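(* Let $X$ be a Euclidean space, let $M \subset X$ be a set that is a $C^2$-smooth manifold around a point $\bar x \in M$, and let $f : X \to \mathbf{R}$ be an $L$-Lipschitz function ($L>0$) that grows robustly relative to $M$ at $\bar x$ and has tempered growth at $\bar x$ relative to $M$. Then, for any sufficiently small multiplier $\beta > 0$, if the initial point $x_0$ is sufficiently close to $\bar x$, the sequence $(x_r)$ of iterates generated by the Lipschitz minimization algorithm described in the context (with inputs $L$, $x_0$, $\beta$) converges nearly linearly to $\bar x$, in the sense that there exist constants $a,b>0$ such that $|x_r - \bar x| \le a e^{-b\sqrt r}$ for all $r$.
   Context: $X$ is a finite-dimensional Euclidean space with inner product $\langle\cdot,\cdot\rangle$, norm $|\cdot|$ and closed unit ball $B$. For a locally Lipschitz $f : X \to \mathbf{R}$, the Clarke subdifferential $\partial f(x)$ is the closed convex hull of all limits $\lim_r \nabla f(x_r)$ arising from sequences $x_r \to x$ of points of differentiability. For $\epsilon \ge 0$, $\partial_\epsilon f(x) = \mathrm{conv}\big(\bigcup_{y \in x + \epsilon B} \partial f(y)\big)$, and the Goldstein subgradient $g_\epsilon(x)$ is the shortest vector in $\partial_\epsilon f(x)$. Algorithm. Input: Lipschitz constant $L$, initial point $x_0$, multiplier $\beta>0$. At iteration $r=0,1,2,\ldots$ with current point $x=x_r$: set $\epsilon = \frac12 L$; while $|g_\epsilon(x)| \le \epsilon$, replace $\epsilon$ by $\frac12\epsilon$; once this loop ends, replace $\epsilon$ by $\beta\epsilon$, set $g = g_\epsilon(x)$, and set $x_{r+1} = x - \epsilon\frac{g}{|g|}$.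 (If an iterate equals $\bar x$, the inner loop never ends; the sequence is then regarded as stopping at $\bar x$.) The function $f$ is subdifferentially regular at $x$ when $\lim_{t \downarrow 0} \frac1t (f(x+ty)-f(x)) = \max_{v \in \partial f(x)} \langle v,y\rangle$ for all $y \in X$. For $x$ near $\bar x$, $P_M(x)$ is the unique nearest point to $x$ in $M$, and $d_M(x)$ is the distance from $x$ to $M$. Robust growth: $f$ grows robustly relative to $M$ at $\bar x$ when: (1) there is $\delta > 0$ with $f(x) - f(\bar x) \ge \frac{\delta}{2}|x - \bar x|^2$ for all $x$ near $\bar x$; (2) $f$ is subdifferentially regular at every point of $M$; (3) the restriction $f_M : M \to \mathbf{R}$ is $C^2$-smooth; (4) there is $K > 0$ such that all $x,y$ near $\bar x$ with $x \in M$ satisfy $\partial f(y) \subset \partial f(x) + K|x-y|B$; (5) there is $\mu > 0$ such that all $x \in X$ near $\bar x$ and all $v \in \partial f(x)$ satisfy $\langle v, x - P_M(x)\rangle \ge \mu\, d_M(x)$. Tempered growth: assuming $f_M$ is $C^2$-smooth, let $\nabla f_M(x)$ (for $x \in M$ near $\bar x$) be its Riemannian gradient, viewed as a vector in the tangent space $T_M(x) \subset X$. $f$ has tempered growth at $\bar x$ relative to $M$ if, given any angle $\theta > 0$, for any sufficiently small $\beta > 0$ and any sequences of points $\bar x \ne x_r \to \bar x$ and radii $0 \le \epsilon_r \le \beta|x_r - \bar x|$ whose Goldstein subgradients $g_{\epsilon_r}(x_r)$ converge to zero, the vectors $g_{\epsilon_r}(x_r)$ and $\nabla f_M(P_M(x_r))$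 are, for all large $r$, nonzero and subtend an angle less than $\theta$. *)

theory Defs
  imports "HOL-Analysis.Analysis" "HOL-Library.While_Combinator"
begin

section \<open>Clarke and Goldstein subdifferentials\<close>

definition clarke_subdifferential :: "('a::euclidean_space \<Rightarrow> real) \<Rightarrow> 'a \<Rightarrow> 'a set" where
  "clarke_subdifferential f x =
     closure (convex hull {v. \<exists>y g. y \<longlonglongrightarrow> x \<and> (\<forall>r::nat. GDERIV f (y r) :> g r) \<and> g \<longlonglongrightarrow> v})"

definition goldstein_subdifferential ::
    "('a::euclidean_space \<Rightarrow> real) \<Rightarrow> real \<Rightarrow> 'a \<Rightarrow> 'a set" where
  "goldstein_subdifferential f \<epsilon> x = convex hull (\<Union>y\<in>cball x \<epsilon>. clarke_subdifferential f y)"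

definition goldstein_subgradient ::
    "('a::euclidean_space \<Rightarrow> real) \<Rightarrow> real \<Rightarrow> 'a \<Rightarrow> 'a" where
  "goldstein_subgradient f \<epsilon> x = closest_point (goldstein_subdifferential f \<epsilon> x) 0"

text \<open>The vector \<open>v\<close> below is a maximizer of \<open>w \<mapsto> \<langle>w,y\<rangle>\<close> over the Clarke subdifferential.\<close>

definition subdifferentially_regular :: "('a::euclidean_space \<Rightarrow> real) \<Rightarrow> 'a \<Rightarrow> bool" where
  "subdifferentially_regular f x \<longleftrightarrow>
     (\<forall>y. \<exists>v\<in>clarke_subdifferential f x.
        (\<forall>w\<in>clarke_subdifferential f x. w \<bullet> y \<le> v \<bullet> y) \<and>
        ((\<lambda>t. (f (x + t *\<^sub>R y) - f x) / t) \<longlongrightarrow> v \<bullet> y) (at_right 0))"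


section \<open>Smooth manifolds and functions on them\<close>

definition C2_on :: "'a set \<Rightarrow> ('a::euclidean_space \<Rightarrow> 'b::euclidean_space) \<Rightarrow> bool" where
  "C2_on U F \<longleftrightarrow> open U \<and>
     (\<exists>(F' :: 'a \<Rightarrow> 'a \<Rightarrow>\<^sub>L 'b) (F'' :: 'a \<Rightarrow> 'a \<Rightarrow>\<^sub>L 'a \<Rightarrow>\<^sub>L 'b).
        (\<forall>x\<in>U. (F has_derivative blinfun_apply (F' x)) (at x)) \<and>
        (\<forall>x\<in>U. (F' has_derivative blinfun_apply (F'' x)) (at x)) \<and>
        continuous_on U F'')"

text \<open>A \<open>C\<^sup>2\<close> diffeomorphism between open sets flattens \<open>M\<close> near \<open>x\<close> onto an open piece of a
  linear subspace.\<close>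

definition C2_manifold_around :: "'a::euclidean_space set \<Rightarrow> 'a \<Rightarrow> bool" where
  "C2_manifold_around M x \<longleftrightarrow> x \<in> M \<and>
     (\<exists>U V S \<phi> \<psi>. x \<in> U \<and> C2_on U (\<phi> :: 'a \<Rightarrow> 'a) \<and> C2_on V \<psi> \<and> homeomorphism U V \<phi> \<psi> \<and>
        subspace S \<and> \<phi> ` (M \<inter> U) = S \<inter> V)"

definition C2_on_manifold_around :: "'a set \<Rightarrow> ('a::euclidean_space \<Rightarrow> real) \<Rightarrow> 'a \<Rightarrow> bool" where
  "C2_on_manifold_around M f x \<longleftrightarrow>
     (\<exists>U F. x \<in> U \<and> C2_on U F \<and> (\<forall>y\<in>M \<inter> U. F y = f y))"

definition C1_curve_at :: "'a::euclidean_space set \<Rightarrow> 'a \<Rightarrow> (real \<Rightarrow> 'a) \<Rightarrow> bool" where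
  "C1_curve_at M x \<gamma> \<longleftrightarrow> \<gamma> 0 = x \<and>
     (\<exists>e>0. \<gamma> C1_differentiable_on {-e<..<e} \<and> \<gamma> ` {-e<..<e} \<subseteq> M)"

definition tangent_space :: "'a::euclidean_space set \<Rightarrow> 'a \<Rightarrow> 'a set" where
  "tangent_space M x = {vector_derivative \<gamma> (at 0) |\<gamma>. C1_curve_at M x \<gamma>}"

text \<open>The tangent vector \<open>g\<close> that represents the differential of \<open>f\<close> restricted to \<open>M\<close>: only the
  values of \<open>f\<close> on \<open>M\<close> matter, through its derivatives along curves in \<open>M\<close>.\<close>

definition riemannian_gradient ::
    "'a::euclidean_space set \<Rightarrow> ('a \<Rightarrow> real) \<Rightarrow> 'a \<Rightarrow> 'a" where
  "riemannian_gradient M f x =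
     (THE g. g \<in> tangent_space M x \<and>
        (\<forall>\<gamma>. C1_curve_at M x \<gamma> \<longrightarrow>
           ((f \<circ> \<gamma>) has_real_derivative g \<bullet> vector_derivative \<gamma> (at 0)) (at 0)))"


section \<open>Growth conditions\<close>

text \<open>In the last condition, \<open>closest_point M x\<close> is the projection of \<open>x\<close> onto \<open>M\<close>, which exists
  uniquely for \<open>x\<close> near \<open>xbar\<close>.\<close>

definition grows_robustly ::
    "('a::euclidean_space \<Rightarrow> real) \<Rightarrow> 'a set \<Rightarrow> 'a \<Rightarrow> bool" where
  "grows_robustly f M xbar \<longleftrightarrow>
     (\<exists>\<delta>>0. \<forall>\<^sub>F x in nhds xbar. f x - f xbar \<ge> \<delta> / 2 * (norm (x - xbar))\<^sup>2) \<and>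
     (\<forall>x\<in>M. subdifferentially_regular f x) \<and>
     C2_on_manifold_around M f xbar \<and>
     (\<exists>K>0. \<forall>\<^sub>F (x, y) in nhds xbar \<times>\<^sub>F nhds xbar. x \<in> M \<longrightarrow>
        clarke_subdifferential f y \<subseteq>
          {u + w |u w. u \<in> clarke_subdifferential f x \<and> w \<in> cball 0 (K * norm (x - y))}) \<and>
     (\<exists>\<mu>>0. \<forall>\<^sub>F x in nhds xbar. \<forall>v\<in>clarke_subdifferential f x.
        v \<bullet> (x - closest_point M x) \<ge> \<mu> * infdist x M)"

text \<open>Meaningful for nonzero vectors only.\<close>

definition vector_angle :: "'a::euclidean_space \<Rightarrow> 'a \<Rightarrow> real" where
  "vector_angle u v = arccos ((u \<bullet> v) / (norm u * norm v))"

definition tempered_growth ::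
    "('a::euclidean_space \<Rightarrow> real) \<Rightarrow> 'a set \<Rightarrow> 'a \<Rightarrow> bool" where
  "tempered_growth f M xbar \<longleftrightarrow>
     (\<forall>\<theta>>0. \<forall>\<^sub>F \<beta> in at_right 0. \<forall>(x :: nat \<Rightarrow> 'a) \<epsilon>.
        (\<forall>r. x r \<noteq> xbar) \<and> x \<longlonglongrightarrow> xbar \<and>
        (\<forall>r. 0 \<le> \<epsilon> r \<and> \<epsilon> r \<le> \<beta> * norm (x r - xbar)) \<and>
        (\<lambda>r. goldstein_subgradient f (\<epsilon> r) (x r)) \<longlonglongrightarrow> 0 \<longrightarrow>
        (\<forall>\<^sub>F r in sequentially.
           goldstein_subgradient f (\<epsilon> r) (x r) \<noteq> 0 \<and>
           riemannian_gradient M f (closest_point M (x r)) \<noteq> 0 \<and>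
           vector_angle (goldstein_subgradient f (\<epsilon> r) (x r))
             (riemannian_gradient M f (closest_point M (x r))) < \<theta>))"


section \<open>The algorithm\<close>

text \<open>\<open>None\<close> means that the inner loop runs forever; the iteration then stays at the current
  point. This happens in particular at a minimizer.\<close>

definition lipschitz_min_step ::
    "('a::euclidean_space \<Rightarrow> real) \<Rightarrow> real \<Rightarrow> real \<Rightarrow> 'a \<Rightarrow> 'a" where
  "lipschitz_min_step f L \<beta> x =
     (case while_option (\<lambda>\<epsilon>. norm (goldstein_subgradient f \<epsilon> x) \<le> \<epsilon>) (\<lambda>\<epsilon>. \<epsilon> / 2) (L / 2) of
        None \<Rightarrow> x
      | Some \<epsilon> \<Rightarrow>
          let \<epsilon>' = \<beta> * \<epsilon>; g = goldstein_subgradient f \<epsilon>' x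
          in x - (\<epsilon>' / norm g) *\<^sub>R g)"

definition lipschitz_min_iterates ::
    "('a::euclidean_space \<Rightarrow> real) \<Rightarrow> real \<Rightarrow> real \<Rightarrow> 'a \<Rightarrow> nat \<Rightarrow> 'a" where
  "lipschitz_min_iterates f L \<beta> x0 r = (lipschitz_min_step f L \<beta> ^^ r) x0"

end

theory Submission
  imports Defs
begin

text \<open>The Goldstein step decreases \<open>f\<close> by at least \<open>\<epsilon> |g|\<close>. Near \<open>xbar\<close> the inner loop stops with \<open>\<epsilon>\<close>
  comparable to \<open>d = |x - xbar|\<close>: on \<open>M\<close> the tangential part of every subgradient is the Riemannian gradient,
  whose norm is at least a multiple of the distance to \<open>xbar\<close> by quadratic growth, and off \<open>M\<close> the normal part
  of the subgradients is bounded away from zero. If \<open>g\<close> is not small, the step therefore decreases \<open>f\<close> by a multiple of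
  \<open>d\<close>, hence contracts \<open>f x - f xbar\<close>, which is at most \<open>L d\<close>. If \<open>g\<close> is small, tempered growth aligns it with the
  Riemannian gradient, and the step contracts \<open>d\<close>. As \<open>f x - f xbar\<close> is also at least a multiple of \<open>d\<^sup>2\<close>,
  at most logarithmically many steps of the second kind are possible between two
  steps of the first kind, whence the exponent \<open>sqrt r\<close> in the rate.

  Nonemptiness of the Clarke subdifferential and the descent inequality rest on Rademacher's theorem: the
  exceptional sets for directional derivatives are null on each line, hence null, and the directional derivative is
  almost everywhere additive in the direction because its integrals over boxes are.\<close>

section \<open>One-dimensional slopes of Lipschitz functions\<close>

text \<open>Neither measure of progress improves in every step: a step of the first kind may double
  \<open>d\<close>, and one of the second kind is only known not to increase \<open>f\<close>. If
  the gap \<open>f x - f xbar\<close> has size exp(-l), then \<open>d\<close> lies between multiples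
  of exp(-l) and exp(-l/2), so a run of second-kind steps that leaves l nearly unchanged has length
  O(l). Reaching level l thus takes O(l^2) steps. A segment is a null set in dimension at least 2,
  so \<open>f\<close> may be differentiable nowhere along a step. Hence the mean value inequality
  speaks of gradients near the segment, and the descent estimate keeps a margin inside the Goldstein
  ball. Points of one Goldstein ball have different projections onto \<open>M\<close>, so chords and
  tangent spaces are compared uniformly in both endpoints. Order of constants: the angle
  \<open>\<theta>\<close> and the bound on \<open>\<beta>\<close> depend on the growth constants
  alone. Only for fixed \<open>\<theta>\<close> and \<open>\<beta>\<close> does tempered growth give
  the threshold \<open>\<sigma>\<close> between small and large subgradients, and the contraction
  factor comes last.\<close>

lemma strict_mono_image_measure_le:
  fixes F :: "real \<Rightarrow> real"
  assumes F: "strict_mono F" "C-lipschitz_on UNIV F" and "p > 0"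
    and E: "E \<in> sets lebesgue" "F ` E \<in> sets lebesgue"
    and slope: "\<And>t \<eta>. t \<in> E \<Longrightarrow> \<eta> > 0 \<Longrightarrow>
      \<exists>a b. a < t \<and> t < b \<and> b - a < \<eta> \<and> F b - F a < p * (b - a)"
  shows "emeasure lebesgue (F ` E) \<le> ennreal p * emeasure lebesgue E"
proof -
  have le: "emeasure lebesgue (F ` E) \<le> ennreal p * (emeasure lebesgue E + ennreal e)" if "e > 0" for e
  proof -
    obtain T where T: "open T" "E \<subseteq> T" "T - E \<in> lmeasurable" "emeasure lebesgue (T - E) < ennreal e"
      using sets_lebesgue_outer_open[OF E(1) \<open>e > 0\<close>] by metis
    define K where "K = {(a, b). a < b \<and> {a<..<b} \<subseteq> T \<and> F b - F a < p * (b - a)}"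
    define ctr where "ctr i = (fst i + snd i) / 2" for i :: "real \<times> real"
    define rad where "rad i = (snd i - fst i) / 2" for i :: "real \<times> real"
    have ball: "ball (ctr i) (rad i) = {fst i<..<snd i}" for i
      by (auto simp: ctr_def rad_def ball_eq_greaterThanLessThan field_simps)
    have cover: "\<exists>i. i \<in> K \<and> t \<in> ball (ctr i) (rad i) \<and> rad i < d" if "t \<in> E" "0 < d" for t d
    proof -
      obtain r where r: "r > 0" "ball t r \<subseteq> T"
        using T \<open>t \<in> E\<close> by (meson openE subsetD)
      obtain a b where ab: "a < t" "t < b" "b - a < min r d" "F b - F a < p * (b - a)"
        using slope[OF \<open>t \<in> E\<close>, of "min r d"] r \<open>0 < d\<close> by auto
      have "{a<..<b} \<subseteq> ball t r"
        using ab by (auto simp: dist_real_def)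
      with r ab have "(a, b) \<in> K"
        by (auto simp: K_def)
      then show ?thesis
        using ab by (intro exI[of _ "(a, b)"]) (auto simp: ball, auto simp: rad_def)
    qed
    \<comment> \<open>Vitali: disjoint intervals of slope below \<open>p\<close>, all inside the
      slightly larger open set \<open>T\<close>, cover almost all of \<open>E\<close>. Monotonicity
      keeps their images disjoint, so the image lengths add up to at most \<open>p\<close> times the
      measure of \<open>T\<close>; the uncovered null set has a null image because \<open>F\<close>
      is Lipschitz.\<close>
    obtain I where I: "countable I" "I \<subseteq> K"
      "pairwise (\<lambda>i j. disjnt (ball (ctr i) (rad i)) (ball (ctr j) (rad j))) I"
      "negligible (E - (\<Union>i\<in>I. ball (ctr i) (rad i)))"
      using Vitali_covering_theorem_balls[of E K ctr rad, OF cover] by blast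
    have lt: "fst i < snd i" "{fst i<..<snd i} \<subseteq> T" "F (snd i) - F (fst i) < p * (snd i - fst i)" if "i \<in> I" for i
      using that I(2) by (cases i; fastforce simp: K_def)+
    have sep: "snd i \<le> fst j \<or> snd j \<le> fst i" if "i \<in> I" "j \<in> I" "i \<noteq> j" for i j
    proof (rule ccontr)
      assume "\<not> ?thesis"
      then have "max (fst i) (fst j) < min (snd i) (snd j)"
        using lt(1) that by auto
      then obtain z where "max (fst i) (fst j) < z" "z < min (snd i) (snd j)"
        using dense by blast
      moreover have "disjnt {fst i<..<snd i} {fst j<..<snd j}"
        using I(3) that by (auto simp: pairwise_def ball)
      ultimately show False
        by (auto simp: disjnt_def)
    qed
    have disj1: "disjoint_family_on (\<lambda>i. {fst i<..<snd i}) I"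
      using sep by (force simp: disjoint_family_on_def)
    have disj2: "disjoint_family_on (\<lambda>i. {F (fst i)<..<F (snd i)}) I"
    proof -
      have "F (snd i) \<le> F (fst j) \<or> F (snd j) \<le> F (fst i)" if "i \<in> I" "j \<in> I" "i \<noteq> j" for i j
        using sep[OF that] F(1) by (auto simp: strict_mono_less_eq)
      then show ?thesis
        by (force simp: disjoint_family_on_def)
    qed
    define N where "N = F ` (E - (\<Union>i\<in>I. {fst i<..<snd i}))"
    have "negligible N"
      unfolding N_def
    proof (rule negligible_locally_Lipschitz_image)
      show "negligible (E - (\<Union>i\<in>I. {fst i<..<snd i}))"
        using I(4) by (simp add: ball)
      show "\<exists>T B. open T \<and> x \<in> T \<and> (\<forall>y\<in>(E - (\<Union>i\<in>I. {fst i<..<snd i})) \<inter> T. norm (F y - F x) \<le> B * norm (y - x))" for x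
        using lipschitz_onD[OF F(2)] by (intro exI[of _ UNIV] exI[of _ C]) (auto simp: dist_norm)
    qed auto
    then have N: "emeasure lebesgue N = 0" "N \<in> sets lebesgue"
      by (auto simp: negligible_iff_null_sets)
    let ?J = "\<Union>i\<in>I. {F (fst i)<..<F (snd i)}"
    have sub: "F ` E \<subseteq> N \<union> ?J"
      using F(1) by (force simp: N_def strict_mono_less)
    have J: "?J \<in> sets lebesgue"
      using I(1) by (intro sets.countable_UN') auto
    have "emeasure lebesgue (F ` E) \<le> emeasure lebesgue (N \<union> ?J)"
      using sub N J by (intro emeasure_mono) auto
    also have "\<dots> \<le> emeasure lebesgue N + emeasure lebesgue ?J"
      using N J by (intro emeasure_subadditive) auto
    also have "\<dots> = (\<integral>\<^sup>+i. emeasure lebesgue {F (fst i)<..<F (snd i)} \<partial>count_space I)"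
      using I(1) disj2 N by (subst emeasure_UN_countable) auto
    also have "\<dots> \<le> (\<integral>\<^sup>+i. ennreal p * emeasure lebesgue {fst i<..<snd i} \<partial>count_space I)"
    proof (rule nn_integral_mono)
      fix i assume "i \<in> space (count_space I)"
      then have i: "i \<in> I" by simp
      have "F (fst i) \<le> F (snd i)"
        using lt(1)[OF i] F(1) by (simp add: strict_mono_less_eq)
      then show "emeasure lebesgue {F (fst i)<..<F (snd i)} \<le> ennreal p * emeasure lebesgue {fst i<..<snd i}"
        using lt(1,3)[OF i] \<open>p > 0\<close> by (simp flip: ennreal_mult add: ennreal_leI)
    qed
    also have "\<dots> = ennreal p * emeasure lebesgue (\<Union>i\<in>I. {fst i<..<snd i})"
      using I(1) disj1 by (subst emeasure_UN_countable) (auto simp: nn_integral_cmult)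
    also have "\<dots> \<le> ennreal p * emeasure lebesgue T"
      using lt(2) T(1) by (intro mult_left_mono emeasure_mono) auto
    also have "emeasure lebesgue T \<le> emeasure lebesgue E + emeasure lebesgue (T - E)"
      using T(2,3) E(1) emeasure_subadditive[of E lebesgue "T - E"]
      by (simp add: Un_absorb1 fmeasurableD)
    also have "\<dots> \<le> emeasure lebesgue E + ennreal e"
      using T(4) by (intro add_left_mono) auto
    finally show ?thesis by (simp add: mult_left_mono)
  qed
  show ?thesis
  proof (rule tendsto_lowerbound[of _ _ "at_right 0"])
    have "((\<lambda>e. ennreal p * (emeasure lebesgue E + ennreal e)) \<longlongrightarrow> ennreal p * (emeasure lebesgue E + ennreal 0)) (at_right 0)"
      by (intro tendsto_mult_ennreal tendsto_intros tendsto_ennrealI) (use \<open>p > 0\<close> in auto)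
    then show "((\<lambda>e. ennreal p * (emeasure lebesgue E + ennreal e)) \<longlongrightarrow> ennreal p * emeasure lebesgue E) (at_right 0)"
      by simp
    show "\<forall>\<^sub>F e in at_right 0. emeasure lebesgue (F ` E) \<le> ennreal p * (emeasure lebesgue E + ennreal e)"
      using le by (auto simp: eventually_at_right_less eventually_at_filter)
  qed auto
qed

text \<open>Slopes over intervals straddling the point make this a \<open>G\<^sub>\<delta>\<close> set.\<close>

definition slope_gap_set :: "('a::real_normed_vector \<Rightarrow> real) \<Rightarrow> 'a \<Rightarrow> real \<Rightarrow> real \<Rightarrow> 'a set" where
  "slope_gap_set f v p q = {x. \<forall>\<eta>>0.
     (\<exists>a b. a < 0 \<and> 0 < b \<and> b - a < \<eta> \<and> f (x + b *\<^sub>R v) - f (x + a *\<^sub>R v) < p * (b - a)) \<and>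
     (\<exists>a b. a < 0 \<and> 0 < b \<and> b - a < \<eta> \<and> f (x + b *\<^sub>R v) - f (x + a *\<^sub>R v) > q * (b - a))}"

lemma slope_gap_set_borel:
  fixes f :: "'a::real_normed_vector \<Rightarrow> real"
  assumes "continuous_on UNIV f"
  shows "slope_gap_set f v p q \<in> sets borel"
proof -
  let ?A = "\<lambda>\<eta>. \<Union>(a, b)\<in>{(a, b). a < 0 \<and> 0 < b \<and> b - a < \<eta>}. {x. f (x + b *\<^sub>R v) - f (x + a *\<^sub>R v) < p * (b - a)}"
  let ?B = "\<lambda>\<eta>. \<Union>(a, b)\<in>{(a, b). a < 0 \<and> 0 < b \<and> b - a < \<eta>}. {x. f (x + b *\<^sub>R v) - f (x + a *\<^sub>R v) > q * (b - a)}"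
  have cont: "continuous_on UNIV (\<lambda>x. f (x + c *\<^sub>R v))" for c
    by (rule continuous_on_compose2[OF assms]) (auto intro!: continuous_intros)
  have op: "open (?A \<eta>)" "open (?B \<eta>)" for \<eta>
    by (auto intro!: open_UN open_Collect_less continuous_intros cont)
  have anti: "?A \<eta> \<subseteq> ?A \<eta>'" "?B \<eta> \<subseteq> ?B \<eta>'" if "\<eta> \<le> \<eta>'" for \<eta> \<eta>'
    using that by force+
  have "slope_gap_set f v p q = (\<Inter>\<eta>\<in>{0<..}. ?A \<eta> \<inter> ?B \<eta>)"
    unfolding slope_gap_set_def by auto
  also have "\<dots> = (\<Inter>n. ?A (1 / Suc n) \<inter> ?B (1 / Suc n))"
  proof (intro antisym subsetI)
    fix x assume x: "x \<in> (\<Inter>n. ?A (1 / Suc n) \<inter> ?B (1 / Suc n))"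
    show "x \<in> (\<Inter>\<eta>\<in>{0<..}. ?A \<eta> \<inter> ?B \<eta>)"
    proof (intro INT_I)
      fix \<eta> :: real assume "\<eta> \<in> {0<..}"
      then obtain n where n: "1 / Suc n < \<eta>"
        by (metis greaterThan_iff nat_approx_posE)
      have "x \<in> ?A (1 / Suc n) \<inter> ?B (1 / Suc n)" using x by blast
      then show "x \<in> ?A \<eta> \<inter> ?B \<eta>"
        using anti[of "1 / Suc n" \<eta>] n by (meson Int_mono less_imp_le subsetD)
    qed
  qed auto
  also have "\<dots> \<in> sets borel"
    by (intro sets.countable_INT'' sets.Int borel_open op) auto
  finally show ?thesis .
qed

text \<open>Adding \<open>(L + 1) * t\<close> makes \<open>h\<close> strictly increasing with slopes
  between 1 and \<open>2 * L + 1\<close>, hence invertible with a 1-Lipschitz inverse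
  \<open>G\<close>. The small slopes of \<open>F\<close> bound the measure of the image of a set by
  \<open>p + L + 1\<close> times its measure; the large slopes, read as small slopes of
  \<open>G\<close>, bound the set by \<open>1 / (q + L + 1)\<close> times its image. As
  \<open>p < q\<close>, both hold only for measure 0.\<close>

lemma slope_gap_set_null_real:
  fixes h :: "real \<Rightarrow> real"
  assumes h: "L-lipschitz_on UNIV h" and "p < q"
  shows "slope_gap_set h 1 p q \<in> null_sets lborel"
proof -
  have L0: "L \<ge> 0" using h lipschitz_on_nonneg by blast
  define F where "F t = h t + (L + 1) * t" for t
  have hd: "\<bar>h t - h s\<bar> \<le> L * (t - s)" if "s \<le> t" for s t
    using lipschitz_onD[OF h, of s t] that by (auto simp: dist_real_def)
  have F1: "t - s \<le> F t - F s" if "s \<le> t" for s t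
    using hd[OF that] by (auto simp: F_def algebra_simps)
  have F2: "F t - F s \<le> (2 * L + 1) * (t - s)" if "s \<le> t" for s t
    using hd[OF that] by (auto simp: F_def algebra_simps)
  have smF: "strict_mono F"
    by (rule strict_monoI) (smt (verit) F1)
  have lipF: "(2 * L + 1)-lipschitz_on UNIV F"
  proof (rule lipschitz_onI)
    fix s t show "dist (F s) (F t) \<le> (2 * L + 1) * dist s t"
      using F1[of s t] F1[of t s] F2[of s t] F2[of t s] by (auto simp: dist_real_def abs_if)
  qed (use L0 in auto)
  have contF: "continuous_on UNIV F"
    using lipF lipschitz_on_continuous_on by blast
  have surjF: "\<exists>t. F t = y" for y
  proof -
    define c where "c = \<bar>y - F 0\<bar>"
    have "F (- c) \<le> y" "y \<le> F c"
      using F1[of 0 c] F1[of "-c" 0] by (auto simp: c_def)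
    then show ?thesis
      using IVT'[of F "-c" y c] contF by (auto simp: c_def intro: continuous_on_subset)
  qed
  define G where "G = inv F"
  have FG: "F (G y) = y" for y
    unfolding G_def using surjF by (metis f_inv_into_f rangeI)
  have GF: "G (F t) = t" for t
    unfolding G_def using smF by (simp add: strict_mono_eq inv_f_f strict_mono_imp_inj_on)
  have smG: "strict_mono G"
    by (rule strict_monoI) (metis FG smF strict_mono_less)
  have lipG: "1-lipschitz_on UNIV G"
  proof (rule lipschitz_onI)
    fix y z show "dist (G y) (G z) \<le> 1 * dist y z"
      using F1[of "G y" "G z"] F1[of "G z" "G y"] by (auto simp: dist_real_def FG abs_if)
  qed auto
  have contG: "continuous_on UNIV G"
    using lipG lipschitz_on_continuous_on by blast
  define S where "S = slope_gap_set h 1 p q"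
  have S: "S \<in> sets borel"
    unfolding S_def using h lipschitz_on_continuous_on by (intro slope_gap_set_borel) blast
  have lo: "\<exists>a b. a < t \<and> t < b \<and> b - a < \<eta> \<and> F b - F a < (p + L + 1) * (b - a)"
    if t: "t \<in> S" "\<eta> > 0" for t \<eta>
  proof -
    obtain a b where "a < 0" "0 < b" "b - a < \<eta>" "h (t + b) - h (t + a) < p * (b - a)"
      using t by (force simp: S_def slope_gap_set_def)
    then show ?thesis
      by (intro exI[of _ "t + a"] exI[of _ "t + b"]) (auto simp: F_def algebra_simps)
  qed
  have hi: "\<exists>a b. a < t \<and> t < b \<and> b - a < \<eta> \<and> F b - F a > (q + L + 1) * (b - a)"
    if t: "t \<in> S" "\<eta> > 0" for t \<eta>
  proof -
    obtain a b where "a < 0" "0 < b" "b - a < \<eta>" "h (t + b) - h (t + a) > q * (b - a)"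
      using t by (force simp: S_def slope_gap_set_def)
    then show ?thesis
      by (intro exI[of _ "t + a"] exI[of _ "t + b"]) (auto simp: F_def algebra_simps)
  qed
  show ?thesis
  \<comment> \<open>A point of \<open>S\<close> is needed for the sign of \<open>p + L + 1\<close>:
    this number exceeds some slope of \<open>F\<close>, and all slopes of \<open>F\<close> are at
    least 1.\<close>
  proof (cases "S = {}")
    case True then show ?thesis by (simp add: S_def)
  next
    case False
    then obtain t where "t \<in> S" by blast
    then obtain a b where "a < t" "t < b" "F b - F a < (p + L + 1) * (b - a)"
      using lo[of t 1] by auto
    then have p0: "p + L + 1 > 0"
      using F1[of a b] by (smt (verit) mult_nonpos_nonneg)
    have q0: "q + L + 1 > 0" using p0 \<open>p < q\<close> by simp
    \<comment> \<open>Bounded pieces have finite measure, so the final inequality can be read in the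
      reals and the measure cancelled.\<close>
    define SN where "SN n = S \<inter> {- real n<..<real n}" for n
    have SNb: "SN n \<in> sets borel" for n
      using S by (auto simp: SN_def)
    have im: "F ` SN n = G -` SN n" for n
      using FG GF by (auto simp: image_iff) (metis)
    have imb: "F ` SN n \<in> sets borel" for n
      unfolding im using measurable_sets[OF borel_measurable_continuous_onI[OF contG] SNb] by simp
    have e1: "emeasure lebesgue (F ` SN n) \<le> ennreal (p + L + 1) * emeasure lebesgue (SN n)" for n
      using strict_mono_image_measure_le[OF smF lipF, of "p + L + 1" "SN n"] p0 SNb imb lo
      by (auto simp: SN_def)
    have e2: "emeasure lebesgue (G ` (F ` SN n)) \<le> ennreal (1 / (q + L + 1)) * emeasure lebesgue (F ` SN n)" for n
    proof (rule strict_mono_image_measure_le[OF smG lipG])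
      show "G ` F ` SN n \<in> sets lebesgue"
        using SNb by (simp add: image_comp comp_def GF)
      fix y \<eta> :: real assume y: "y \<in> F ` SN n" "\<eta> > 0"
      then obtain t where t: "t \<in> S" "y = F t" by (auto simp: SN_def)
      have "\<eta> / (2 * L + 1) > 0" using y L0 by simp
      from hi[OF t(1) this] obtain a b where ab: "a < t" "t < b" "b - a < \<eta> / (2 * L + 1)" "F b - F a > (q + L + 1) * (b - a)"
        by blast
      have "F b - F a \<le> (2 * L + 1) * (b - a)" using F2[of a b] ab by simp
      also have "\<dots> < \<eta>" using ab L0 by (simp add: field_simps)
      finally have "F b - F a < \<eta>" .
      moreover have "b - a < 1 / (q + L + 1) * (F b - F a)"
        using ab q0 by (simp add: field_simps)
      ultimately show "\<exists>a b. a < y \<and> y < b \<and> b - a < \<eta> \<and> G b - G a < 1 / (q + L + 1) * (b - a)"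
        using ab smF t by (intro exI[of _ "F a"] exI[of _ "F b"]) (auto simp: GF strict_mono_less)
    qed (use q0 imb in auto)
    have "emeasure lborel (SN n) = 0" for n
    proof -
      have "emeasure lborel (SN n) \<le> emeasure lborel {- real n<..<real n}"
        by (intro emeasure_mono) (auto simp: SN_def)
      also have "\<dots> < \<infinity>" by simp
      finally obtain m where m: "emeasure lborel (SN n) = ennreal m" "m \<ge> 0"
        by (metis ennreal_cases infinity_ennreal_def less_irrefl)
      have "emeasure lebesgue (SN n) \<le> ennreal (1 / (q + L + 1)) * (ennreal (p + L + 1) * emeasure lebesgue (SN n))"
        using e2[of n] mult_left_mono[OF e1[of n], of "ennreal (1 / (q + L + 1))"]
        by (auto simp: image_comp comp_def GF intro: order_trans)
      then have "ennreal m \<le> ennreal (1 / (q + L + 1) * ((p + L + 1) * m))"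
        using p0 q0 m SNb ennreal_mult[of "1 / (q + L + 1)" "(p + L + 1) * m"] ennreal_mult[of "p + L + 1" m]
        by (auto simp del: ennreal_le_iff)
      moreover have "0 \<le> 1 / (q + L + 1) * ((p + L + 1) * m)"
        using p0 q0 m(2) by simp
      ultimately have "m \<le> 1 / (q + L + 1) * ((p + L + 1) * m)"
        using ennreal_le_iff by metis
      then have "(q - p) * m \<le> 0"
        using q0 by (simp add: field_simps)
      then have "m \<le> 0" using \<open>p < q\<close> by (simp add: mult_le_0_iff)
      then show ?thesis using m by simp
    qed
    then have "SN n \<in> null_sets lborel" for n
      using SNb by (auto simp: null_sets_def)
    then have "(\<Union>n. SN n) \<in> null_sets lborel" by blast
    moreover have "(\<Union>n. SN n) = S"
    proof -
      have "\<exists>n. - real n < t \<and> t < real n" for t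
        using reals_Archimedean2[of "\<bar>t\<bar>"] by (auto simp: abs_less_iff) (metis minus_less_iff)
      then show ?thesis by (auto simp: SN_def)
    qed
    ultimately show ?thesis by (simp add: S_def)
  qed
qed

text \<open>Fubini without coordinates adapted to \<open>v\<close>: by translation invariance the
  measure of the set is the average over t in [0,1] of the measures of its translates by t v. After
  exchanging the integrals the inner one runs along a line, where the one-dimensional result
  applies.\<close>

lemma slope_gap_set_null:
  fixes f :: "'a::euclidean_space \<Rightarrow> real"
  assumes f: "L-lipschitz_on UNIV f" and "p < q"
  shows "slope_gap_set f v p q \<in> null_sets lborel"
proof -
  define A where "A = slope_gap_set f v p q"
  have A[measurable]: "A \<in> sets borel"
    unfolding A_def using f lipschitz_on_continuous_on by (intro slope_gap_set_borel) blast
  have slice: "{t. x + t *\<^sub>R v \<in> A} \<in> null_sets lborel" for x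
  proof -
    have "(L * norm v)-lipschitz_on UNIV (\<lambda>t. f (x + t *\<^sub>R v))"
    proof (rule lipschitz_onI)
      fix s t :: real
      have "dist (f (x + s *\<^sub>R v)) (f (x + t *\<^sub>R v)) \<le> L * dist (x + s *\<^sub>R v) (x + t *\<^sub>R v)"
        using lipschitz_onD[OF f] by blast
      also have "dist (x + s *\<^sub>R v) (x + t *\<^sub>R v) = norm v * dist s t"
        by (simp add: dist_norm flip: scaleR_left_diff_distrib)
      finally show "dist (f (x + s *\<^sub>R v)) (f (x + t *\<^sub>R v)) \<le> L * norm v * dist s t"
        by (simp add: mult.assoc)
    qed (use lipschitz_on_nonneg[OF f] in auto)
    from slope_gap_set_null_real[OF this \<open>p < q\<close>]
    show ?thesis
      by (simp add: A_def slope_gap_set_def scaleR_add_left add.assoc)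
  qed
  have "emeasure lborel A = (\<integral>\<^sup>+t. indicator {0..1::real} t * emeasure lborel A \<partial>lborel)"
    by (simp add: nn_integral_multc)
  also have "\<dots> = (\<integral>\<^sup>+t. (\<integral>\<^sup>+x. indicator {0..1} t * indicator A (x + t *\<^sub>R v) \<partial>lborel) \<partial>lborel)"
  proof (rule nn_integral_cong)
    fix t :: real
    have "emeasure lborel A = (\<integral>\<^sup>+x. indicator A x \<partial>distr lborel borel ((+) (t *\<^sub>R v)))"
      by (simp add: lborel_distr_plus)
    also have "\<dots> = (\<integral>\<^sup>+x. indicator A (x + t *\<^sub>R v) \<partial>lborel)"
      by (subst nn_integral_distr) (auto simp: add.commute)
    finally show "indicator {0..1} t * emeasure lborel A =
        (\<integral>\<^sup>+x. indicator {0..1} t * indicator A (x + t *\<^sub>R v) \<partial>lborel)"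
      by (simp add: nn_integral_cmult)
  qed
  also have "\<dots> = (\<integral>\<^sup>+x. (\<integral>\<^sup>+t. indicator {0..1} t * indicator A (x + t *\<^sub>R v) \<partial>lborel) \<partial>lborel)"
    by (rule lborel_pair.Fubini') measurable
  also have "\<dots> = (\<integral>\<^sup>+(x::'a). 0 \<partial>lborel)"
  proof (rule nn_integral_cong)
    fix x
    have "AE t in lborel. t \<notin> {t. x + t *\<^sub>R v \<in> A}"
      using slice by (rule AE_not_in)
    then have "AE t in lborel. indicator {0..1} t * indicator A (x + t *\<^sub>R v) = (0::ennreal)"
      by eventually_elim (auto simp: indicator_def)
    then show "(\<integral>\<^sup>+t. indicator {0..1} t * indicator A (x + t *\<^sub>R v) \<partial>lborel) = 0"
      by (subst nn_integral_0_iff_AE) auto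
  qed
  finally show ?thesis
    by (auto simp: null_sets_def A_def[symmetric])
qed

section \<open>Directional derivatives almost everywhere\<close>

lemma directional_derivative_exists:
  fixes f :: "'a::real_normed_vector \<Rightarrow> real"
  assumes f: "L-lipschitz_on UNIV f"
    and gap: "\<And>p q. p \<in> \<rat> \<Longrightarrow> q \<in> \<rat> \<Longrightarrow> p < q \<Longrightarrow> x \<notin> slope_gap_set f v p q"
  shows "\<exists>D. ((\<lambda>t. (f (x + t *\<^sub>R v) - f x) / t) \<longlongrightarrow> D) (at 0)"
proof -
  have lip: "\<bar>f (x + b *\<^sub>R v) - f (x + a *\<^sub>R v)\<bar> \<le> L * norm v * (b - a)" if "a \<le> b" for a b
  proof -
    have "\<bar>f (x + b *\<^sub>R v) - f (x + a *\<^sub>R v)\<bar> \<le> L * norm ((b - a) *\<^sub>R v)"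
      using lipschitz_onD[OF f, of "x + b *\<^sub>R v" "x + a *\<^sub>R v"]
      by (simp add: dist_norm algebra_simps)
    then show ?thesis using that by (simp add: mult_ac)
  qed
  define Q where "Q a b = f (x + b *\<^sub>R v) - f (x + a *\<^sub>R v)" for a b
  \<comment> \<open>The supremum of \<open>P\<close> is the lower limit of the slopes over short
    straddling intervals; it is the candidate for the derivative.\<close>
  define P where "P = {p. \<exists>\<eta>>0. \<forall>a b. a < 0 \<and> 0 < b \<and> b - a < \<eta> \<longrightarrow> Q a b \<ge> p * (b - a)}"
  have "- (L * norm v) \<in> P"
    unfolding P_def Q_def using lip by (auto intro!: exI[of _ 1] simp: abs_le_iff) (smt (verit))
  then have Pne: "P \<noteq> {}" by blast
  have Pbd: "p \<le> L * norm v" if "p \<in> P" for p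
  proof -
    obtain \<eta> where \<eta>: "\<eta> > 0" "\<And>a b. a < 0 \<Longrightarrow> 0 < b \<Longrightarrow> b - a < \<eta> \<Longrightarrow> Q a b \<ge> p * (b - a)"
      using \<open>p \<in> P\<close> by (auto simp: P_def)
    let ?c = "\<eta> / 4 - - (\<eta> / 4)"
    have "p * ?c \<le> Q (- (\<eta> / 4)) (\<eta> / 4)"
      using \<eta>(1) by (intro \<eta>(2)) auto
    also have "\<dots> \<le> L * norm v * ?c"
      using lip[of "- (\<eta>/4)" "\<eta>/4"] \<eta>(1) unfolding Q_def by linarith
    finally show ?thesis
      by (rule mult_right_le_imp_le) (use \<eta>(1) in simp)
  qed
  then have bdd: "bdd_above P" by (auto simp: bdd_above_def)
  define D where "D = Sup P"
  have straddle: "\<exists>\<eta>>0. \<forall>a b. a < 0 \<and> 0 < b \<and> b - a < \<eta> \<longrightarrow> \<bar>Q a b - D * (b - a)\<bar> \<le> e * (b - a)" if "e > 0" for e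
  proof -
    obtain p where p: "p \<in> P" "D - e < p"
      unfolding D_def using less_cSupE[of "Sup P - e" P] Pne \<open>e > 0\<close> by auto
    \<comment> \<open>No slope gap fits just above \<open>D\<close>: slopes below \<open>p'\<close>
      occur at every scale since \<open>p' \<notin> P\<close>, so slopes above \<open>q'\<close>
      must stop. Both are rational because \<open>x\<close> avoids only the countably many sets with
      rational parameters.\<close>
    obtain p' where p': "p' \<in> \<rat>" "D < p'" "p' < D + e"
      using Rats_dense_in_real[of D "D + e"] \<open>e > 0\<close> by auto
    obtain q' where q': "q' \<in> \<rat>" "p' < q'" "q' < D + e"
      using Rats_dense_in_real[of p' "D + e"] p' by auto
    have "p' \<notin> P"
      using p' bdd cSup_upper[of p' P] by (auto simp: D_def)
    then have small: "\<exists>a b. a < 0 \<and> 0 < b \<and> b - a < \<eta> \<and> Q a b < p' * (b - a)" if "\<eta> > 0" for \<eta>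
      using that unfolding P_def by (simp add: not_le)
    obtain \<eta>1 where \<eta>1: "\<eta>1 > 0"
      "\<And>a b. a < 0 \<Longrightarrow> 0 < b \<Longrightarrow> b - a < \<eta>1 \<Longrightarrow> Q a b \<le> q' * (b - a)"
    proof (rule ccontr)
      assume "\<not> thesis"
      with that have "\<exists>a b. a < 0 \<and> 0 < b \<and> b - a < \<eta> \<and> Q a b > q' * (b - a)" if "\<eta> > 0" for \<eta>
        using \<open>\<eta> > 0\<close> not_le by blast
      with small have "x \<in> slope_gap_set f v p' q'"
        by (simp add: slope_gap_set_def Q_def)
      with gap[OF p'(1) q'(1,2)] show False by blast
    qed
    obtain \<eta>2 where \<eta>2: "\<eta>2 > 0" "\<And>a b. a < 0 \<Longrightarrow> 0 < b \<Longrightarrow> b - a < \<eta>2 \<Longrightarrow> Q a b \<ge> p * (b - a)"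
      using p by (auto simp: P_def)
    have "\<bar>Q a b - D * (b - a)\<bar> \<le> e * (b - a)" if "a < 0" "0 < b" "b - a < min \<eta>1 \<eta>2" for a b
    proof -
      have "Q a b \<le> q' * (b - a)" "p * (b - a) \<le> Q a b"
        using \<eta>1 \<eta>2 that by auto
      moreover have "q' * (b - a) \<le> (D + e) * (b - a)" "(D - e) * (b - a) \<le> p * (b - a)"
        using q' p that by (auto intro!: mult_right_mono)
      ultimately show ?thesis by (auto simp: abs_le_iff algebra_simps)
    qed
    then show ?thesis using \<eta>1 \<eta>2 by (intro exI[of _ "min \<eta>1 \<eta>2"]) auto
  qed
  have contQ: "isCont (\<lambda>a. Q a b) 0" "isCont (\<lambda>b. Q a b) 0" for a b
  proof -
    have "continuous_on UNIV f" using f lipschitz_on_continuous_on by blast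
    then have "continuous_on UNIV (\<lambda>a. f (x + a *\<^sub>R v))"
      by (rule continuous_on_compose2) (auto intro!: continuous_intros)
    then have *: "isCont (\<lambda>a. f (x + a *\<^sub>R v)) 0"
      by (simp add: continuous_on_eq_continuous_at)
    show "isCont (\<lambda>a. Q a b) 0" "isCont (\<lambda>b. Q a b) 0"
      unfolding Q_def by (intro continuous_intros *)+
  qed
  have "((\<lambda>t. (f (x + t *\<^sub>R v) - f x) / t) \<longlongrightarrow> D) (at 0)"
    unfolding LIM_eq
  proof (intro allI impI)
    fix r :: real assume "r > 0"
    then obtain \<eta> where \<eta>: "\<eta> > 0"
      "\<And>a b. a < 0 \<Longrightarrow> 0 < b \<Longrightarrow> b - a < \<eta> \<Longrightarrow> \<bar>Q a b - D * (b - a)\<bar> \<le> r / 2 * (b - a)"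
      using straddle[of "r / 2"] by auto
    have "\<bar>(f (x + t *\<^sub>R v) - f x) / t - D\<bar> < r" if t: "t \<noteq> 0" "\<bar>t\<bar> < \<eta>" for t
    proof (cases "t > 0")
      case True
      \<comment> \<open>\<open>straddle\<close> needs endpoints strictly on both sides of 0, so the
        endpoint 0 is reached as a limit; using \<open>r / 2\<close> leaves a strict inequality
        afterwards.\<close>
      have "\<bar>Q 0 t - D * (t - 0)\<bar> \<le> r / 2 * (t - 0)"
      proof (rule tendsto_le[of "at_left 0"])
        show "((\<lambda>a. r / 2 * (t - a)) \<longlongrightarrow> r / 2 * (t - 0)) (at_left 0)"
          by (intro tendsto_intros)
        show "((\<lambda>a. \<bar>Q a t - D * (t - a)\<bar>) \<longlongrightarrow> \<bar>Q 0 t - D * (t - 0)\<bar>) (at_left 0)"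
          using contQ(1)[of t] by (intro tendsto_intros) (auto simp: isCont_def intro: tendsto_within_subset)
        show "\<forall>\<^sub>F a in at_left 0. \<bar>Q a t - D * (t - a)\<bar> \<le> r / 2 * (t - a)"
        proof -
          have "\<forall>\<^sub>F a in at_left 0. a \<in> {t - \<eta><..<0}"
            using t True by (intro eventually_at_left_real) auto
          then show ?thesis
          proof eventually_elim
            case (elim a)
            then show ?case using \<eta>(2)[of a t] True by (auto simp: algebra_simps)
          qed
        qed
      qed auto
      then have "\<bar>Q 0 t / t - D\<bar> \<le> r / 2"
        using True by (simp add: abs_le_iff field_simps)
      then show ?thesis using \<open>r > 0\<close> by (simp add: Q_def)
    next
      case False
      then have "t < 0" using t by simp
      have "\<bar>Q t 0 - D * (0 - t)\<bar> \<le> r / 2 * (0 - t)"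
      proof (rule tendsto_le[of "at_right 0"])
        show "((\<lambda>a. r / 2 * (a - t)) \<longlongrightarrow> r / 2 * (0 - t)) (at_right 0)"
          by (intro tendsto_intros)
        show "((\<lambda>a. \<bar>Q t a - D * (a - t)\<bar>) \<longlongrightarrow> \<bar>Q t 0 - D * (0 - t)\<bar>) (at_right 0)"
          using contQ(2)[of t] by (intro tendsto_intros) (auto simp: isCont_def intro: tendsto_within_subset)
        show "\<forall>\<^sub>F a in at_right 0. \<bar>Q t a - D * (a - t)\<bar> \<le> r / 2 * (a - t)"
        proof -
          have "\<forall>\<^sub>F a in at_right 0. a \<in> {0<..<t + \<eta>}"
            using t \<open>t < 0\<close> by (intro eventually_at_right_real) auto
          then show ?thesis
          proof eventually_elim
            case (elim a)
            then show ?case using \<eta>(2)[of t a] \<open>t < 0\<close> by (auto simp: algebra_simps)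
          qed
        qed
      qed auto
      then have "\<bar>(Q t 0 - D * (0 - t)) / (0 - t)\<bar> \<le> r / 2"
        using \<open>t < 0\<close> unfolding abs_divide by (subst pos_divide_le_eq) auto
      also have "(Q t 0 - D * (0 - t)) / (0 - t) = - Q t 0 / t - D"
        using \<open>t < 0\<close> by (simp add: field_simps)
      finally have "\<bar>- Q t 0 / t - D\<bar> \<le> r / 2" .
      then show ?thesis using \<open>r > 0\<close> by (simp add: Q_def)
    qed
    then show "\<exists>s>0. \<forall>t. t \<noteq> 0 \<and> norm (t - 0) < s \<longrightarrow> norm ((f (x + t *\<^sub>R v) - f x) / t - D) < r"
      using \<eta>(1) by auto
  qed
  then show ?thesis ..
qed

text \<open>A limit along one sequence gives a total function that is Borel measurable for
  continuous \<open>f\<close>. It is the two-sided derivative only where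
  \<open>has_dir_deriv\<close> holds.\<close>

definition dir_deriv :: "('a::real_normed_vector \<Rightarrow> real) \<Rightarrow> 'a \<Rightarrow> 'a \<Rightarrow> real" where
  "dir_deriv f v x = lim (\<lambda>n. (f (x + (1 / real (Suc n)) *\<^sub>R v) - f x) / (1 / real (Suc n)))"

definition has_dir_deriv :: "('a::real_normed_vector \<Rightarrow> real) \<Rightarrow> 'a \<Rightarrow> 'a \<Rightarrow> bool" where
  "has_dir_deriv f v x \<longleftrightarrow> ((\<lambda>t. (f (x + t *\<^sub>R v) - f x) / t) \<longlongrightarrow> dir_deriv f v x) (at 0)"

lemma has_dir_derivI:
  assumes "((\<lambda>t. (f (x + t *\<^sub>R v) - f x) / t) \<longlongrightarrow> D) (at 0)"
  shows "has_dir_deriv f v x" "dir_deriv f v x = D"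
proof -
  have "filterlim (\<lambda>n. 1 / real (Suc n)) (at 0) sequentially"
    using LIMSEQ_inverse_real_of_nat by (auto simp: filterlim_at inverse_eq_divide)
  from filterlim_compose[OF assms this]
  show "dir_deriv f v x = D" by (simp add: dir_deriv_def limI)
  with assms show "has_dir_deriv f v x" by (simp add: has_dir_deriv_def)
qed

lemma has_dir_derivD_sequentially:
  assumes "has_dir_deriv f v x"
  shows "(\<lambda>n. (f (x + (1 / real (Suc n)) *\<^sub>R v) - f x) / (1 / real (Suc n))) \<longlonglongrightarrow> dir_deriv f v x"
proof -
  have "filterlim (\<lambda>n. 1 / real (Suc n)) (at 0) sequentially"
    using LIMSEQ_inverse_real_of_nat by (auto simp: filterlim_at inverse_eq_divide)
  from filterlim_compose[OF assms[unfolded has_dir_deriv_def] this] show ?thesis .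
qed

lemma AE_has_dir_deriv:
  fixes f :: "'a::euclidean_space \<Rightarrow> real"
  assumes f: "L-lipschitz_on UNIV f"
  shows "AE x in lborel. has_dir_deriv f v x"
proof -
  have "AE x in lborel. \<forall>p\<in>\<rat>. \<forall>q\<in>\<rat>. p < q \<longrightarrow> x \<notin> slope_gap_set f v p q"
  proof (intro AE_ball_countable[THEN iffD2] ballI countable_rat)
    fix p q :: real
    show "AE x in lborel. p < q \<longrightarrow> x \<notin> slope_gap_set f v p q"
      using slope_gap_set_null[OF f] by (cases "p < q") (auto dest: AE_not_in)
  qed
  then show ?thesis
  proof eventually_elim
    case (elim x)
    then show ?case
      using directional_derivative_exists[OF f, of x v] has_dir_derivI by blast
  qed
qed

lemma dir_deriv_measurable [measurable]:
  fixes f :: "'a::euclidean_space \<Rightarrow> real"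
  assumes "continuous_on UNIV f"
  shows "dir_deriv f v \<in> borel_measurable borel"
proof -
  have [measurable]: "f \<in> borel_measurable borel"
    using assms by (rule borel_measurable_continuous_onI)
  show ?thesis
    unfolding dir_deriv_def[abs_def] by measurable
qed

text \<open>Adding \<open>C\<close> makes \<open>g\<close> a nonnegative density almost everywhere.
  The measures with densities \<open>g + C\<close> and \<open>C\<close> agree on boxes, which form
  an intersection-stable generator, hence everywhere, and densities are almost everywhere
  unique.\<close>

lemma AE_eq_0_if_box_integrals_0:
  fixes g :: "'a::euclidean_space \<Rightarrow> real"
  assumes [measurable]: "g \<in> borel_measurable borel" and bd: "AE x in lborel. \<bar>g x\<bar> \<le> C" and C: "C \<ge> 0"
    and int0: "\<And>a b. (\<integral>x. indicator (box a b) x * g x \<partial>lborel) = 0"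
  shows "AE x in lborel. g x = 0"
proof -
  have "density lborel (\<lambda>x. ennreal (g x + C)) = density lborel (\<lambda>x. ennreal C)"
  proof (rule measure_eqI_generator_eq)
    let ?E = "range (\<lambda>(a, b). box a b::'a set)"
    show "Int_stable ?E"
      by (auto simp: Int_stable_def box_Int_box)
    show "?E \<subseteq> Pow UNIV"
      "sets (density lborel (\<lambda>x. ennreal (g x + C))) = sigma_sets UNIV ?E"
      "sets (density lborel (\<lambda>x. ennreal C)) = sigma_sets UNIV ?E"
      by (simp_all add: borel_eq_box)
    let ?A = "\<lambda>n::nat. box (- (real n *\<^sub>R One)) (real n *\<^sub>R One) :: 'a set"
    show "range ?A \<subseteq> ?E" "(\<Union>i. ?A i) = UNIV"
      unfolding UN_box_eq_UNIV by auto
    have box: "emeasure (density lborel (\<lambda>x. ennreal (g x + C))) (box a b) = ennreal C * emeasure lborel (box a b)" for a b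
    proof -
      have fin: "emeasure lborel (box a b) < top"
        by (simp add: emeasure_lborel_box_eq)
      have "AE x in lborel. x \<in> box a b \<longrightarrow> norm (indicator (box a b) x * g x) \<le> C"
        using bd by eventually_elim (auto simp: indicator_def)
      then have i1: "integrable lborel (\<lambda>x. indicator (box a b) x * g x)"
        using fin by (intro integrableI_bounded_set[where A="box a b" and B=C]) (auto simp: indicator_def)
      have nn: "AE x in lborel. 0 \<le> indicator (box a b) x * g x + indicator (box a b) x * C"
        using bd by eventually_elim (auto simp: indicator_def abs_le_iff)
      have i2: "integrable lborel (\<lambda>x. indicator (box a b) x * C)"
        using fin by (intro integrable_mult_left integrable_real_indicator) auto
      have "emeasure (density lborel (\<lambda>x. ennreal (g x + C))) (box a b)
          = (\<integral>\<^sup>+x. ennreal (indicator (box a b) x * g x + indicator (box a b) x * C) \<partial>lborel)"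
        by (subst emeasure_density) (auto intro!: nn_integral_cong simp: indicator_def)
      also have "\<dots> = ennreal (\<integral>x. indicator (box a b) x * g x + indicator (box a b) x * C \<partial>lborel)"
        by (intro nn_integral_eq_integral Bochner_Integration.integrable_add i1 i2 nn)
      also have "(\<integral>x. indicator (box a b) x * g x + indicator (box a b) x * C \<partial>lborel) = C * measure lborel (box a b)"
        using i1 i2 int0[of a b] by simp
      also have "ennreal \<dots> = ennreal C * emeasure lborel (box a b)"
        using C fin emeasure_eq_ennreal_measure[of lborel "box a b"] ennreal_mult[of C "measure lborel (box a b)"]
        by auto
      finally show ?thesis .
    qed
    show "emeasure (density lborel (\<lambda>x. ennreal (g x + C))) (?A i) \<noteq> \<infinity>" for i
      unfolding box using emeasure_lborel_box_finite[of "- (real i *\<^sub>R One)" "real i *\<^sub>R One :: 'a"]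
      by (auto simp: ennreal_mult_eq_top_iff)
    show "emeasure (density lborel (\<lambda>x. ennreal (g x + C))) X = emeasure (density lborel (\<lambda>x. ennreal C)) X" if "X \<in> ?E" for X
      using that box by (auto simp: emeasure_density nn_integral_cmult)
  qed
  then have "AE x in lborel. ennreal (g x + C) = ennreal C"
    by (subst (asm) sigma_finite_measure.density_unique_iff[OF sigma_finite_lborel]) auto
  with bd show ?thesis
  proof eventually_elim
    case (elim x)
    then have "0 \<le> g x + C" by auto
    with elim(2) C have "g x + C = C" by (metis ennreal_inj)
    then show ?case by simp
  qed
qed

section \<open>Rademacher's theorem and the mean value inequality\<close>

lemma lborel_integral_translate:
  fixes \<phi> :: "'a::euclidean_space \<Rightarrow> real"
  assumes [measurable]: "\<phi> \<in> borel_measurable borel"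
  shows "(\<integral>x. \<phi> (x + c) \<partial>lborel) = (\<integral>x. \<phi> x \<partial>lborel)"
proof -
  have "(\<integral>x. \<phi> x \<partial>lborel) = (\<integral>x. \<phi> x \<partial>distr lborel borel ((+) c))"
    by (simp add: lborel_distr_plus)
  also have "\<dots> = (\<integral>x. \<phi> (x + c) \<partial>lborel)"
    by (subst integral_distr) (auto simp: add.commute)
  finally show ?thesis by simp
qed

lemma AE_lborel_translate:
  fixes c :: "'a::euclidean_space"
  assumes "AE x in lborel. P x"
  shows "AE x in lborel. P (c + x)"
proof -
  obtain N where N': "{x \<in> space lborel. \<not> P x} \<subseteq> N" "emeasure lborel N = 0" "N \<in> sets lborel"
    using AE_E[OF assms] .
  then have N: "{x. \<not> P x} \<subseteq> N" "N \<in> sets borel" "emeasure lborel N = 0"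
    by auto
  have "AE x in distr lborel borel ((+) c). x \<notin> N"
    unfolding lborel_distr_plus using N by (intro AE_not_in) (auto simp: null_sets_def)
  then have "AE x in lborel. c + x \<notin> N"
    using N(2) by (subst (asm) AE_distr_iff) auto
  then show ?thesis
    by eventually_elim (use N(1) in blast)
qed

lemma lipschitz_quotient_bound:
  fixes f :: "'a::real_normed_vector \<Rightarrow> real"
  assumes f: "L-lipschitz_on UNIV f"
  shows "\<bar>(f (x + t *\<^sub>R v) - f x) / t\<bar> \<le> L * norm v"
proof (cases "t = 0")
  case False
  have "\<bar>f (x + t *\<^sub>R v) - f x\<bar> \<le> L * norm (t *\<^sub>R v)"
    using lipschitz_onD[OF f, of "x + t *\<^sub>R v" x] by (simp add: dist_norm)
  then show ?thesis using False by (simp add: field_simps)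
qed (use lipschitz_on_nonneg[OF f] in simp)

lemma dir_deriv_bound:
  fixes f :: "'a::real_normed_vector \<Rightarrow> real"
  assumes f: "L-lipschitz_on UNIV f" and "has_dir_deriv f v x"
  shows "\<bar>dir_deriv f v x\<bar> \<le> L * norm v"
proof (rule tendsto_upperbound)
  show "((\<lambda>t. \<bar>(f (x + t *\<^sub>R v) - f x) / t\<bar>) \<longlongrightarrow> \<bar>dir_deriv f v x\<bar>) (at 0)"
    using assms(2) unfolding has_dir_deriv_def by (intro tendsto_intros)
  show "\<forall>\<^sub>F t in at 0. \<bar>(f (x + t *\<^sub>R v) - f x) / t\<bar> \<le> L * norm v"
    using lipschitz_quotient_bound[OF f] by (intro always_eventually allI)
qed auto

lemma AE_not_in_frontier_box:
  "AE x in lborel. (x::'a::euclidean_space) \<notin> frontier (box a b)"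
proof -
  have "negligible (frontier (box a b))"
    by (intro negligible_convex_frontier) auto
  then have "frontier (box a b) \<in> null_sets lborel"
    by (simp add: negligible_iff_null_sets null_sets_completion_iff)
  then show ?thesis by (rule AE_not_in)
qed

text \<open>Translating the quotient in the direction \<open>w\<close> by the vanishing vector \<open>s u\<close> does not change the limit of
  its integral over a box, whence both sides have equal integrals over all boxes.\<close>

lemma AE_dir_deriv_add:
  fixes f :: "'a::euclidean_space \<Rightarrow> real"
  assumes f: "L-lipschitz_on UNIV f"
  shows "AE x in lborel. dir_deriv f (u + w) x = dir_deriv f u x + dir_deriv f w x"
proof -
  have L0: "L \<ge> 0" using f lipschitz_on_nonneg by blast
  have cont: "continuous_on UNIV f" using f lipschitz_on_continuous_on by blast
  have [measurable]: "f \<in> borel_measurable borel"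
    using cont by (rule borel_measurable_continuous_onI)
  note [measurable] = dir_deriv_measurable[OF cont]
  define s where "s n = 1 / real (Suc n)" for n
  define q where "q n v x = (f (x + s n *\<^sub>R v) - f x) / s n" for n v x
  have s0: "s \<longlonglongrightarrow> 0" unfolding s_def by real_asymp
  have s1: "0 < s n" "s n \<le> 1" for n by (auto simp: s_def)
  have qm[measurable]: "q n v \<in> borel_measurable borel" for n v
    unfolding q_def[abs_def] by measurable
  have qb: "\<bar>q n v x\<bar> \<le> L * norm v" for n v x
    unfolding q_def by (rule lipschitz_quotient_bound[OF f])
  have qlim: "AE x in lborel. (\<lambda>n. q n v x) \<longlonglongrightarrow> dir_deriv f v x" for v
    using AE_has_dir_deriv[OF f, of v]
    by eventually_elim (auto simp: q_def s_def dest: has_dir_derivD_sequentially)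
  have dbd: "AE x in lborel. \<bar>dir_deriv f v x\<bar> \<le> L * norm v" for v
    using AE_has_dir_deriv[OF f, of v] by eventually_elim (rule dir_deriv_bound[OF f])
  have int0: "(\<integral>x. indicator (box a b) x * (dir_deriv f (u + w) x - (dir_deriv f u x + dir_deriv f w x)) \<partial>lborel) = 0" for a b
  proof -
    let ?I = "indicator (box a b) :: 'a \<Rightarrow> real"
    obtain R where R: "R > 0" "box a b \<subseteq> cball 0 R"
      using bounded_subset_ballD[OF bounded_box, of a b 0] ball_subset_cball by (meson subset_trans)
    define B where "B = cball (0::'a) (R + norm u)"
    have B: "x - s n *\<^sub>R u \<in> box a b \<Longrightarrow> x \<in> B" for x n
    proof -
      assume "x - s n *\<^sub>R u \<in> box a b"
      then have "norm (x - s n *\<^sub>R u) \<le> R" using R by auto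
      moreover have "norm (s n *\<^sub>R u) \<le> norm u"
        using s1[of n] by (simp add: mult_left_le_one_le)
      ultimately show "x \<in> B"
        using norm_triangle_sub[of x "s n *\<^sub>R u"] by (simp add: B_def)
    qed
    have B': "x \<in> box a b \<Longrightarrow> x \<in> B" for x
    proof -
      assume "x \<in> box a b"
      then have "norm x \<le> R" using R(2) by auto
      then show "x \<in> B" using norm_ge_zero[of u] by (simp add: B_def del: norm_ge_zero)
    qed
    have Bint: "integrable lborel (\<lambda>x. indicator B x * c)" for c :: real
    proof -
      have "emeasure lborel B < \<infinity>" unfolding B_def by (rule emeasure_lborel_cball_finite)
      then show ?thesis
        by (intro integrable_mult_left integrable_real_indicator) (auto simp: B_def)
    qed
    have conv: "(\<lambda>n. \<integral>x. ?I x * q n v x \<partial>lborel) \<longlonglongrightarrow> (\<integral>x. ?I x * dir_deriv f v x \<partial>lborel)" 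
      "integrable lborel (\<lambda>x. ?I x * dir_deriv f v x)"
      "\<And>n. integrable lborel (\<lambda>x. ?I x * q n v x)" for v
    proof -
      have l: "AE x in lborel. (\<lambda>n. ?I x * q n v x) \<longlonglongrightarrow> ?I x * dir_deriv f v x"
        using qlim[of v] by eventually_elim (intro tendsto_intros)
      have d: "AE x in lborel. norm (?I x * q n v x) \<le> indicator B x * (L * norm v)" for n
        using qb B' by (auto simp: indicator_def abs_mult L0)
      have m: "(\<lambda>x. ?I x * dir_deriv f v x) \<in> borel_measurable lborel"
        "(\<lambda>x. ?I x * q n v x) \<in> borel_measurable lborel" for n
        by measurable
      show "(\<lambda>n. \<integral>x. ?I x * q n v x \<partial>lborel) \<longlonglongrightarrow> (\<integral>x. ?I x * dir_deriv f v x \<partial>lborel)"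
        by (rule integral_dominated_convergence[where w="\<lambda>x. indicator B x * (L * norm v)"]) (fact m l d Bint)+
      show "integrable lborel (\<lambda>x. ?I x * dir_deriv f v x)"
        by (rule integrable_dominated_convergence[where w="\<lambda>x. indicator B x * (L * norm v)" and s="\<lambda>n x. ?I x * q n v x"]) (fact m l d Bint)+
      show "integrable lborel (\<lambda>x. ?I x * q n v x)" for n
        by (rule integrable_dominated_convergence2[where w="\<lambda>x. indicator B x * (L * norm v)" and f="\<lambda>x. ?I x * dir_deriv f v x"]) (fact m l d Bint)+
    qed
    have shift: "(\<lambda>n. \<integral>x. ?I (x - s n *\<^sub>R u) * q n w x \<partial>lborel) \<longlonglongrightarrow> (\<integral>x. ?I x * dir_deriv f w x \<partial>lborel)"
    proof (rule integral_dominated_convergence[where w="\<lambda>x. indicator B x * (L * norm w)"])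
      show "integrable lborel (\<lambda>x. indicator B x * (L * norm w))" by (rule Bint)
      show "AE x in lborel. (\<lambda>n. ?I (x - s n *\<^sub>R u) * q n w x) \<longlonglongrightarrow> ?I x * dir_deriv f w x"
        using qlim[of w] AE_not_in_frontier_box[of a b]
      proof eventually_elim
        case (elim x)
        have lim: "(\<lambda>n. x - s n *\<^sub>R u) \<longlonglongrightarrow> x - 0 *\<^sub>R u"
          by (intro tendsto_intros s0)
        have "\<forall>\<^sub>F n in sequentially. ?I (x - s n *\<^sub>R u) = ?I x"
        proof (cases "x \<in> box a b")
          case True
          then have "\<forall>\<^sub>F n in sequentially. x - s n *\<^sub>R u \<in> box a b"
            using lim by (intro topological_tendstoD) auto
          then show ?thesis by eventually_elim (use True in auto)
        next
          case False
          then have "x \<in> - closure (box a b)"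
            using elim(2) by (auto simp: frontier_def interior_open[OF open_box])
          then have "\<forall>\<^sub>F n in sequentially. x - s n *\<^sub>R u \<in> - closure (box a b)"
            using lim by (intro topological_tendstoD) auto
          then show ?thesis
            by eventually_elim (use False closure_subset in \<open>auto simp: indicator_def\<close>)
        qed
        then have "(\<lambda>n. ?I (x - s n *\<^sub>R u)) \<longlonglongrightarrow> ?I x"
          by (simp add: tendsto_eventually)
        with elim(1) show ?case by (intro tendsto_intros)
      qed
      show "AE x in lborel. norm (?I (x - s n *\<^sub>R u) * q n w x) \<le> indicator B x * (L * norm w)" for n
        using qb B[of _ n] by (intro AE_I2) (auto simp: indicator_def abs_mult L0)
    qed auto
    have "(\<integral>x. ?I x * q n (u + w) x \<partial>lborel)
        = (\<integral>x. ?I (x - s n *\<^sub>R u) * q n w x \<partial>lborel) + (\<integral>x. ?I x * q n u x \<partial>lborel)" for n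
    proof -
      \<comment> \<open>Telescoping through \<open>x + s n *\<^sub>R u\<close>. The change of
        variables below moves the shift from the quotient, whose limit is merely measurable in
        \<open>x\<close>, to the indicator, which is continuous off the null frontier of the
        box.\<close>
      have q: "q n (u + w) x = q n w (x + s n *\<^sub>R u) + q n u x" for x
        unfolding q_def scaleR_add_right add.assoc add_divide_distrib[symmetric] by simp
      have "integrable lborel (\<lambda>x. ?I x * q n (u + w) x - ?I x * q n u x)"
        using conv(3) by (intro Bochner_Integration.integrable_diff) auto
      then have i: "integrable lborel (\<lambda>x. ?I x * q n w (x + s n *\<^sub>R u))"
        by (simp add: q algebra_simps)
      have "(\<integral>x. ?I x * q n (u + w) x \<partial>lborel)
        = (\<integral>x. ?I x * q n w (x + s n *\<^sub>R u) \<partial>lborel) + (\<integral>x. ?I x * q n u x \<partial>lborel)"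
        unfolding q distrib_left by (rule Bochner_Integration.integral_add[OF i conv(3)])
      also have "(\<integral>x. ?I x * q n w (x + s n *\<^sub>R u) \<partial>lborel)
          = (\<integral>x. ?I (x - s n *\<^sub>R u) * q n w x \<partial>lborel)"
        using lborel_integral_translate[of "\<lambda>x. ?I (x - s n *\<^sub>R u) * q n w x" "s n *\<^sub>R u"] by simp
      finally show ?thesis .
    qed
    then have "(\<lambda>n. \<integral>x. ?I x * q n (u + w) x \<partial>lborel) \<longlonglongrightarrow>
       (\<integral>x. ?I x * dir_deriv f w x \<partial>lborel) + (\<integral>x. ?I x * dir_deriv f u x \<partial>lborel)"
      using tendsto_add[OF shift conv(1)[of u]] by simp
    from LIMSEQ_unique[OF this conv(1)[of "u + w"]]
    show ?thesis
      using conv(2) by (simp add: right_diff_distrib distrib_left)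
  qed
  have "AE x in lborel. dir_deriv f (u + w) x - (dir_deriv f u x + dir_deriv f w x) = 0"
  proof (rule AE_eq_0_if_box_integrals_0[OF _ _ _ int0])
    show "AE x in lborel. \<bar>dir_deriv f (u + w) x - (dir_deriv f u x + dir_deriv f w x)\<bar> \<le> L * norm (u + w) + (L * norm u + L * norm w)"
      using dbd[of "u + w"] dbd[of u] dbd[of w] by eventually_elim (auto simp: abs_le_iff)
    show "0 \<le> L * norm (u + w) + (L * norm u + L * norm w)" using L0 by simp
  qed measurable
  then show ?thesis by eventually_elim simp
qed

lemma has_dir_deriv_scaleR:
  assumes "has_dir_deriv f v x"
  shows "has_dir_deriv f (c *\<^sub>R v) x \<and> dir_deriv f (c *\<^sub>R v) x = c * dir_deriv f v x"
proof -
  have "((\<lambda>t. (f (x + t *\<^sub>R (c *\<^sub>R v)) - f x) / t) \<longlongrightarrow> c * dir_deriv f v x) (at 0)"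
  proof (cases "c = 0")
    case False
    have "filterlim (\<lambda>t. t * c) (at 0) (at 0)"
      using False by (auto simp: filterlim_at eventually_at_filter intro!: tendsto_eq_intros)
    from filterlim_compose[OF assms[unfolded has_dir_deriv_def] this]
    have "((\<lambda>t. c * ((f (x + (t * c) *\<^sub>R v) - f x) / (t * c))) \<longlongrightarrow> c * dir_deriv f v x) (at 0)"
      by (intro tendsto_intros)
    then show ?thesis using False by simp
  qed simp
  then show ?thesis using has_dir_derivI by blast
qed

lemma AE_dir_deriv_linear:
  fixes f :: "'a::euclidean_space \<Rightarrow> real"
  assumes f: "L-lipschitz_on UNIV f"
  shows "AE x in lborel. dir_deriv f d x = (\<Sum>b\<in>Basis. dir_deriv f b x *\<^sub>R b) \<bullet> d"
proof -
  have "AE x in lborel. dir_deriv f (\<Sum>b\<in>S. (d \<bullet> b) *\<^sub>R b) x = (\<Sum>b\<in>S. (d \<bullet> b) * dir_deriv f b x)"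
    if "finite S" for S :: "'a set"
    using that
  proof (induction S)
    case empty
    then show ?case by (simp add: dir_deriv_def)
  next
    case (insert b S)
    from insert.IH AE_dir_deriv_add[OF f, of "(d \<bullet> b) *\<^sub>R b" "\<Sum>b\<in>S. (d \<bullet> b) *\<^sub>R b"] AE_has_dir_deriv[OF f, of b]
    show ?case
      by eventually_elim (use insert.hyps has_dir_deriv_scaleR in auto)
  qed
  from this[OF finite_Basis] show ?thesis
    by eventually_elim (simp add: euclidean_representation inner_sum_right inner_commute[of _ d] mult.commute)
qed

text \<open>By compactness finitely many directions of \<open>D\<close> come within
  \<open>e'\<close> of every unit vector, and the quotients along these converge uniformly.
  Replacing a unit vector by the nearest of them costs \<open>L * e'\<close> in \<open>f\<close> and
  \<open>norm g * e'\<close> in the linear part, together at most \<open>e / 2\<close>.\<close>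

lemma GDERIV_if_dense_directions:
  fixes f :: "'a::euclidean_space \<Rightarrow> real"
  assumes f: "L-lipschitz_on UNIV f" and D: "closure D = UNIV"
    and dir: "\<And>d. d \<in> D \<Longrightarrow> ((\<lambda>t. (f (x + t *\<^sub>R d) - f x) / t) \<longlongrightarrow> g \<bullet> d) (at 0)"
  shows "GDERIV f x :> g"
  unfolding gderiv_def has_derivative_at_alt
proof (intro conjI allI impI)
  show "bounded_linear (\<lambda>h. h \<bullet> g)" by (rule bounded_linear_inner_left)
  fix e :: real assume "e > 0"
  have L0: "L \<ge> 0" using f lipschitz_on_nonneg by blast
  define A where "A = L + norm g + 1"
  have A: "A > 0" "L + norm g \<le> A" using L0 norm_ge_zero[of g] by (auto simp: A_def simp del: norm_ge_zero)
  define e' where "e' = e / (2 * A)"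
  have e': "e' > 0" using \<open>e > 0\<close> A by (simp add: e'_def)
  have "(L + norm g) * e' \<le> A * e'"
    using A e' by (intro mult_right_mono) auto
  also have "\<dots> = e / 2"
    using A by (simp add: e'_def)
  finally have e'2: "(L + norm g) * e' \<le> e / 2" .
  have "sphere 0 1 \<subseteq> (\<Union>d\<in>D. ball d e')"
  proof
    fix u :: 'a
    have "u \<in> closure D" using D by simp
    then obtain d where "d \<in> D" "dist d u < e'"
      using e' closure_approachable by blast
    then show "u \<in> (\<Union>d\<in>D. ball d e')" by auto
  qed
  then obtain K where K: "K \<subseteq> D" "finite K" "sphere 0 1 \<subseteq> (\<Union>d\<in>K. ball d e')"
    using compactE_image[OF compact_sphere, of D "\<lambda>d. ball d e'" 0 1] by auto
  have "\<forall>\<^sub>F t in at 0. \<forall>d\<in>K. dist ((f (x + t *\<^sub>R d) - f x) / t) (g \<bullet> d) < e / 2"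
    using K dir \<open>e > 0\<close> by (intro eventually_ball_finite ballI tendstoD) auto
  then obtain \<delta> where \<delta>: "\<delta> > 0" "\<And>t d. t \<noteq> 0 \<Longrightarrow> \<bar>t\<bar> < \<delta> \<Longrightarrow> d \<in> K \<Longrightarrow> \<bar>(f (x + t *\<^sub>R d) - f x) / t - g \<bullet> d\<bar> < e / 2"
    by (auto simp: eventually_at dist_real_def)
  have "norm (f y - f x - (y - x) \<bullet> g) \<le> e * norm (y - x)" if y: "norm (y - x) < \<delta>" for y
  proof (cases "y = x")
    case False
    define t where "t = norm (y - x)"
    have t: "t > 0" "t < \<delta>" using False y by (auto simp: t_def)
    define u where "u = (y - x) /\<^sub>R t"
    have yx: "y - x = t *\<^sub>R u" using t by (simp add: u_def)
    then have y: "y = x + t *\<^sub>R u" by (simp add: diff_eq_eq add.commute)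
    have "u \<in> sphere 0 1" using t by (simp add: u_def t_def)
    then obtain d where d: "d \<in> K" "norm (u - d) < e'"
      using K(3) by (force simp: dist_norm norm_minus_commute)
    have "\<bar>f (x + t *\<^sub>R u) - f (x + t *\<^sub>R d)\<bar> \<le> L * norm (t *\<^sub>R u - t *\<^sub>R d)"
      using lipschitz_onD[OF f, of "x + t *\<^sub>R u" "x + t *\<^sub>R d"] by (simp add: dist_norm)
    also have "norm (t *\<^sub>R u - t *\<^sub>R d) = t * norm (u - d)"
      using t by (simp flip: scaleR_diff_right)
    also have "L * (t * norm (u - d)) \<le> L * (t * e')"
      using d t L0 by (intro mult_left_mono) auto
    finally have 1: "\<bar>f (x + t *\<^sub>R u) - f (x + t *\<^sub>R d)\<bar> \<le> L * (t * e')" .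
    have "\<bar>(f (x + t *\<^sub>R d) - f x) / t - g \<bullet> d\<bar> < e / 2"
      using \<delta>(2)[of t d] t d by simp
    then have 2: "\<bar>f (x + t *\<^sub>R d) - f x - t * (g \<bullet> d)\<bar> \<le> e / 2 * t"
    proof -
      have "z - t * (g \<bullet> d) = t * (z / t - g \<bullet> d)" for z
        using t by (simp add: right_diff_distrib)
      from this[of "f (x + t *\<^sub>R d) - f x"]
      have "\<bar>f (x + t *\<^sub>R d) - f x - t * (g \<bullet> d)\<bar> = t * \<bar>(f (x + t *\<^sub>R d) - f x) / t - g \<bullet> d\<bar>"
        using t by (simp only: abs_mult abs_of_pos)
      also have "\<dots> \<le> t * (e / 2)"
        using \<open>_ < e / 2\<close> t by (intro mult_left_mono) auto
      finally show ?thesis by (simp add: mult.commute)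
    qed
    have "\<bar>g \<bullet> (u - d)\<bar> \<le> norm g * norm (u - d)" by (rule Cauchy_Schwarz_ineq2)
    also have "\<dots> \<le> norm g * e'" using d by (intro mult_left_mono) auto
    finally have 3: "\<bar>t * (g \<bullet> u) - t * (g \<bullet> d)\<bar> \<le> t * (norm g * e')"
      using t by (simp add: inner_diff_right abs_mult flip: right_diff_distrib)
    have "\<bar>f (x + t *\<^sub>R u) - f x - t * (g \<bullet> u)\<bar> \<le> t * ((L + norm g) * e') + e / 2 * t"
    proof -
      have "t * ((L + norm g) * e') = L * (t * e') + t * (norm g * e')" by algebra
      with 1 2 3 show ?thesis unfolding abs_le_iff by linarith
    qed
    also have "\<dots> \<le> t * (e / 2) + e / 2 * t"
      using e'2 t by (intro add_right_mono mult_left_mono) auto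
    also have "\<dots> = e * t" by simp
    finally have "\<bar>f y - f x - t * (g \<bullet> u)\<bar> \<le> e * t" by (simp only: y)
    moreover have "(y - x) \<bullet> g = t * (g \<bullet> u)" by (simp add: yx inner_commute[of u g])
    ultimately show ?thesis by (simp add: t_def)
  qed simp
  then show "\<exists>d>0. \<forall>y. norm (y - x) < d \<longrightarrow> norm (f y - f x - (y - x) \<bullet> g) \<le> e * norm (y - x)"
    using \<delta>(1) by blast
qed

text \<open>The null set off which the derivative in direction \<open>d\<close> is given by the
  vector of partial derivatives depends on \<open>d\<close>. A countable dense set of directions
  keeps the union of these sets null.\<close>

theorem rademacher:
  fixes f :: "'a::euclidean_space \<Rightarrow> real"
  assumes f: "L-lipschitz_on UNIV f"
  shows "AE x in lborel. \<exists>g. GDERIV f x :> g"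
proof -
  obtain D :: "'a set" where "countable D" "D \<subseteq> UNIV" "UNIV \<subseteq> closure D"
    by (rule separable)
  then have D: "countable D" "closure D = UNIV" by auto
  have "AE x in lborel. \<forall>d\<in>D. has_dir_deriv f d x \<and> dir_deriv f d x = (\<Sum>b\<in>Basis. dir_deriv f b x *\<^sub>R b) \<bullet> d"
    unfolding AE_ball_countable[OF D(1)]
    using AE_has_dir_deriv[OF f] AE_dir_deriv_linear[OF f] by auto
  then show ?thesis
  proof eventually_elim
    case (elim x)
    have "GDERIV f x :> (\<Sum>b\<in>Basis. dir_deriv f b x *\<^sub>R b)"
    proof (rule GDERIV_if_dense_directions[OF f D(2)])
      fix d assume "d \<in> D"
      then have "has_dir_deriv f d x" and eq: "dir_deriv f d x = (\<Sum>b\<in>Basis. dir_deriv f b x *\<^sub>R b) \<bullet> d"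
        using elim by auto
      then show "((\<lambda>t. (f (x + t *\<^sub>R d) - f x) / t) \<longlongrightarrow> (\<Sum>b\<in>Basis. dir_deriv f b x *\<^sub>R b) \<bullet> d) (at 0)"
        by (simp only: has_dir_deriv_def eq)
    qed
    then show ?case ..
  qed
qed

lemma GDERIV_directional:
  assumes "GDERIV f x :> g"
  shows "((\<lambda>t. (f (x + t *\<^sub>R v) - f x) / t) \<longlongrightarrow> g \<bullet> v) (at 0)"
proof -
  have "((\<lambda>t. x + t *\<^sub>R v) has_derivative (\<lambda>t. t *\<^sub>R v)) (at 0)"
    by (auto intro!: derivative_eq_intros)
  moreover have "(f has_derivative (\<lambda>h. h \<bullet> g)) (at (x + 0 *\<^sub>R v))"
    using assms by (simp add: gderiv_def)
  ultimately have "((\<lambda>t. f (x + t *\<^sub>R v)) has_derivative (\<lambda>t. (t *\<^sub>R v) \<bullet> g)) (at 0)"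
    by (rule has_derivative_compose)
  then have "((\<lambda>t. f (x + t *\<^sub>R v)) has_real_derivative g \<bullet> v) (at 0)"
    by (rule has_derivative_imp_has_field_derivative) (simp add: inner_commute[of g v])
  then show ?thesis by (simp add: has_field_derivative_iff)
qed

text \<open>The function \<open>\<Phi>\<close> below averages \<open>f\<close> over small balls centred on the segment; it is differentiable,
  and its derivative averages the almost everywhere defined directional derivative.\<close>

theorem lipschitz_mean_value:
  fixes f :: "'a::euclidean_space \<Rightarrow> real"
  assumes f: "L-lipschitz_on UNIV f" and "r > 0" "\<eta> > 0"
  shows "\<exists>t\<in>{0..1}. \<exists>y g. dist y (a + t *\<^sub>R d) < r \<and> (GDERIV f y :> g) \<and> g \<bullet> d \<ge> f (a + d) - f a - \<eta>"
proof (rule ccontr)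
  assume contra: "\<not> ?thesis"
  have L0: "L \<ge> 0" using f lipschitz_on_nonneg by blast
  have cont: "continuous_on UNIV f" using f lipschitz_on_continuous_on by blast
  have [measurable]: "f \<in> borel_measurable borel"
    using cont by (rule borel_measurable_continuous_onI)
  note [measurable] = dir_deriv_measurable[OF cont]
  define s where "s = f (a + d) - f a - \<eta>"
  \<comment> \<open>The bound \<open>r\<close> keeps the averaged points admissible. The other bound
    gives \<open>2 * L * \<rho> < \<eta>\<close>: averaging moves \<open>f\<close> at each end of
    the segment by at most \<open>L * \<rho>\<close>, and the slack \<open>\<eta>\<close> absorbs
    both errors.\<close>
  define \<rho> where "\<rho> = min r (\<eta> / (2 * L + 1))"
  have \<rho>: "\<rho> > 0" "\<rho> \<le> r" using assms L0 by (auto simp: \<rho>_def)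
  have "2 * L * \<rho> < (2 * L + 1) * \<rho>" using \<rho>(1) by simp
  also have "\<dots> \<le> (2 * L + 1) * (\<eta> / (2 * L + 1))"
    using L0 by (intro mult_left_mono) (auto simp: \<rho>_def)
  also have "\<dots> = \<eta>" using L0 by simp
  finally have L\<rho>: "2 * L * \<rho> < \<eta>" .
  define I where "I = (indicator (ball 0 \<rho>) :: 'a \<Rightarrow> real)"
  have I01: "I z = 1 \<and> norm z < \<rho> \<or> I z = 0" for z by (auto simp: I_def indicator_def)
  have [measurable]: "I \<in> borel_measurable borel" unfolding I_def by (intro borel_measurable_indicator) auto
  define V where "V = (\<integral>z. I z \<partial>lborel)"
  have fin: "emeasure lborel (ball (0::'a) \<rho>) < \<infinity>" by (rule emeasure_lborel_ball_finite)
  have Vpos: "V > 0"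
    using content_ball_pos[OF \<rho>(1), of 0] by (simp add: V_def I_def)
  have intI: "integrable lborel (\<lambda>z. I z * c)" for c
    unfolding I_def using fin by (intro integrable_mult_left integrable_real_indicator) auto
  have intf: "integrable lborel (\<lambda>z. I z * f (c + z))" for c
  proof (rule Bochner_Integration.integrable_bound[OF intI])
    have "\<bar>f (c + z)\<bar> \<le> \<bar>f c\<bar> + L * \<rho>" if "norm z < \<rho>" for z
    proof -
      have "\<bar>f (c + z) - f c\<bar> \<le> L * norm z"
        using lipschitz_onD[OF f, of "c + z" c] by (simp add: dist_norm)
      also have "\<dots> \<le> L * \<rho>" using that L0 by (intro mult_left_mono) auto
      finally show ?thesis by linarith
    qed
    then have "norm (I z * f (c + z)) \<le> norm (I z * (\<bar>f c\<bar> + L * \<rho>))" for z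
      using I01[of z] L0 \<rho> by auto
    then show "AE z in lborel. norm (I z * f (c + z)) \<le> norm (I z * (\<bar>f c\<bar> + L * \<rho>))" by simp
  qed measurable
  define \<Phi> where "\<Phi> t = (\<integral>z. I z * f (a + t *\<^sub>R d + z) \<partial>lborel)" for t
  define \<Psi> where "\<Psi> t = (\<integral>z. I z * dir_deriv f d (a + t *\<^sub>R d + z) \<partial>lborel)" for t
  have deriv: "(\<Phi> has_real_derivative \<Psi> t) (at t)" for t
    unfolding DERIV_def tendsto_at_iff_sequentially
  proof (intro allI impI)
    fix X :: "nat \<Rightarrow> real" assume X: "\<forall>i. X i \<in> UNIV - {0}" "X \<longlonglongrightarrow> 0"
    have X': "filterlim X (at 0) sequentially"
      using X by (auto simp: filterlim_at)
    let ?q = "\<lambda>i z. I z * ((f (a + t *\<^sub>R d + z + X i *\<^sub>R d) - f (a + t *\<^sub>R d + z)) / X i)"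
    have "(\<lambda>i. \<integral>z. ?q i z \<partial>lborel) \<longlonglongrightarrow> \<Psi> t"
      unfolding \<Psi>_def
    proof (rule integral_dominated_convergence[where w="\<lambda>z. I z * (L * norm d)"])
      show "AE z in lborel. (\<lambda>i. ?q i z) \<longlonglongrightarrow> I z * dir_deriv f d (a + t *\<^sub>R d + z)"
        using AE_lborel_translate[OF AE_has_dir_deriv[OF f, of d], of "a + t *\<^sub>R d"]
      proof eventually_elim
        case (elim z)
        from filterlim_compose[OF elim[unfolded has_dir_deriv_def] X']
        show ?case by (intro tendsto_intros)
      qed
      show "AE z in lborel. norm (?q i z) \<le> I z * (L * norm d)" for i
      proof (rule AE_I2)
        fix z
        have "\<bar>(f (a + t *\<^sub>R d + z + X i *\<^sub>R d) - f (a + t *\<^sub>R d + z)) / X i\<bar> \<le> L * norm d"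
          by (rule lipschitz_quotient_bound[OF f])
        then show "norm (?q i z) \<le> I z * (L * norm d)" using I01[of z] by auto
      qed
      show "integrable lborel (\<lambda>z. I z * (L * norm d))" by (rule intI)
    qed measurable
    also have "(\<lambda>i. \<integral>z. ?q i z \<partial>lborel) = (\<lambda>h. (\<Phi> (t + h) - \<Phi> t) / h) \<circ> X"
    proof (rule ext)
      fix i
      have "\<Phi> (t + X i) - \<Phi> t = (\<integral>z. I z * f (a + (t + X i) *\<^sub>R d + z) - I z * f (a + t *\<^sub>R d + z) \<partial>lborel)"
        unfolding \<Phi>_def by (rule Bochner_Integration.integral_diff[symmetric]) (rule intf)+
      also have "\<dots> = (\<integral>z. X i * ?q i z \<partial>lborel)"
      proof (rule Bochner_Integration.integral_cong[OF refl])
        fix z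
        have *: "a + (t + X i) *\<^sub>R d + z = a + t *\<^sub>R d + z + X i *\<^sub>R d" by (simp add: algebra_simps)
        have "X i \<noteq> 0" using X by blast
        then show "I z * f (a + (t + X i) *\<^sub>R d + z) - I z * f (a + t *\<^sub>R d + z) = X i * ?q i z"
          unfolding * by (simp add: right_diff_distrib[of "I z"])
      qed
      also have "\<dots> = X i * (\<integral>z. ?q i z \<partial>lborel)" by (rule integral_mult_right_zero)
      finally show "(\<integral>z. ?q i z \<partial>lborel) = ((\<lambda>h. (\<Phi> (t + h) - \<Phi> t) / h) \<circ> X) i"
        using X by simp
    qed
    finally show "((\<lambda>h. (\<Phi> (t + h) - \<Phi> t) / h) \<circ> X) \<longlonglongrightarrow> \<Psi> t" .
  qed
  obtain \<xi> where \<xi>: "0 < \<xi>" "\<xi> < 1" "\<Phi> 1 - \<Phi> 0 = \<Psi> \<xi>"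
    using MVT2[of 0 1 \<Phi> \<Psi>] deriv by auto
  have ae: "AE z in lborel. has_dir_deriv f d (a + \<xi> *\<^sub>R d + z) \<and> (\<exists>g. GDERIV f (a + \<xi> *\<^sub>R d + z) :> g)"
    using AE_lborel_translate[OF AE_has_dir_deriv[OF f, of d], of "a + \<xi> *\<^sub>R d"]
      AE_lborel_translate[OF rademacher[OF f], of "a + \<xi> *\<^sub>R d"] by eventually_elim auto
  \<comment> \<open>Were all gradients near the segment to have inner product below \<open>s\<close>
    with \<open>d\<close>, the averaged derivative would be at most \<open>V * s\<close>, which is
    too small for the increase of \<open>\<Phi>\<close>.\<close>
  have "\<Psi> \<xi> \<le> (\<integral>z. I z * s \<partial>lborel)"
    unfolding \<Psi>_def
  proof (rule integral_mono_AE)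
    show "integrable lborel (\<lambda>z. I z * dir_deriv f d (a + \<xi> *\<^sub>R d + z))"
    proof (rule Bochner_Integration.integrable_bound[OF intI])
      show "AE z in lborel. norm (I z * dir_deriv f d (a + \<xi> *\<^sub>R d + z)) \<le> norm (I z * (L * norm d))"
        using ae
      proof eventually_elim
        case (elim z)
        then have "\<bar>dir_deriv f d (a + \<xi> *\<^sub>R d + z)\<bar> \<le> L * norm d"
          by (intro dir_deriv_bound[OF f]) auto
        then show ?case using I01[of z] by auto
      qed
    qed measurable
    show "AE z in lborel. I z * dir_deriv f d (a + \<xi> *\<^sub>R d + z) \<le> I z * s"
      using ae
    proof eventually_elim
      case (elim z)
      then obtain g where g: "GDERIV f (a + \<xi> *\<^sub>R d + z) :> g" by blast
      have dd: "dir_deriv f d (a + \<xi> *\<^sub>R d + z) = g \<bullet> d"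
        using has_dir_derivI(2)[OF GDERIV_directional[OF g]] .
      show ?case
      proof (cases "norm z < \<rho>")
        case True
        then have "dist (a + \<xi> *\<^sub>R d + z) (a + \<xi> *\<^sub>R d) < r"
          using \<rho> by (simp add: dist_norm)
        then have "\<not> g \<bullet> d \<ge> s"
          using contra g \<xi> unfolding s_def by (meson atLeastAtMost_iff less_imp_le)
        then show ?thesis using I01[of z] by (auto simp: dd)
      qed (use I01[of z] in auto)
    qed
  qed (rule intI)
  also have "\<dots> = V * s" by (simp add: V_def)
  finally have upper: "\<Phi> 1 - \<Phi> 0 \<le> V * s" using \<xi> by simp
  have "V * (f (a + d) - f a - 2 * L * \<rho>) = (\<integral>z. I z * (f (a + d) - f a - 2 * L * \<rho>) \<partial>lborel)"
    by (simp add: V_def)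
  also have "\<dots> \<le> (\<integral>z. I z * f (a + d + z) - I z * f (a + z) \<partial>lborel)"
  proof (rule integral_mono)
    show "integrable lborel (\<lambda>z. I z * f (a + d + z) - I z * f (a + z))"
      using intf by (intro Bochner_Integration.integrable_diff)
    fix z
    have "\<bar>f (c + z) - f c\<bar> \<le> L * \<rho>" if "norm z < \<rho>" for c
    proof -
      have "\<bar>f (c + z) - f c\<bar> \<le> L * norm z"
        using lipschitz_onD[OF f, of "c + z" c] by (simp add: dist_norm)
      also have "\<dots> \<le> L * \<rho>" using that L0 by (intro mult_left_mono) auto
      finally show ?thesis .
    qed
    from this[of "a + d"] this[of a]
    have "norm z < \<rho> \<Longrightarrow> f (a + d) - f a - 2 * L * \<rho> \<le> f (a + d + z) - f (a + z)"
      by linarith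
    then show "I z * (f (a + d) - f a - 2 * L * \<rho>) \<le> I z * f (a + d + z) - I z * f (a + z)"
      using I01[of z] by auto
  qed (rule intI)
  also have "\<dots> = \<Phi> 1 - \<Phi> 0"
    unfolding \<Phi>_def by (subst Bochner_Integration.integral_diff[OF intf intf]) simp
  finally have "V * (f (a + d) - f a - 2 * L * \<rho>) \<le> V * s" using upper by linarith
  then show False
    using Vpos L\<rho> by (simp add: s_def)
qed

section \<open>Clarke and Goldstein subdifferentials\<close>

lemma norm_gradient_le:
  fixes f :: "'a::euclidean_space \<Rightarrow> real"
  assumes f: "L-lipschitz_on UNIV f" and g: "GDERIV f x :> g"
  shows "norm g \<le> L"
proof (cases "g = 0")
  case False
  have "g \<bullet> g \<le> L * norm g"
  proof (rule tendsto_upperbound)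
    show "((\<lambda>t. (f (x + t *\<^sub>R g) - f x) / t) \<longlongrightarrow> g \<bullet> g) (at 0)"
      by (rule GDERIV_directional[OF g])
    show "\<forall>\<^sub>F t in at 0. (f (x + t *\<^sub>R g) - f x) / t \<le> L * norm g"
      using lipschitz_quotient_bound[OF f] by (intro always_eventually allI) (meson abs_le_iff)
  qed auto
  then have "norm g * norm g \<le> L * norm g"
    by (simp add: power2_norm_eq_inner[symmetric] power2_eq_square)
  then show ?thesis using False by simp
qed (use lipschitz_on_nonneg[OF f] in simp)

definition limiting_gradients :: "('a::euclidean_space \<Rightarrow> real) \<Rightarrow> 'a \<Rightarrow> 'a set" where
  "limiting_gradients f x = {v. \<exists>y g. y \<longlonglongrightarrow> x \<and> (\<forall>r::nat. GDERIV f (y r) :> g r) \<and> g \<longlonglongrightarrow> v}"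

lemma clarke_eq: "clarke_subdifferential f x = closure (convex hull limiting_gradients f x)"
  by (simp add: clarke_subdifferential_def limiting_gradients_def)

lemma limiting_gradients_subset_clarke: "limiting_gradients f x \<subseteq> clarke_subdifferential f x"
  unfolding clarke_eq by (rule subset_trans[OF hull_subset closure_subset])

lemma limiting_gradientsI:
  assumes "y \<longlonglongrightarrow> x" "\<And>r::nat. GDERIV f (y r) :> g r" "g \<longlonglongrightarrow> v"
  shows "v \<in> limiting_gradients f x"
  unfolding limiting_gradients_def using assms by blast

lemma GDERIV_in_clarke: "GDERIV f x :> g \<Longrightarrow> g \<in> clarke_subdifferential f x"
  using limiting_gradients_subset_clarke[of f x]
    limiting_gradientsI[of "\<lambda>_. x" x f "\<lambda>_. g" g] by auto

lemma convex_clarke: "convex (clarke_subdifferential f x)"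
  by (simp add: clarke_eq convex_closure)

lemma closed_clarke: "closed (clarke_subdifferential f x)"
  by (simp add: clarke_eq)

lemma clarke_subset_if_limiting:
  assumes "limiting_gradients f x \<subseteq> S" "closed S" "convex S"
  shows "clarke_subdifferential f x \<subseteq> S"
  unfolding clarke_eq using assms by (intro closure_minimal hull_minimal)

lemma clarke_subset_cball:
  fixes f :: "'a::euclidean_space \<Rightarrow> real"
  assumes f: "L-lipschitz_on UNIV f"
  shows "clarke_subdifferential f x \<subseteq> cball 0 L"
proof (rule clarke_subset_if_limiting)
  show "limiting_gradients f x \<subseteq> cball 0 L"
  proof
    fix v assume "v \<in> limiting_gradients f x"
    then obtain y g where g: "\<And>r::nat. GDERIV f (y r) :> g r" "g \<longlonglongrightarrow> v"
      by (auto simp: limiting_gradients_def)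
    have "norm v \<le> L"
      using norm_gradient_le[OF f g(1)] by (intro tendsto_upperbound[OF tendsto_norm[OF g(2)]]) auto
    then show "v \<in> cball 0 L" by simp
  qed
qed auto

lemma gradients_near_accumulate:
  fixes f :: "'a::euclidean_space \<Rightarrow> real"
  assumes f: "L-lipschitz_on UNIV f" and y: "y \<longlonglongrightarrow> x" and g: "\<And>n::nat. GDERIV f (y n) :> g n"
  shows "\<exists>v r. strict_mono (r :: nat \<Rightarrow> nat) \<and> (g \<circ> r) \<longlonglongrightarrow> v \<and> v \<in> limiting_gradients f x"
proof -
  have "\<forall>n. g n \<in> cball 0 L" using norm_gradient_le[OF f g] by simp
  then obtain v r where r: "strict_mono (r :: nat \<Rightarrow> nat)" "(g \<circ> r) \<longlonglongrightarrow> v"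
    using compact_cball[of "0::'a" L] unfolding compact_def by metis
  have "(y \<circ> r) \<longlonglongrightarrow> x" using y r(1) LIMSEQ_subseq_LIMSEQ by blast
  then have "v \<in> limiting_gradients f x"
    by (rule limiting_gradientsI[OF _ _ r(2)]) (use g in simp)
  with r show ?thesis by blast
qed

lemma LIMSEQ_if_dist_less:
  assumes "\<And>n. dist (X n) l < 1 / real (Suc n)"
  shows "X \<longlonglongrightarrow> l"
  by (rule metric_tendsto_imp_tendsto[OF LIMSEQ_inverse_real_of_nat])
    (use assms in \<open>auto simp: inverse_eq_divide intro!: always_eventually less_imp_le\<close>)

lemma clarke_nonempty:
  fixes f :: "'a::euclidean_space \<Rightarrow> real"
  assumes f: "L-lipschitz_on UNIV f"
  shows "clarke_subdifferential f x \<noteq> {}"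
proof -
  \<comment> \<open>With direction 0 the mean value inequality just supplies points of
    differentiability arbitrarily close to \<open>x\<close>.\<close>
  have "\<exists>y g. dist y x < 1 / Suc n \<and> (GDERIV f y :> g)" for n
    using lipschitz_mean_value[OF f, of "1 / Suc n" 1 x 0] by auto
  then obtain y g where yg: "\<And>n. dist (y n) x < 1 / Suc n" "\<And>n. GDERIV f (y n) :> g n"
    by metis
  have "y \<longlonglongrightarrow> x" using yg(1) by (rule LIMSEQ_if_dist_less)
  from gradients_near_accumulate[OF f this yg(2)] limiting_gradients_subset_clarke[of f x]
  show ?thesis by blast
qed

text \<open>The Clarke subdifferential is an intersection of half-spaces, and each of these contains all
  gradients at points close to \<open>x\<close>.\<close>

lemma clarke_outer_semicontinuous:
  fixes f :: "'a::euclidean_space \<Rightarrow> real"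
  assumes f: "L-lipschitz_on UNIV f" and y: "y \<longlonglongrightarrow> x" and v: "v \<longlonglongrightarrow> u"
    and mem: "\<And>n::nat. v n \<in> clarke_subdifferential f (y n)"
  shows "u \<in> clarke_subdifferential f x"
proof (rule ccontr)
  assume "u \<notin> clarke_subdifferential f x"
  then obtain a b where ab: "a \<bullet> u < b" "\<And>w. w \<in> clarke_subdifferential f x \<Longrightarrow> a \<bullet> w > b"
    using separating_hyperplane_closed_point[OF convex_clarke closed_clarke] by blast
  have "\<exists>\<eta>>0. \<forall>z g. dist z x < \<eta> \<and> (GDERIV f z :> g) \<longrightarrow> a \<bullet> g \<ge> b"
  proof (rule ccontr)
    assume contra: "\<not> ?thesis"
    have "\<exists>z g. dist z x < 1 / Suc n \<and> (GDERIV f z :> g) \<and> a \<bullet> g < b" for n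
    proof -
      have "1 / real (Suc n) > 0" by simp
      with contra show ?thesis by (meson not_le)
    qed
    then obtain z g where zg: "\<And>n. dist (z n) x < 1 / Suc n" "\<And>n. GDERIV f (z n) :> g n" "\<And>n. a \<bullet> g n < b"
      by metis
    have "z \<longlonglongrightarrow> x" using zg(1) by (rule LIMSEQ_if_dist_less)
    from gradients_near_accumulate[OF f this zg(2)] obtain w r where
      w: "strict_mono (r :: nat \<Rightarrow> nat)" "(g \<circ> r) \<longlonglongrightarrow> w" "w \<in> limiting_gradients f x" by blast
    have "a \<bullet> w \<le> b"
    proof (rule tendsto_upperbound)
      show "(\<lambda>n. a \<bullet> (g \<circ> r) n) \<longlonglongrightarrow> a \<bullet> w" by (intro tendsto_intros w)
      show "\<forall>\<^sub>F n in sequentially. a \<bullet> (g \<circ> r) n \<le> b"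
        using zg(3) by (auto intro!: always_eventually less_imp_le)
    qed auto
    moreover have "a \<bullet> w > b"
      using w(3) limiting_gradients_subset_clarke ab(2) by blast
    ultimately show False by simp
  qed
  then obtain \<eta> where \<eta>: "\<eta> > 0" "\<And>z g. dist z x < \<eta> \<Longrightarrow> GDERIV f z :> g \<Longrightarrow> a \<bullet> g \<ge> b" by blast
  have near: "clarke_subdifferential f z \<subseteq> {w. a \<bullet> w \<ge> b}" if z: "dist z x < \<eta>" for z
  proof (rule clarke_subset_if_limiting)
    show "limiting_gradients f z \<subseteq> {w. a \<bullet> w \<ge> b}"
    proof
      fix w assume "w \<in> limiting_gradients f z"
      then obtain y g where g: "y \<longlonglongrightarrow> z" "\<And>r::nat. GDERIV f (y r) :> g r" "g \<longlonglongrightarrow> w"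
        by (auto simp: limiting_gradients_def)
      have "a \<bullet> w \<ge> b"
      proof (rule tendsto_lowerbound)
        show "(\<lambda>n. a \<bullet> g n) \<longlonglongrightarrow> a \<bullet> w" by (intro tendsto_intros g)
        have "\<forall>\<^sub>F n in sequentially. dist (y n) x < \<eta>"
          using z g(1) by (intro order_tendstoD(2)[OF tendsto_dist[OF g(1) tendsto_const]])
        then show "\<forall>\<^sub>F n in sequentially. b \<le> a \<bullet> g n"
          by eventually_elim (use \<eta>(2) g(2) in blast)
      qed auto
      then show "w \<in> {w. a \<bullet> w \<ge> b}" by simp
    qed
    show "closed {w. a \<bullet> w \<ge> b}" "convex {w. a \<bullet> w \<ge> b}"
      by (auto simp: closed_halfspace_ge convex_halfspace_ge)
  qed
  have "a \<bullet> u \<ge> b"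
  proof (rule tendsto_lowerbound)
    show "(\<lambda>n. a \<bullet> v n) \<longlonglongrightarrow> a \<bullet> u" by (intro tendsto_intros v)
    have "\<forall>\<^sub>F n in sequentially. dist (y n) x < \<eta>"
      using \<eta>(1) tendstoD[OF y] by blast
    then show "\<forall>\<^sub>F n in sequentially. b \<le> a \<bullet> v n"
      by eventually_elim (use near mem in blast)
  qed auto
  with ab(1) show False by simp
qed

text \<open>The Clarke subdifferentials over a closed ball have a bounded union, which is closed by
  outer semicontinuity; in finite dimension the hull of a compact set is compact. This guarantees
  that the shortest vector is attained although the hull is taken without closure.\<close>

lemma compact_goldstein:
  fixes f :: "'a::euclidean_space \<Rightarrow> real"
  assumes f: "L-lipschitz_on UNIV f"
  shows "compact (goldstein_subdifferential f \<epsilon> x)"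
  unfolding goldstein_subdifferential_def
proof (rule compact_convex_hull)
  let ?K = "\<Union>y\<in>cball x \<epsilon>. clarke_subdifferential f y"
  have "bounded ?K"
    by (rule bounded_subset[OF bounded_cball[of 0 L]]) (rule UN_least[OF clarke_subset_cball[OF f]])
  moreover have "closed ?K"
    unfolding closed_sequential_limits
  proof (intro allI impI, elim conjE)
    fix v u assume v: "\<forall>n::nat. v n \<in> ?K" "v \<longlonglongrightarrow> u"
    then have "\<forall>n. \<exists>y. y \<in> cball x \<epsilon> \<and> v n \<in> clarke_subdifferential f y"
      by (auto simp only: UN_iff Bex_def)
    then obtain y where y: "\<forall>n. y n \<in> cball x \<epsilon> \<and> v n \<in> clarke_subdifferential f (y n)"
      using choice by meson
    obtain z r where r: "z \<in> cball x \<epsilon>" "strict_mono (r :: nat \<Rightarrow> nat)" "(y \<circ> r) \<longlonglongrightarrow> z"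
    proof -
      have "\<forall>n. y n \<in> cball x \<epsilon>" using y by simp
      with compact_cball[of x \<epsilon>] show thesis
        unfolding compact_def using that by blast
    qed
    have "u \<in> clarke_subdifferential f z"
      using clarke_outer_semicontinuous[OF f r(3) LIMSEQ_subseq_LIMSEQ[OF v(2) r(2)]] y by simp
    then show "u \<in> ?K" by (rule UN_I[OF r(1)])
  qed
  ultimately show "compact ?K" by (simp add: compact_eq_bounded_closed)
qed

lemma goldstein_nonempty:
  fixes f :: "'a::euclidean_space \<Rightarrow> real"
  assumes "L-lipschitz_on UNIV f" "\<epsilon> \<ge> 0"
  shows "goldstein_subdifferential f \<epsilon> x \<noteq> {}"
proof -
  have "x \<in> cball x \<epsilon>" using assms by simp
  then show ?thesis
    using clarke_nonempty[OF assms(1), of x] by (auto simp: goldstein_subdifferential_def)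
qed

lemma clarke_subset_goldstein:
  "y \<in> cball x \<epsilon> \<Longrightarrow> clarke_subdifferential f y \<subseteq> goldstein_subdifferential f \<epsilon> x"
  unfolding goldstein_subdifferential_def by (meson UN_upper hull_subset subset_trans)

lemma goldstein_subgradient_in:
  fixes f :: "'a::euclidean_space \<Rightarrow> real"
  assumes "L-lipschitz_on UNIV f" "\<epsilon> \<ge> 0"
  shows "goldstein_subgradient f \<epsilon> x \<in> goldstein_subdifferential f \<epsilon> x"
  unfolding goldstein_subgradient_def
  using closest_point_in_set[OF compact_imp_closed[OF compact_goldstein[OF assms(1)]] goldstein_nonempty[OF assms]] .

lemma norm_goldstein_subgradient_le:
  fixes f :: "'a::euclidean_space \<Rightarrow> real"
  assumes "L-lipschitz_on UNIV f" "v \<in> goldstein_subdifferential f \<epsilon> x"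
  shows "norm (goldstein_subgradient f \<epsilon> x) \<le> norm v"
  using closest_point_le[OF compact_imp_closed[OF compact_goldstein[OF assms(1)]] assms(2), of 0]
  by (simp add: goldstein_subgradient_def)

text \<open>The obtuse-angle property of the projection of 0 onto a convex set. It turns each
  gradient met along a step into a definite decrease.\<close>

lemma goldstein_subgradient_inner_ge:
  fixes f :: "'a::euclidean_space \<Rightarrow> real"
  assumes "L-lipschitz_on UNIV f" "v \<in> goldstein_subdifferential f \<epsilon> x"
  shows "goldstein_subgradient f \<epsilon> x \<bullet> v \<ge> (norm (goldstein_subgradient f \<epsilon> x))\<^sup>2"
  using closest_point_dot[OF _ compact_imp_closed[OF compact_goldstein[OF assms(1)]] assms(2), of 0]
  by (simp add: goldstein_subgradient_def goldstein_subdifferential_def convex_convex_hull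
      inner_diff_right power2_norm_eq_inner)

lemma norm_goldstein_subgradient_antimono:
  fixes f :: "'a::euclidean_space \<Rightarrow> real"
  assumes "L-lipschitz_on UNIV f" "0 \<le> \<epsilon>" "\<epsilon> \<le> \<epsilon>'"
  shows "norm (goldstein_subgradient f \<epsilon>' x) \<le> norm (goldstein_subgradient f \<epsilon> x)"
proof (rule norm_goldstein_subgradient_le[OF assms(1)])
  have "goldstein_subdifferential f \<epsilon> x \<subseteq> goldstein_subdifferential f \<epsilon>' x"
    unfolding goldstein_subdifferential_def using assms by (intro hull_mono UN_mono) auto
  then show "goldstein_subgradient f \<epsilon> x \<in> goldstein_subdifferential f \<epsilon>' x"
    using goldstein_subgradient_in[OF assms(1,2)] by blast
qed

lemma goldstein_inner_ge:
  assumes "\<And>y v. y \<in> cball x \<epsilon> \<Longrightarrow> v \<in> clarke_subdifferential f y \<Longrightarrow> c \<le> v \<bullet> w"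
    and "u \<in> goldstein_subdifferential f \<epsilon> x"
  shows "c \<le> u \<bullet> w"
proof -
  have "goldstein_subdifferential f \<epsilon> x \<subseteq> {u. w \<bullet> u \<ge> c}"
    unfolding goldstein_subdifferential_def using assms(1)
    by (intro hull_minimal convex_halfspace_ge) (auto simp: inner_commute)
  with assms(2) show ?thesis by (auto simp: inner_commute)
qed

text \<open>Gradients at points of the ball have inner product at least
  \<open>(norm g)\<^sup>2\<close> with \<open>g\<close>. The mean value inequality locates its
  gradient only near the segment, so a step of length \<open>t * \<epsilon>\<close> with
  \<open>t < 1\<close> is treated first, leaving room \<open>(1 - t) * \<epsilon>\<close> inside the
  ball; then t tends to 1.\<close>

theorem goldstein_descent:
  fixes f :: "'a::euclidean_space \<Rightarrow> real" and x :: 'a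
  assumes f: "L-lipschitz_on UNIV f" and "\<epsilon> \<ge> 0"
  defines "g \<equiv> goldstein_subgradient f \<epsilon> x"
  assumes g0: "g \<noteq> 0"
  shows "f (x - (\<epsilon> / norm g) *\<^sub>R g) \<le> f x - \<epsilon> * norm g"
proof (cases "\<epsilon> = 0")
  case False
  then have "\<epsilon> > 0" using assms by simp
  define e where "e = - (\<epsilon> / norm g) *\<^sub>R g"
  have ne: "norm e = \<epsilon>" using g0 \<open>\<epsilon> > 0\<close> by (simp add: e_def)
  have step: "f (x + t *\<^sub>R e) \<le> f x - t * (\<epsilon> * norm g)" if t: "0 < t" "t < 1" for t
  proof (rule field_le_epsilon)
    fix \<eta> :: real assume "\<eta> > 0"
    have "(1 - t) * \<epsilon> > 0" using t \<open>\<epsilon> > 0\<close> by simp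
    from lipschitz_mean_value[OF f this \<open>\<eta> > 0\<close>, of x "t *\<^sub>R e"] obtain \<tau> y h where
      \<tau>: "0 \<le> \<tau>" "\<tau> \<le> 1" and y: "dist y (x + \<tau> *\<^sub>R t *\<^sub>R e) < (1 - t) * \<epsilon>"
      and h: "GDERIV f y :> h" "h \<bullet> (t *\<^sub>R e) \<ge> f (x + t *\<^sub>R e) - f x - \<eta>"
      by auto
    have "dist x y \<le> dist y (x + \<tau> *\<^sub>R t *\<^sub>R e) + dist (x + \<tau> *\<^sub>R t *\<^sub>R e) x"
      by (metis dist_commute dist_triangle)
    also have "dist (x + \<tau> *\<^sub>R t *\<^sub>R e) x = \<tau> * t * \<epsilon>" using \<tau> t ne by (simp add: dist_norm)
    also have "\<tau> * t * \<epsilon> \<le> 1 * t * \<epsilon>" using \<tau> t \<open>\<epsilon> > 0\<close> by (intro mult_right_mono) auto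
    finally have "y \<in> cball x \<epsilon>" using y by (simp add: algebra_simps)
    then have "h \<in> goldstein_subdifferential f \<epsilon> x"
      using clarke_subset_goldstein GDERIV_in_clarke[OF h(1)] by blast
    then have gh: "(norm g)\<^sup>2 \<le> g \<bullet> h"
      unfolding g_def by (rule goldstein_subgradient_inner_ge[OF f])
    have "t * (\<epsilon> * norm g) = t * (\<epsilon> / norm g) * (norm g)\<^sup>2"
      using g0 by (simp add: power2_eq_square)
    also have "\<dots> \<le> t * (\<epsilon> / norm g) * (g \<bullet> h)"
      using gh t \<open>\<epsilon> > 0\<close> by (intro mult_left_mono) auto
    also have "\<dots> = - (h \<bullet> (t *\<^sub>R e))" by (simp add: e_def inner_commute)
    finally show "f (x + t *\<^sub>R e) \<le> f x - t * (\<epsilon> * norm g) + \<eta>" using h(2) by linarith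
  qed
  have "f (x + 1 *\<^sub>R e) \<le> f x - 1 * (\<epsilon> * norm g)"
  proof (rule tendsto_le[of "at_left 1"])
    have "isCont f z" for z
      using lipschitz_on_continuous_on[OF f] by (simp add: continuous_on_eq_continuous_at)
    then show "((\<lambda>t. f (x + t *\<^sub>R e)) \<longlongrightarrow> f (x + 1 *\<^sub>R e)) (at_left 1)"
      by (rule isCont_tendsto_compose) (intro tendsto_intros)
    show "((\<lambda>t. f x - t * (\<epsilon> * norm g)) \<longlongrightarrow> f x - 1 * (\<epsilon> * norm g)) (at_left 1)"
      by (intro tendsto_intros)
    have "\<forall>\<^sub>F t in at_left 1. t \<in> {0<..<1::real}" by (rule eventually_at_left_real) simp
    then show "\<forall>\<^sub>F t in at_left 1. f (x + t *\<^sub>R e) \<le> f x - t * (\<epsilon> * norm g)"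
      by eventually_elim (use step in auto)
  qed simp
  then show ?thesis by (simp add: e_def)
qed simp

text \<open>If a hyperplane with normal \<open>a\<close> separated 0 from the subdifferential,
  regularity would make the directional derivative along \<open>- a\<close> negative, contradicting
  minimality.\<close>

lemma zero_in_clarke_local_min:
  fixes f :: "'a::euclidean_space \<Rightarrow> real"
  assumes reg: "subdifferentially_regular f x" and min: "\<forall>\<^sub>F y in nhds x. f x \<le> f y"
  shows "0 \<in> clarke_subdifferential f x"
proof (rule ccontr)
  assume "0 \<notin> clarke_subdifferential f x"
  then obtain a b where ab: "a \<bullet> 0 < b" "\<And>w. w \<in> clarke_subdifferential f x \<Longrightarrow> a \<bullet> w > b"
    using separating_hyperplane_closed_point[OF convex_clarke closed_clarke] by blast
  obtain v where v: "v \<in> clarke_subdifferential f x"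
    "((\<lambda>t. (f (x + t *\<^sub>R (- a)) - f x) / t) \<longlongrightarrow> v \<bullet> (- a)) (at_right 0)"
    using reg unfolding subdifferentially_regular_def by blast
  have "0 \<le> v \<bullet> (- a)"
  proof (rule tendsto_lowerbound[OF v(2)])
    have "((\<lambda>t. x + t *\<^sub>R (- a)) \<longlongrightarrow> x + 0 *\<^sub>R (- a)) (at_right 0)"
      by (intro tendsto_intros)
    then have "filterlim (\<lambda>t. x + t *\<^sub>R (- a)) (nhds x) (at_right 0)" by simp
    from eventually_compose_filterlim[OF min this]
    have "\<forall>\<^sub>F t in at_right 0. f x \<le> f (x + t *\<^sub>R (- a))" .
    with eventually_at_right_less[of "0::real"]
    show "\<forall>\<^sub>F t in at_right 0. 0 \<le> (f (x + t *\<^sub>R (- a)) - f x) / t"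
      by eventually_elim simp
  qed auto
  with ab(1) ab(2)[OF v(1)] show False by (simp add: inner_commute)
qed

section \<open>Functions on embedded manifolds\<close>

lemma has_vector_derivative_quotient:
  assumes "(c has_vector_derivative a) (at 0)"
  shows "((\<lambda>t. (c t - c 0) /\<^sub>R t) \<longlongrightarrow> a) (at 0)"
proof -
  have "((\<lambda>t. norm (c t - c 0 - t *\<^sub>R a) / norm t) \<longlongrightarrow> 0) (at 0)"
    using assms by (simp add: has_vector_derivative_def has_derivative_at)
  moreover have "\<forall>\<^sub>F t in at 0. norm (c t - c 0 - t *\<^sub>R a) / norm t = norm ((c t - c 0) /\<^sub>R t - a)"
  proof -
    have "norm (c t - c 0 - t *\<^sub>R a) / norm t = norm ((c t - c 0) /\<^sub>R t - a)" if "t \<noteq> 0" for t :: real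
    proof -
      have "(c t - c 0) /\<^sub>R t - a = (c t - c 0 - t *\<^sub>R a) /\<^sub>R t"
        using that by (simp add: scaleR_diff_right)
      then show ?thesis by (simp add: divide_inverse mult.commute)
    qed
    then show ?thesis by (simp add: eventually_at_filter)
  qed
  ultimately have "((\<lambda>t. norm ((c t - c 0) /\<^sub>R t - a)) \<longlongrightarrow> 0) (at 0)"
    by (simp add: tendsto_cong)
  then show ?thesis by (rule LIM_zero_cancel[OF tendsto_norm_zero_cancel])
qed

lemma C1_curve_derivative:
  assumes "C1_curve_at M p \<gamma>"
  shows "(\<gamma> has_vector_derivative vector_derivative \<gamma> (at 0)) (at 0)" "\<gamma> 0 = p"
    "\<forall>\<^sub>F t in nhds 0. \<gamma> t \<in> M"
proof -
  obtain e where e: "\<gamma> 0 = p" "e > 0" "\<gamma> C1_differentiable_on {-e<..<e}" "\<gamma> ` {-e<..<e} \<subseteq> M"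
    using assms by (auto simp: C1_curve_at_def)
  then obtain D where "\<forall>t\<in>{-e<..<e}. (\<gamma> has_vector_derivative D t) (at t)"
    by (auto simp: C1_differentiable_on_def)
  then have "(\<gamma> has_vector_derivative D 0) (at 0)"
    using e(2) by simp
  then show "(\<gamma> has_vector_derivative vector_derivative \<gamma> (at 0)) (at 0)"
    by (simp add: vector_derivative_at)
  show "\<gamma> 0 = p" by (rule e)
  have "\<forall>\<^sub>F t in nhds 0. t \<in> {-e<..<e}"
    using e(2) by (intro eventually_nhds_in_open) auto
  then show "\<forall>\<^sub>F t in nhds 0. \<gamma> t \<in> M"
    by eventually_elim (use e(4) in auto)
qed

lemma eventually_nhds_curve:
  assumes "isCont \<gamma> 0" "open U" "\<gamma> 0 \<in> U"
  shows "\<forall>\<^sub>F t in nhds 0. \<gamma> t \<in> U"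
  using assms by (auto simp: isCont_def eventually_at_filter elim!: eventually_mono dest!: topological_tendstoD)

text \<open>Only first-order data of the chart are recorded. Second-order information on
  \<open>\<psi>\<close> enters at a single point, as an assumption of
  \<open>gradient_growth\<close>.\<close>

locale flattening_chart =
  fixes M U V S :: "'a::euclidean_space set" and \<phi> \<psi> :: "'a \<Rightarrow> 'a" and \<phi>' \<psi>' :: "'a \<Rightarrow> 'a \<Rightarrow>\<^sub>L 'a"
  assumes open_U: "open U" and open_V: "open V" and homeo: "homeomorphism U V \<phi> \<psi>"
    and subspace_S: "subspace S" and image_M: "\<phi> ` (M \<inter> U) = S \<inter> V"
    and deriv_\<phi>: "\<And>x. x \<in> U \<Longrightarrow> (\<phi> has_derivative blinfun_apply (\<phi>' x)) (at x)"
    and deriv_\<psi>: "\<And>y. y \<in> V \<Longrightarrow> (\<psi> has_derivative blinfun_apply (\<psi>' y)) (at y)"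
    and cont_\<phi>': "continuous_on U \<phi>'" and cont_\<psi>': "continuous_on V \<psi>'"
begin

lemma \<psi>_\<phi>: "x \<in> U \<Longrightarrow> \<psi> (\<phi> x) = x"
  using homeo by (auto simp: homeomorphism_def)

lemma \<phi>_\<psi>: "y \<in> V \<Longrightarrow> \<phi> (\<psi> y) = y"
  using homeo by (auto simp: homeomorphism_def)

lemma \<phi>_in: "x \<in> U \<Longrightarrow> \<phi> x \<in> V"
  using homeo by (auto simp: homeomorphism_def)

lemma \<psi>_in: "y \<in> V \<Longrightarrow> \<psi> y \<in> U"
  using homeo by (auto simp: homeomorphism_def)

lemma \<phi>_in_S: "x \<in> M \<Longrightarrow> x \<in> U \<Longrightarrow> \<phi> x \<in> S"
  using image_M by blast

lemma \<psi>_in_M: "y \<in> S \<Longrightarrow> y \<in> V \<Longrightarrow> \<psi> y \<in> M"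
  using image_M \<psi>_\<phi> by (metis IntE IntI imageE)

lemma chart_curve:
  assumes p: "p \<in> M" "p \<in> U" and s: "s \<in> S"
  shows "\<exists>\<gamma>. C1_curve_at M p \<gamma> \<and> vector_derivative \<gamma> (at 0) = \<psi>' (\<phi> p) s"
proof -
  let ?\<gamma> = "\<lambda>t. \<psi> (\<phi> p + t *\<^sub>R s)"
  have "open ((\<lambda>t. \<phi> p + t *\<^sub>R s) -` V)"
    by (intro open_vimage open_V continuous_intros)
  moreover have "0 \<in> (\<lambda>t. \<phi> p + t *\<^sub>R s) -` V" using \<phi>_in[OF p(2)] by simp
  ultimately obtain e where e: "e > 0" "ball 0 e \<subseteq> (\<lambda>t. \<phi> p + t *\<^sub>R s) -` V"
    by (meson openE)
  then have inV: "\<phi> p + t *\<^sub>R s \<in> V" if "t \<in> {-e<..<e}" for t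
    using that by (auto simp: subset_iff)
  have D: "(?\<gamma> has_vector_derivative \<psi>' (\<phi> p + t *\<^sub>R s) s) (at t)" if "t \<in> {-e<..<e}" for t
  proof -
    have "((\<lambda>t. \<phi> p + t *\<^sub>R s) has_derivative (\<lambda>h. h *\<^sub>R s)) (at t)"
      by (auto intro!: derivative_eq_intros)
    from has_derivative_compose[OF this deriv_\<psi>[OF inV[OF that]]] show ?thesis
      by (simp add: has_vector_derivative_def blinfun.scaleR_right)
  qed
  have "C1_curve_at M p ?\<gamma>"
    unfolding C1_curve_at_def C1_differentiable_on_def
  proof (intro conjI exI[of _ e] exI[of _ "\<lambda>t. \<psi>' (\<phi> p + t *\<^sub>R s) s"] ballI)
    show "continuous_on {-e<..<e} (\<lambda>t. \<psi>' (\<phi> p + t *\<^sub>R s) s)"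
      using inV by (intro continuous_intros continuous_on_compose2[OF cont_\<psi>']) auto
    show "?\<gamma> ` {-e<..<e} \<subseteq> M"
    proof
      fix y assume "y \<in> ?\<gamma> ` {-e<..<e}"
      then obtain t where t: "t \<in> {-e<..<e}" "y = ?\<gamma> t" by blast
      have "\<phi> p + t *\<^sub>R s \<in> S"
        using \<phi>_in_S[OF p] s by (intro subspace_add subspace_scale subspace_S)
      with inV[OF t(1)] t(2) show "y \<in> M" by (simp add: \<psi>_in_M)
    qed
  qed (use \<psi>_\<phi> p e D in auto)
  moreover have "vector_derivative ?\<gamma> (at 0) = \<psi>' (\<phi> p) s"
    using D[of 0] e by (simp add: vector_derivative_at)
  ultimately show ?thesis by blast
qed

text \<open>Difference quotients of \<open>\<phi> \<circ> \<gamma>\<close> lie in \<open>S\<close>,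
  which is closed, hence so does their limit. The second claim differentiates
  \<open>\<psi> \<circ> \<phi> \<circ> \<gamma> = \<gamma>\<close>.\<close>

lemma tangent_coordinates:
  assumes p: "p \<in> M" "p \<in> U" and w: "w \<in> tangent_space M p"
  shows "\<phi>' p w \<in> S" "\<psi>' (\<phi> p) (\<phi>' p w) = w"
proof -
  obtain \<gamma> where \<gamma>: "C1_curve_at M p \<gamma>" "w = vector_derivative \<gamma> (at 0)"
    using w unfolding tangent_space_def by blast
  note C = C1_curve_derivative[OF \<gamma>(1), folded \<gamma>(2)]
  have cont: "isCont \<gamma> 0" using C(1) by (rule has_vector_derivative_continuous)
  have inU: "\<forall>\<^sub>F t in nhds 0. \<gamma> t \<in> U"
    using cont open_U p(2) C(2) by (intro eventually_nhds_curve) auto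
  have d\<gamma>: "(\<gamma> has_derivative (\<lambda>h. h *\<^sub>R w)) (at 0)"
    using C(1) by (simp add: has_vector_derivative_def)
  have d\<phi>: "((\<lambda>t. \<phi> (\<gamma> t)) has_derivative (\<lambda>h. h *\<^sub>R \<phi>' p w)) (at 0)"
    using has_derivative_compose[OF d\<gamma>, of \<phi> "\<phi>' p"] deriv_\<phi>[OF p(2)] C(2) by (simp add: blinfun.scaleR_right)
  have lim: "((\<lambda>t. (\<phi> (\<gamma> t) - \<phi> p) /\<^sub>R t) \<longlongrightarrow> \<phi>' p w) (at 0)"
    using d\<phi> C(2) has_vector_derivative_quotient[of "\<lambda>t. \<phi> (\<gamma> t)"]
    by (simp add: has_vector_derivative_def)
  show "\<phi>' p w \<in> S"
  proof (rule Lim_in_closed_set[OF closed_subspace[OF subspace_S] _ _ lim])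
    have "\<forall>\<^sub>F t in nhds 0. (\<phi> (\<gamma> t) - \<phi> p) /\<^sub>R t \<in> S"
      using inU C(3)
    proof eventually_elim
      case (elim t)
      then show ?case
        using \<phi>_in_S p subspace_S by (intro subspace_scale subspace_diff) auto
    qed
    then show "\<forall>\<^sub>F t in at 0. (\<phi> (\<gamma> t) - \<phi> p) /\<^sub>R t \<in> S"
      by (simp add: eventually_at_filter eventually_mono)
  qed simp
  have "((\<lambda>t. \<psi> (\<phi> (\<gamma> t))) has_derivative (\<lambda>h. h *\<^sub>R \<psi>' (\<phi> p) (\<phi>' p w))) (at 0)"
    using has_derivative_compose[OF d\<phi>, of \<psi> "\<psi>' (\<phi> p)"] deriv_\<psi>[OF \<phi>_in[OF p(2)]] C(2) by (simp add: blinfun.scaleR_right)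
  moreover have "\<forall>\<^sub>F t in at 0. \<psi> (\<phi> (\<gamma> t)) = \<gamma> t"
    using inU unfolding eventually_at_filter by eventually_elim (simp add: \<psi>_\<phi>)
  moreover have "\<psi> (\<phi> (\<gamma> 0)) = \<gamma> 0"
    using C(2) \<psi>_\<phi>[OF p(2)] by simp
  ultimately have "(\<gamma> has_derivative (\<lambda>h. h *\<^sub>R \<psi>' (\<phi> p) (\<phi>' p w))) (at 0)"
    by (rule has_derivative_transform_eventually) simp
  from has_derivative_unique[OF this d\<gamma>]
  show "\<psi>' (\<phi> p) (\<phi>' p w) = w" by (metis scaleR_one)
qed

lemma tangent_space_eq:
  assumes p: "p \<in> M" "p \<in> U"
  shows "tangent_space M p = \<psi>' (\<phi> p) ` S"
proof
  show "tangent_space M p \<subseteq> \<psi>' (\<phi> p) ` S"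
    using tangent_coordinates[OF p] by (metis image_eqI subsetI)
  show "\<psi>' (\<phi> p) ` S \<subseteq> tangent_space M p"
    using chart_curve[OF p] by (force simp: tangent_space_def)
qed

lemma subspace_tangent_space:
  assumes "p \<in> M" "p \<in> U"
  shows "subspace (tangent_space M p)"
  unfolding tangent_space_eq[OF assms]
  by (intro linear_subspace_image subspace_S bounded_linear.linear blinfun.bounded_linear_right)

end

text \<open>The mean value inequality is applied to \<open>g\<close> minus its linearization at
  \<open>b\<close>, whose derivative \<open>g' z - g' b\<close> is small on a small ball by
  continuity of \<open>g'\<close>. The point is uniformity in the base point \<open>b\<close>, as
  tangent spaces at moving points will be compared.\<close>

lemma C1_strictly_differentiable:
  fixes g :: "'a::euclidean_space \<Rightarrow> 'b::real_normed_vector" and g' :: "'a \<Rightarrow> 'a \<Rightarrow>\<^sub>L 'b"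
  assumes U: "open U" "x0 \<in> U" and deriv: "\<And>x. x \<in> U \<Longrightarrow> (g has_derivative blinfun_apply (g' x)) (at x)"
    and cont: "continuous_on U g'" and \<eta>: "\<eta> > 0"
  shows "\<exists>\<rho>>0. ball x0 \<rho> \<subseteq> U \<and> (\<forall>a\<in>ball x0 \<rho>. \<forall>b\<in>ball x0 \<rho>.
    norm (g a - g b - g' b (a - b)) \<le> \<eta> * norm (a - b) \<and> norm (g' b) \<le> norm (g' x0) + \<eta>)"
proof -
  obtain \<rho>1 where \<rho>1: "\<rho>1 > 0" "ball x0 \<rho>1 \<subseteq> U" using U openE by blast
  have "isCont g' x0" using cont U by (simp add: continuous_on_eq_continuous_at)
  then obtain \<rho>2 where \<rho>2: "\<rho>2 > 0" "\<And>x. dist x x0 < \<rho>2 \<Longrightarrow> dist (g' x) (g' x0) < \<eta> / 2"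
    using \<eta> unfolding continuous_at_eps_delta by (meson half_gt_zero)
  define \<rho> where "\<rho> = min \<rho>1 \<rho>2"
  have near: "norm (g' x - g' x0) < \<eta> / 2" "x \<in> U" if "x \<in> ball x0 \<rho>" for x
    using that \<rho>1 \<rho>2(2)[of x] by (auto simp: \<rho>_def dist_norm norm_minus_commute subset_iff)
  have "norm (g a - g b - g' b (a - b)) \<le> \<eta> * norm (a - b)" if a: "a \<in> ball x0 \<rho>" and b: "b \<in> ball x0 \<rho>" for a b
  proof -
    have "norm ((g a - g' b a) - (g b - g' b b)) \<le> \<eta> * norm (a - b)"
    proof (rule differentiable_bound[of "ball x0 \<rho>" "\<lambda>z. g z - g' b z" "\<lambda>z. blinfun_apply (g' z - g' b)"])
      fix z assume z: "z \<in> ball x0 \<rho>"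
      have "((\<lambda>z. g z - g' b z) has_derivative (\<lambda>h. g' z h - g' b h)) (at z)"
        by (intro has_derivative_diff deriv near(2)[OF z] bounded_linear_imp_has_derivative blinfun.bounded_linear_right)
      then show "((\<lambda>z. g z - g' b z) has_derivative blinfun_apply (g' z - g' b)) (at z within ball x0 \<rho>)"
        by (simp add: minus_blinfun.rep_eq has_derivative_at_withinI)
      have "norm (g' z - g' b) \<le> norm (g' z - g' x0) + norm (g' b - g' x0)"
        by (rule norm_triangle_ineq4[of "g' z - g' x0" "g' b - g' x0", simplified])
      also have "\<dots> \<le> \<eta>" using near(1)[OF z] near(1)[OF b] by simp
      finally show "onorm (blinfun_apply (g' z - g' b)) \<le> \<eta>" by (simp add: norm_blinfun.rep_eq)
    qed (use a b in auto)
    then show ?thesis by (simp add: blinfun.diff_right algebra_simps)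
  qed
  moreover have "norm (g' b) \<le> norm (g' x0) + \<eta>" if "b \<in> ball x0 \<rho>" for b
    using near(1)[OF that] norm_triangle_ineq2[of "g' b" "g' x0"] \<eta> by linarith
  ultimately show ?thesis
    using \<rho>1 \<rho>2 by (intro exI[of _ \<rho>]) (auto simp: \<rho>_def)
qed

lemma C1_locally_lipschitz:
  fixes g :: "'a::euclidean_space \<Rightarrow> 'b::real_normed_vector" and g' :: "'a \<Rightarrow> 'a \<Rightarrow>\<^sub>L 'b"
  assumes U: "open U" "x0 \<in> U" and deriv: "\<And>x. x \<in> U \<Longrightarrow> (g has_derivative blinfun_apply (g' x)) (at x)"
    and cont: "continuous_on U g'"
  obtains \<rho> C where "\<rho> > 0" "C > 0" "ball x0 \<rho> \<subseteq> U"
    "\<And>a b. a \<in> ball x0 \<rho> \<Longrightarrow> b \<in> ball x0 \<rho> \<Longrightarrow> norm (g a - g b) \<le> C * norm (a - b)"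
    "\<And>b. b \<in> ball x0 \<rho> \<Longrightarrow> norm (g' b) \<le> C"
proof -
  obtain \<rho> where \<rho>: "\<rho> > 0" "ball x0 \<rho> \<subseteq> U" and
    b: "\<And>a b. a \<in> ball x0 \<rho> \<Longrightarrow> b \<in> ball x0 \<rho> \<Longrightarrow> norm (g a - g b - g' b (a - b)) \<le> 1 * norm (a - b) \<and> norm (g' b) \<le> norm (g' x0) + 1"
    using C1_strictly_differentiable[OF U deriv cont, of 1] by auto
  define C where "C = norm (g' x0) + 2"
  have C: "C > 0" using norm_ge_zero[of "g' x0"] unfolding C_def by linarith
  have "norm (g a - g b) \<le> C * norm (a - b)" if ab: "a \<in> ball x0 \<rho>" "b \<in> ball x0 \<rho>" for a b
  proof -
    have "norm (g a - g b) \<le> norm (g a - g b - g' b (a - b)) + norm (g' b (a - b))"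
      by (metis diff_add_cancel norm_triangle_ineq)
    also have "norm (g' b (a - b)) \<le> norm (g' b) * norm (a - b)" by (rule norm_blinfun)
    also have "\<dots> \<le> (norm (g' x0) + 1) * norm (a - b)" using b[OF ab] by (intro mult_right_mono) auto
    also have "norm (g a - g b - g' b (a - b)) \<le> 1 * norm (a - b)" using b[OF ab] by blast
    finally show ?thesis by (simp add: C_def algebra_simps)
  qed
  moreover have "norm (g' z) \<le> C" if "z \<in> ball x0 \<rho>" for z
    using b[OF that that] by (simp add: C_def)
  ultimately show thesis using that[OF \<rho>(1) C \<rho>(2)] by blast
qed

locale manifold_restriction = flattening_chart M U V S \<phi> \<psi> \<phi>' \<psi>'
  for M U V S :: "'a::euclidean_space set" and \<phi> \<psi> :: "'a \<Rightarrow> 'a" and \<phi>' \<psi>' :: "'a \<Rightarrow> 'a \<Rightarrow>\<^sub>L 'a" +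
  fixes f F :: "'a \<Rightarrow> real" and F' :: "'a \<Rightarrow> 'a \<Rightarrow>\<^sub>L real" and W :: "'a set" and L :: real
  assumes lip: "L-lipschitz_on UNIV f" and open_W: "open W"
    and F_eq: "\<And>x. x \<in> M \<Longrightarrow> x \<in> W \<Longrightarrow> F x = f x"
    and deriv_F: "\<And>x. x \<in> W \<Longrightarrow> (F has_derivative blinfun_apply (F' x)) (at x)"
    and reg: "\<And>x. x \<in> M \<Longrightarrow> subdifferentially_regular f x"
begin

lemma curve_derivative_f:
  assumes q: "q \<in> M" "q \<in> W" and \<gamma>: "C1_curve_at M q \<gamma>"
  shows "((f \<circ> \<gamma>) has_real_derivative F' q (vector_derivative \<gamma> (at 0))) (at 0)"
proof -
  define w where "w = vector_derivative \<gamma> (at 0)"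
  note C = C1_curve_derivative[OF \<gamma>, folded w_def]
  have "isCont \<gamma> 0" using C(1) by (rule has_vector_derivative_continuous)
  then have "\<forall>\<^sub>F t in nhds 0. \<gamma> t \<in> W"
    using C(2) q open_W by (intro eventually_nhds_curve) auto
  with C(3) have ev: "\<forall>\<^sub>F t in nhds 0. F (\<gamma> t) = f (\<gamma> t)"
    by eventually_elim (rule F_eq)
  have "(\<gamma> has_derivative (\<lambda>h. h *\<^sub>R w)) (at 0)"
    using C(1) by (simp add: has_vector_derivative_def)
  moreover have "(F has_derivative blinfun_apply (F' q)) (at (\<gamma> 0))"
    using deriv_F q C(2) by simp
  ultimately have d: "((\<lambda>t. F (\<gamma> t)) has_derivative (\<lambda>h. F' q (h *\<^sub>R w))) (at 0)"
    by (rule has_derivative_compose)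
  have "((\<lambda>t. f (\<gamma> t)) has_derivative (\<lambda>h. F' q (h *\<^sub>R w))) (at 0)"
  proof (rule has_derivative_transform_eventually[OF d])
    show "\<forall>\<^sub>F t in at 0. F (\<gamma> t) = f (\<gamma> t)"
      using ev unfolding eventually_at_filter by eventually_elim simp
    show "F (\<gamma> 0) = f (\<gamma> 0)" using F_eq q C(2) by simp
  qed simp
  then have "((\<lambda>t. f (\<gamma> t)) has_real_derivative F' q w) (at 0)"
    by (rule has_derivative_imp_has_field_derivative) (simp add: blinfun.scaleR_right)
  then show ?thesis by (simp add: comp_def w_def)
qed

text \<open>The gradient is the orthogonal projection onto the tangent space of the vector
  representing \<open>F' q\<close>. The difference of two candidates is again the velocity of a
  curve in \<open>M\<close>, and testing both along that curve shows that it vanishes.\<close>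

lemma riemannian_gradient:
  assumes q: "q \<in> M" "q \<in> U" "q \<in> W"
  shows "riemannian_gradient M f q \<in> tangent_space M q"
    "\<And>w. w \<in> tangent_space M q \<Longrightarrow> riemannian_gradient M f q \<bullet> w = F' q w"
proof -
  define T where "T = tangent_space M q"
  have sT: "subspace T" unfolding T_def by (rule subspace_tangent_space[OF q(1,2)])
  define z where "z = (\<Sum>b\<in>Basis. F' q b *\<^sub>R b)"
  have z: "F' q h = z \<bullet> h" for h
  proof -
    have "F' q h = F' q (\<Sum>b\<in>Basis. (h \<bullet> b) *\<^sub>R b)" by (simp add: euclidean_representation)
    also have "\<dots> = z \<bullet> h"
      by (simp add: blinfun.sum_right blinfun.scaleR_right z_def inner_sum_left inner_commute[of h] mult.commute)
    finally show ?thesis .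
  qed
  obtain g n where g: "g \<in> span T" "\<And>w. w \<in> span T \<Longrightarrow> orthogonal n w" "z = g + n"
    using orthogonal_subspace_decomp_exists[of T z] by blast
  have gT: "g \<in> T" using g(1) sT by (simp add: span_eq_iff[THEN iffD2])
  have gw: "g \<bullet> w = F' q w" if "w \<in> T" for w
    using g(2)[of w] that by (simp add: z g(3) orthogonal_def span_base inner_add_left)
  have vT: "vector_derivative \<gamma> (at 0) \<in> T" if "C1_curve_at M q \<gamma>" for \<gamma>
    unfolding T_def tangent_space_def using that by blast
  have "riemannian_gradient M f q = g"
    unfolding riemannian_gradient_def
  proof (rule the_equality)
    show "g \<in> tangent_space M q \<and> (\<forall>\<gamma>. C1_curve_at M q \<gamma> \<longrightarrow>
        ((f \<circ> \<gamma>) has_real_derivative g \<bullet> vector_derivative \<gamma> (at 0)) (at 0))"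
      using gT gw vT curve_derivative_f[OF q(1,3)] by (simp add: T_def)
    fix g' assume g': "g' \<in> tangent_space M q \<and> (\<forall>\<gamma>. C1_curve_at M q \<gamma> \<longrightarrow>
        ((f \<circ> \<gamma>) has_real_derivative g' \<bullet> vector_derivative \<gamma> (at 0)) (at 0))"
    have "g' - g \<in> T" using g' gT sT by (intro subspace_diff) (auto simp: T_def)
    then obtain \<gamma> where \<gamma>: "C1_curve_at M q \<gamma>" "g' - g = vector_derivative \<gamma> (at 0)"
      unfolding T_def tangent_space_def by blast
    have "((f \<circ> \<gamma>) has_real_derivative g' \<bullet> (g' - g)) (at 0)" using g' \<gamma> by simp
    moreover have "((f \<circ> \<gamma>) has_real_derivative F' q (g' - g)) (at 0)"
      using curve_derivative_f[OF q(1,3) \<gamma>(1)] by (simp only: \<gamma>(2))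
    ultimately have "g' \<bullet> (g' - g) = F' q (g' - g)" by (rule DERIV_unique)
    also have "\<dots> = g \<bullet> (g' - g)" using gw[OF \<open>g' - g \<in> T\<close>] by simp
    finally have "(g' - g) \<bullet> (g' - g) = 0" by (simp add: inner_diff_left)
    then show "g' = g" by simp
  qed
  then show "riemannian_gradient M f q \<in> tangent_space M q"
    "\<And>w. w \<in> tangent_space M q \<Longrightarrow> riemannian_gradient M f q \<bullet> w = F' q w"
    using gT gw by (auto simp: T_def)
qed

text \<open>By regularity, \<open>w \<mapsto> max {\<langle>u,w\<rangle> | u \<in> \<partial>f(q)}\<close> is the directional derivative, which is linear along
  the tangent space.\<close>

lemma clarke_tangent:
  assumes q: "q \<in> M" "q \<in> U" "q \<in> W" and u: "u \<in> clarke_subdifferential f q"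
    and w: "w \<in> tangent_space M q"
  shows "u \<bullet> w = riemannian_gradient M f q \<bullet> w"
proof -
  have le: "u \<bullet> w \<le> F' q w" if w: "w \<in> tangent_space M q" for w
  proof -
    obtain \<gamma> where \<gamma>: "C1_curve_at M q \<gamma>" "w = vector_derivative \<gamma> (at 0)"
      using w unfolding tangent_space_def by blast
    note C = C1_curve_derivative[OF \<gamma>(1), folded \<gamma>(2)]
    obtain v where v: "u \<bullet> w \<le> v \<bullet> w"
      "((\<lambda>t. (f (q + t *\<^sub>R w) - f q) / t) \<longlongrightarrow> v \<bullet> w) (at_right 0)"
      using reg[OF q(1)] u unfolding subdifferentially_regular_def by blast
    have "((f \<circ> \<gamma>) has_real_derivative F' q w) (at 0)"
      using curve_derivative_f[OF q(1,3) \<gamma>(1)] by (simp only: \<gamma>(2))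
    then have "((\<lambda>t. (f (\<gamma> t) - f q) / t) \<longlongrightarrow> F' q w) (at 0)"
      by (simp add: has_field_derivative_iff C(2))
    then have lim1: "((\<lambda>t. (f (\<gamma> t) - f q) / t) \<longlongrightarrow> F' q w) (at_right 0)"
      by (rule tendsto_within_subset) simp
    have "((\<lambda>t. L * norm ((\<gamma> t - \<gamma> 0) /\<^sub>R t - w)) \<longlongrightarrow> L * norm (w - w)) (at 0)"
      by (intro tendsto_intros has_vector_derivative_quotient[OF C(1)])
    then have lim2: "((\<lambda>t. L * norm ((\<gamma> t - \<gamma> 0) /\<^sub>R t - w)) \<longlongrightarrow> 0) (at_right 0)"
      by (intro tendsto_within_subset[of _ _ 0 UNIV "{0<..}"]) simp_all
    \<comment> \<open>Regularity speaks of straight lines, smoothness on \<open>M\<close> of curves.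
      As \<open>\<gamma> t - (q + t *\<^sub>R w)\<close> is o(t) and \<open>f\<close> is Lipschitz,
      the two quotients have the same limit.\<close>
    have "((\<lambda>t. (f (q + t *\<^sub>R w) - f q) / t - (f (\<gamma> t) - f q) / t) \<longlongrightarrow> 0) (at_right 0)"
    proof (rule Lim_null_comparison[OF _ lim2])
      have "norm ((f (q + t *\<^sub>R w) - f q) / t - (f (\<gamma> t) - f q) / t) \<le> L * norm ((\<gamma> t - \<gamma> 0) /\<^sub>R t - w)"
        if "t > 0" for t
      proof -
        have "\<bar>f (q + t *\<^sub>R w) - f (\<gamma> t)\<bar> \<le> L * norm (\<gamma> t - (q + t *\<^sub>R w))"
          using lipschitz_onD[OF lip, of "q + t *\<^sub>R w" "\<gamma> t"] by (simp add: dist_norm norm_minus_commute)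
        also have "\<gamma> t - (q + t *\<^sub>R w) = t *\<^sub>R ((\<gamma> t - \<gamma> 0) /\<^sub>R t - w)"
          using that C(2) by (simp add: scaleR_diff_right)
        also have "L * norm \<dots> = t * (L * norm ((\<gamma> t - \<gamma> 0) /\<^sub>R t - w))" using that by simp
        finally have "\<bar>f (q + t *\<^sub>R w) - f (\<gamma> t)\<bar> / t \<le> L * norm ((\<gamma> t - \<gamma> 0) /\<^sub>R t - w)"
          using that by (simp add: pos_divide_le_eq mult.commute)
        moreover have "(f (q + t *\<^sub>R w) - f q) / t - (f (\<gamma> t) - f q) / t = (f (q + t *\<^sub>R w) - f (\<gamma> t)) / t"
          by (simp add: diff_divide_distrib)
        ultimately show ?thesis using that by (simp add: abs_divide)
      qed
      then show "\<forall>\<^sub>F t in at_right 0. norm ((f (q + t *\<^sub>R w) - f q) / t - (f (\<gamma> t) - f q) / t) \<le> L * norm ((\<gamma> t - \<gamma> 0) /\<^sub>R t - w)"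
        using eventually_at_right_less[of "0::real"] by (auto elim: eventually_mono)
    qed
    moreover have "((\<lambda>t. (f (q + t *\<^sub>R w) - f q) / t - (f (\<gamma> t) - f q) / t) \<longlongrightarrow> v \<bullet> w - F' q w) (at_right 0)"
      by (intro tendsto_diff v(2) lim1)
    ultimately have "v \<bullet> w - F' q w = 0" using tendsto_unique trivial_limit_at_right_real by blast
    with v(1) show ?thesis by simp
  qed
  \<comment> \<open>\<open>F' q\<close> is linear, so the bound at \<open>- w\<close> is the reverse
    inequality at \<open>w\<close>.\<close>
  have "- w \<in> tangent_space M q"
    using subspace_neg[OF subspace_tangent_space[OF q(1,2)] w] .
  from le[OF this] le[OF w] show ?thesis
    by (simp add: riemannian_gradient(2)[OF q w] blinfun.minus_right)
qed

text \<open>Chords of \<open>M\<close> are nearly tangent, uniformly in both endpoints: the tangent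
  vector is the image of the chart's chord, which lies in \<open>S\<close>, and strict
  differentiability of \<open>\<psi>\<close> bounds the error. The tolerance
  \<open>\<eta> / C\<close> compensates for the Lipschitz constant \<open>C\<close> of
  \<open>\<phi>\<close>.\<close>

lemma tangent_approximation:
  assumes x: "x \<in> M" "x \<in> U" and "\<eta> > 0"
  shows "\<exists>\<rho>>0. ball x \<rho> \<subseteq> U \<and> (\<forall>p\<in>M \<inter> ball x \<rho>. \<forall>q\<in>M \<inter> ball x \<rho>.
    \<phi> p - \<phi> q \<in> S \<and> \<psi>' (\<phi> q) (\<phi> p - \<phi> q) \<in> tangent_space M q \<and>
    norm (p - q - \<psi>' (\<phi> q) (\<phi> p - \<phi> q)) \<le> \<eta> * norm (p - q))"
proof -
  obtain \<rho>1 C where \<rho>1: "\<rho>1 > 0" "ball x \<rho>1 \<subseteq> U" and C: "C > 0"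
    and lip\<phi>: "\<And>a b. a \<in> ball x \<rho>1 \<Longrightarrow> b \<in> ball x \<rho>1 \<Longrightarrow> norm (\<phi> a - \<phi> b) \<le> C * norm (a - b)"
    using C1_locally_lipschitz[OF open_U x(2) deriv_\<phi> cont_\<phi>'] by metis
  obtain \<rho>2 where \<rho>2: "\<rho>2 > 0" "ball (\<phi> x) \<rho>2 \<subseteq> V" and
    b2: "\<And>a b. a \<in> ball (\<phi> x) \<rho>2 \<Longrightarrow> b \<in> ball (\<phi> x) \<rho>2 \<Longrightarrow> norm (\<psi> a - \<psi> b - \<psi>' b (a - b)) \<le> \<eta> / C * norm (a - b)"
    using C1_strictly_differentiable[OF open_V \<phi>_in[OF x(2)] deriv_\<psi> cont_\<psi>', of "\<eta> / C"] \<open>\<eta> > 0\<close> C by auto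
  define \<rho> where "\<rho> = min \<rho>1 (\<rho>2 / C)"
  have \<rho>: "\<rho> > 0" using \<rho>1 \<rho>2 C by (simp add: \<rho>_def)
  have in2: "\<phi> p \<in> ball (\<phi> x) \<rho>2" if "p \<in> ball x \<rho>" for p
  proof -
    have "norm (\<phi> p - \<phi> x) \<le> C * norm (p - x)"
      using that \<rho>1 by (intro lip\<phi>) (auto simp: \<rho>_def)
    also have "\<dots> < C * (\<rho>2 / C)"
      using that C by (intro mult_strict_left_mono) (auto simp: \<rho>_def dist_norm norm_minus_commute)
    also have "\<dots> = \<rho>2" using C by simp
    finally show ?thesis by (simp add: dist_norm norm_minus_commute)
  qed
  have "\<phi> p - \<phi> q \<in> S \<and> \<psi>' (\<phi> q) (\<phi> p - \<phi> q) \<in> tangent_space M q \<and>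
      norm (p - q - \<psi>' (\<phi> q) (\<phi> p - \<phi> q)) \<le> \<eta> * norm (p - q)"
    if p: "p \<in> M \<inter> ball x \<rho>" and q: "q \<in> M \<inter> ball x \<rho>" for p q
  proof (intro conjI)
    have pq: "p \<in> M" "q \<in> M" "p \<in> ball x \<rho>1" "q \<in> ball x \<rho>1" using p q by (auto simp: \<rho>_def)
    then have pqU: "p \<in> U" "q \<in> U" using \<rho>1 by auto
    show S: "\<phi> p - \<phi> q \<in> S"
      using pq pqU by (intro subspace_diff subspace_S \<phi>_in_S)
    then show "\<psi>' (\<phi> q) (\<phi> p - \<phi> q) \<in> tangent_space M q"
      unfolding tangent_space_eq[OF pq(2) pqU(2)] by blast
    have "norm (\<psi> (\<phi> p) - \<psi> (\<phi> q) - \<psi>' (\<phi> q) (\<phi> p - \<phi> q)) \<le> \<eta> / C * norm (\<phi> p - \<phi> q)"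
      using p q by (intro b2 in2) auto
    also have "\<dots> \<le> \<eta> / C * (C * norm (p - q))"
      using pq \<open>\<eta> > 0\<close> C by (intro mult_left_mono lip\<phi>) auto
    finally show "norm (p - q - \<psi>' (\<phi> q) (\<phi> p - \<phi> q)) \<le> \<eta> * norm (p - q)"
      using C by (simp add: \<psi>_\<phi> pqU)
  qed
  then show ?thesis using \<rho> \<rho>1 by (intro exI[of _ \<rho>]) (auto simp: \<rho>_def)
qed


text \<open>In the chart, \<open>h = F \<circ> \<psi>\<close> has a quadratic minimum on \<open>S\<close> at \<open>\<phi> x\<close>, and \<open>h'\<close> is differentiable there.
  The mean value theorem \<open>h (s + e) - h s = h' (s + \<tau> e) e\<close> turns the quadratic growth into
  positive definiteness of the second derivative.\<close>

lemma gradient_growth: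
  assumes x: "x \<in> M" "x \<in> U" "x \<in> W"
    and F'2: "(F' has_derivative F2) (at x)" and \<psi>'2: "(\<psi>' has_derivative \<psi>2) (at (\<phi> x))"
    and growth: "\<delta> > 0" "\<forall>\<^sub>F y in nhds x. f y - f x \<ge> \<delta> / 2 * (norm (y - x))\<^sup>2"
  shows "\<exists>c>0. \<exists>C>0. \<exists>\<rho>>0. \<forall>q\<in>M \<inter> ball x \<rho>. q \<in> U \<and> q \<in> W \<and>
    norm (riemannian_gradient M f q) \<le> C * norm (q - x) \<and>
    riemannian_gradient M f q \<bullet> (q - x) \<ge> c * (norm (q - x))\<^sup>2"
proof -
  define s0 where "s0 = \<phi> x"
  have s0: "s0 \<in> V" "s0 \<in> S" "\<psi> s0 = x" using x by (auto simp: s0_def \<phi>_in \<phi>_in_S \<psi>_\<phi>)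
  \<comment> \<open>\<open>H\<close> is the derivative of \<open>F \<circ> \<psi>\<close>; its own
    derivative \<open>D\<close> at \<open>s0\<close> plays the part of the Hessian.\<close>
  define H where "H s = F' (\<psi> s) o\<^sub>L \<psi>' s" for s
  have H: "H s e = F' (\<psi> s) (\<psi>' s e)" for s e by (simp add: H_def)
  have "((\<lambda>s. F' (\<psi> s)) has_derivative (\<lambda>h. F2 (\<psi>' s0 h))) (at s0)"
    using has_derivative_compose[OF deriv_\<psi>[OF s0(1)], of F' F2] F'2 s0(3) by simp
  from bounded_bilinear.FDERIV[OF bounded_bilinear_blinfun_compose this, of \<psi>' \<psi>2] \<psi>'2
  obtain D where D: "(H has_derivative D) (at s0)"
    unfolding H_def[abs_def] s0_def by blast
  have linD: "bounded_linear D" using D by (rule has_derivative_bounded_linear)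
  obtain K where K: "K > 0" "\<And>h. norm (D h) \<le> norm h * K"
    using bounded_linear.pos_bounded[OF linD] by blast
  obtain \<rho>1 C1 where \<rho>1: "\<rho>1 > 0" "ball x \<rho>1 \<subseteq> U" and C1: "C1 > 0"
    and lip\<phi>: "\<And>a b. a \<in> ball x \<rho>1 \<Longrightarrow> b \<in> ball x \<rho>1 \<Longrightarrow> norm (\<phi> a - \<phi> b) \<le> C1 * norm (a - b)"
    and bd\<phi>: "\<And>b. b \<in> ball x \<rho>1 \<Longrightarrow> norm (\<phi>' b) \<le> C1"
    using C1_locally_lipschitz[OF open_U x(2) deriv_\<phi> cont_\<phi>'] by metis
  obtain \<rho>2 C2 where \<rho>2: "\<rho>2 > 0" "ball s0 \<rho>2 \<subseteq> V" and C2: "C2 > 0"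
    and lip\<psi>: "\<And>a b. a \<in> ball s0 \<rho>2 \<Longrightarrow> b \<in> ball s0 \<rho>2 \<Longrightarrow> norm (\<psi> a - \<psi> b) \<le> C2 * norm (a - b)"
    using C1_locally_lipschitz[OF open_V s0(1) deriv_\<psi> cont_\<psi>'] by metis
  have "\<forall>\<^sub>F y in nhds x. y \<in> W \<and> f y - f x \<ge> \<delta> / 2 * (norm (y - x))\<^sup>2"
    using growth(2) eventually_nhds_in_open[OF open_W x(3)] by eventually_elim simp
  then obtain \<rho>3 where \<rho>3: "\<rho>3 > 0"
    "\<And>y. dist y x < \<rho>3 \<Longrightarrow> y \<in> W \<and> f y - f x \<ge> \<delta> / 2 * (norm (y - x))\<^sup>2"
    unfolding eventually_nhds_metric by blast
  \<comment> \<open>The growth constant in chart coordinates: lengths in the chart exceed lengths on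
    \<open>M\<close> by at most the factor \<open>C1\<close>.\<close>
  define \<delta>1 where "\<delta>1 = \<delta> / (2 * C1\<^sup>2)"
  have \<delta>1: "\<delta>1 > 0" using growth(1) C1 by (simp add: \<delta>1_def)
  obtain \<rho>4 where \<rho>4: "\<rho>4 > 0"
    "\<And>s. norm (s - s0) < \<rho>4 \<Longrightarrow> norm (H s - H s0 - D (s - s0)) \<le> \<delta>1 / 4 * norm (s - s0)"
    using D \<delta>1 unfolding has_derivative_at_alt by (meson divide_pos_pos zero_less_numeral)
  define r0 where "r0 = min (min \<rho>2 \<rho>4) (min \<rho>1 \<rho>3 / C2)"
  have r0: "r0 > 0" "r0 \<le> \<rho>2" "r0 \<le> \<rho>4" using \<rho>1 \<rho>2 \<rho>3 \<rho>4 C2 by (auto simp: r0_def)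
  have near: "s \<in> V" "\<psi> s \<in> ball x \<rho>1" "dist (\<psi> s) x < \<rho>3" if "norm (s - s0) < r0" for s
  proof -
    have s: "s \<in> ball s0 \<rho>2" using that r0 by (simp add: dist_norm norm_minus_commute)
    then show "s \<in> V" using \<rho>2 by blast
    have "norm (\<psi> s - x) \<le> C2 * norm (s - s0)"
      using lip\<psi>[OF s, of s0] \<rho>2 s0 by simp
    also have "\<dots> < C2 * (min \<rho>1 \<rho>3 / C2)"
      using that C2 by (intro mult_strict_left_mono) (auto simp: r0_def)
    finally have "norm (\<psi> s - x) < min \<rho>1 \<rho>3" using C2 by simp
    then show "\<psi> s \<in> ball x \<rho>1" "dist (\<psi> s) x < \<rho>3" by (auto simp: dist_norm norm_minus_commute)
  qed
  \<comment> \<open>0 lies in the Clarke subdifferential at the minimizer \<open>x\<close>, and on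
    tangent vectors every element of that set agrees with \<open>F' x\<close>.\<close>
  have zero: "H s0 e = 0" if "e \<in> S" for e
  proof -
    have T: "\<psi>' s0 e \<in> tangent_space M x"
      unfolding tangent_space_eq[OF x(1,2)] s0_def using that by blast
    have "\<forall>\<^sub>F y in nhds x. f x \<le> f y"
      using growth(2) by eventually_elim (use growth(1) in \<open>smt (verit) mult_nonneg_nonneg zero_le_power2 divide_nonneg_nonneg\<close>)
    then have "0 \<in> clarke_subdifferential f x"
      by (rule zero_in_clarke_local_min[OF reg[OF x(1)]])
    from clarke_tangent[OF x this T] riemannian_gradient(2)[OF x T]
    show ?thesis by (simp add: H s0(3))
  qed
  have approx: "\<bar>H (s0 + t *\<^sub>R e) e' - t * D e e'\<bar> \<le> \<delta>1 / 4 * (t * norm e) * norm e'"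
    if e: "norm e < r0" "e' \<in> S" and t: "0 \<le> t" "t \<le> 1" for t e e'
  proof -
    have "t * norm e \<le> 1 * norm e" using t by (intro mult_right_mono) auto
    then have lt: "norm ((s0 + t *\<^sub>R e) - s0) < \<rho>4" using e r0 t by simp
    have "D (t *\<^sub>R e) = t *\<^sub>R D e" using linD by (simp add: linear_cmul bounded_linear.linear)
    then have eq: "H (s0 + t *\<^sub>R e) e' - t * D e e' = (H (s0 + t *\<^sub>R e) - H s0 - D (s0 + t *\<^sub>R e - s0)) e'"
      using zero[OF e(2)] by (simp add: blinfun.diff_left blinfun.scaleR_left)
    have "norm \<dots> \<le> norm (H (s0 + t *\<^sub>R e) - H s0 - D (s0 + t *\<^sub>R e - s0)) * norm e'"
      by (rule norm_blinfun)
    also have "\<dots> \<le> (\<delta>1 / 4 * norm ((s0 + t *\<^sub>R e) - s0)) * norm e'"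
      using \<rho>4(2)[OF lt] by (intro mult_right_mono) auto
    finally show ?thesis unfolding eq using t by simp
  qed
  have convex: "H (s0 + e) e \<ge> \<delta>1 / 2 * (norm e)\<^sup>2" if e: "e \<in> S" "norm e < r0" for e
  proof (cases "e = 0")
    case False
    have inr: "norm ((s0 + t *\<^sub>R e) - s0) < r0" if "0 \<le> t" "t \<le> 1" for t
    proof -
      have "t * norm e \<le> 1 * norm e" using that by (intro mult_right_mono) auto
      then show ?thesis using e that by simp
    qed
    have "((\<lambda>t. F (\<psi> (s0 + t *\<^sub>R e))) has_real_derivative H (s0 + t *\<^sub>R e) e) (at t)" if t: "0 \<le> t" "t \<le> 1" for t
    proof -
      have "((\<lambda>t. s0 + t *\<^sub>R e) has_derivative (\<lambda>h. h *\<^sub>R e)) (at t)"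
        by (auto intro!: derivative_eq_intros)
      from has_derivative_compose[OF this deriv_\<psi>[OF near(1)[OF inr[OF t]]]]
      have "((\<lambda>t. \<psi> (s0 + t *\<^sub>R e)) has_derivative (\<lambda>h. \<psi>' (s0 + t *\<^sub>R e) (h *\<^sub>R e))) (at t)" .
      moreover have "\<psi> (s0 + t *\<^sub>R e) \<in> W" using near(3)[OF inr[OF t]] \<rho>3 by blast
      ultimately have "((\<lambda>t. F (\<psi> (s0 + t *\<^sub>R e))) has_derivative (\<lambda>h. F' (\<psi> (s0 + t *\<^sub>R e)) (\<psi>' (s0 + t *\<^sub>R e) (h *\<^sub>R e)))) (at t)"
        by (intro has_derivative_compose[OF _ deriv_F])
      then show ?thesis
        by (rule has_derivative_imp_has_field_derivative) (simp add: H blinfun.scaleR_right)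
    qed
    then obtain \<tau> where \<tau>: "0 < \<tau>" "\<tau> < 1" "F (\<psi> (s0 + 1 *\<^sub>R e)) - F (\<psi> (s0 + 0 *\<^sub>R e)) = (1 - 0) * H (s0 + \<tau> *\<^sub>R e) e"
      using MVT2[of 0 1 "\<lambda>t. F (\<psi> (s0 + t *\<^sub>R e))" "\<lambda>t. H (s0 + t *\<^sub>R e) e"] by auto
    have n1: "norm ((s0 + e) - s0) < r0" using e by simp
    have "\<psi> (s0 + e) \<in> M"
      using e s0 near(1)[OF n1] by (intro \<psi>_in_M subspace_add[OF subspace_S])
    then have Ff: "F (\<psi> (s0 + e)) - F x = f (\<psi> (s0 + e)) - f x"
      using \<rho>3(2)[OF near(3)[OF n1]] F_eq x by simp
    have "norm (\<phi> (\<psi> (s0 + e)) - \<phi> x) \<le> C1 * norm (\<psi> (s0 + e) - x)"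
      using \<rho>1 by (intro lip\<phi> near(2)[OF n1]) auto
    then have "norm e \<le> C1 * norm (\<psi> (s0 + e) - x)"
      using near(1)[OF n1] by (simp add: \<phi>_\<psi> s0_def)
    then have "(norm e)\<^sup>2 \<le> (C1 * norm (\<psi> (s0 + e) - x))\<^sup>2"
      by (intro power_mono) auto
    then have "\<delta>1 * (norm e)\<^sup>2 \<le> \<delta>1 * (C1 * norm (\<psi> (s0 + e) - x))\<^sup>2"
      using \<delta>1 by (intro mult_left_mono) auto
    also have "\<dots> = \<delta> / 2 * (norm (\<psi> (s0 + e) - x))\<^sup>2"
      using C1 by (simp add: \<delta>1_def power_mult_distrib)
    also have "\<dots> \<le> f (\<psi> (s0 + e)) - f x"
      using \<rho>3(2)[OF near(3)[OF n1]] by blast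
    also have "\<dots> = H (s0 + \<tau> *\<^sub>R e) e" using \<tau>(3) Ff s0(3) by simp
    also have "\<dots> \<le> \<tau> * (D e e + \<delta>1 / 4 * (norm e)\<^sup>2)"
    proof -
      have "\<bar>H (s0 + \<tau> *\<^sub>R e) e - \<tau> * D e e\<bar> \<le> \<delta>1 / 4 * (\<tau> * norm e) * norm e"
        using e \<tau> by (intro approx) auto
      also have "\<dots> = \<tau> * (\<delta>1 / 4 * (norm e)\<^sup>2)" by (simp add: power2_eq_square)
      finally show ?thesis unfolding distrib_left by linarith
    qed
    finally have le: "\<delta>1 * (norm e)\<^sup>2 \<le> \<tau> * (D e e + \<delta>1 / 4 * (norm e)\<^sup>2)" .
    moreover have "\<delta>1 * (norm e)\<^sup>2 > 0" using \<delta>1 False by simp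
    ultimately have "D e e + \<delta>1 / 4 * (norm e)\<^sup>2 > 0"
      using \<tau> by (smt (verit) mult_nonneg_nonpos)
    then have "\<tau> * (D e e + \<delta>1 / 4 * (norm e)\<^sup>2) \<le> 1 * (D e e + \<delta>1 / 4 * (norm e)\<^sup>2)"
      using \<tau> by (intro mult_right_mono) auto
    from order_trans[OF le this] have "\<delta>1 * (norm e)\<^sup>2 \<le> D e e + \<delta>1 / 4 * (norm e)\<^sup>2"
      by (simp only: mult_1)
    moreover have "H (s0 + e) e \<ge> D e e - \<delta>1 / 4 * (norm e)\<^sup>2"
    proof -
      have "\<bar>H (s0 + 1 *\<^sub>R e) e - 1 * D e e\<bar> \<le> \<delta>1 / 4 * (1 * norm e) * norm e"
        using e by (intro approx) auto
      also have "\<dots> = \<delta>1 / 4 * (norm e)\<^sup>2" by (simp add: power2_eq_square)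
      finally show ?thesis unfolding scaleR_one mult_1 by linarith
    qed
    ultimately show ?thesis by simp
  qed simp
  define K1 where "K1 = K + \<delta>1 / 4"
  have K1: "K1 > 0" using K \<delta>1 by (simp add: K1_def)
  have upper: "H (s0 + e) e' \<le> K1 * norm e * norm e'" if "norm e < r0" "e' \<in> S" for e e'
  proof -
    have "\<bar>D e e'\<bar> \<le> norm (D e) * norm e'" using norm_blinfun[of "D e" e'] by simp
    also have "\<dots> \<le> (norm e * K) * norm e'" by (intro mult_right_mono K) auto
    finally have "\<bar>D e e'\<bar> \<le> (norm e * K) * norm e'" .
    moreover have "\<bar>H (s0 + 1 *\<^sub>R e) e' - 1 * D e e'\<bar> \<le> \<delta>1 / 4 * (1 * norm e) * norm e'"
      using that by (intro approx) auto
    moreover have "K1 * norm e * norm e' = (norm e * K) * norm e' + \<delta>1 / 4 * (1 * norm e) * norm e'"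
      by (simp add: K1_def algebra_simps)
    ultimately show ?thesis by (simp only: scaleR_one mult_1)
  qed
  define C where "C = K1 * C1\<^sup>2"
  have C: "C > 0" using K1 C1 by (simp add: C_def)
  \<comment> \<open>In the chart the constant \<open>2 * c\<close> is available. Half of it pays for
    replacing the tangent vector \<open>\<psi>' (\<phi> q) e\<close> by the chord
    \<open>q - x\<close>, which is why the tolerance below is \<open>c / C\<close>.\<close>
  define c where "c = \<delta>1 / (4 * C2\<^sup>2)"
  have c: "c > 0" using \<delta>1 C2 by (simp add: c_def)
  obtain \<rho>5 where \<rho>5: "\<rho>5 > 0" "\<And>p q. p \<in> M \<inter> ball x \<rho>5 \<Longrightarrow> q \<in> M \<inter> ball x \<rho>5 \<Longrightarrow>
    norm (p - q - \<psi>' (\<phi> q) (\<phi> p - \<phi> q)) \<le> c / C * norm (p - q)"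
    using tangent_approximation[OF x(1,2), of "c / C"] c C by (meson divide_pos_pos)
  define \<rho> where "\<rho> = min (min \<rho>1 \<rho>3) (min \<rho>5 (r0 / C1))"
  have \<rho>: "\<rho> > 0" using \<rho>1 \<rho>3 \<rho>5 r0 C1 by (simp add: \<rho>_def)
  have "q \<in> U \<and> q \<in> W \<and> norm (riemannian_gradient M f q) \<le> C * norm (q - x) \<and>
    riemannian_gradient M f q \<bullet> (q - x) \<ge> c * (norm (q - x))\<^sup>2" if q: "q \<in> M \<inter> ball x \<rho>" for q
  proof -
    have qM: "q \<in> M" and q1: "q \<in> ball x \<rho>1" and q3: "dist q x < \<rho>3" and q5: "q \<in> ball x \<rho>5"
      and qr: "norm (q - x) < r0 / C1"
      using q by (auto simp: \<rho>_def dist_commute dist_norm norm_minus_commute)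
    have qU: "q \<in> U" using q1 \<rho>1 by blast
    have qW: "q \<in> W" using \<rho>3(2)[OF q3] by blast
    note qq = qM qU qW
    define g where "g = riemannian_gradient M f q"
    have gT: "g \<in> tangent_space M q" and gw: "\<And>w. w \<in> tangent_space M q \<Longrightarrow> g \<bullet> w = F' q w"
      using riemannian_gradient[OF qq] by (auto simp: g_def)
    define e where "e = \<phi> q - s0"
    have eS: "e \<in> S" unfolding e_def using \<phi>_in_S[OF qM qU] s0 by (intro subspace_diff subspace_S)
    have e1: "norm e \<le> C1 * norm (q - x)"
      unfolding e_def s0_def using q1 \<rho>1 by (intro lip\<phi>) auto
    also have "\<dots> < C1 * (r0 / C1)" using qr C1 by (intro mult_strict_left_mono) auto
    finally have er: "norm e < r0" using C1 by simp
    have se: "s0 + e = \<phi> q" by (simp add: e_def)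
    have Hq: "H (s0 + e) e' = F' q (\<psi>' (\<phi> q) e')" for e'
      by (simp add: se H \<psi>_\<phi>[OF qU])
    \<comment> \<open>The chart coordinates of the gradient itself: evaluating
      \<open>H (s0 + e)\<close> at them yields the squared norm of \<open>g\<close>, so an upper
      bound on \<open>H\<close> becomes one on \<open>norm g\<close>.\<close>
    define e' where "e' = \<phi>' q g"
    have e': "e' \<in> S" "\<psi>' (\<phi> q) e' = g"
      using tangent_coordinates[OF qM qU gT] by (auto simp: e'_def)
    have "norm e' \<le> norm (\<phi>' q) * norm g" unfolding e'_def by (rule norm_blinfun)
    also have "\<dots> \<le> C1 * norm g" by (intro mult_right_mono bd\<phi> q1) auto
    finally have ne': "norm e' \<le> C1 * norm g" .
    have "norm g * norm g = g \<bullet> g" by (simp add: power2_norm_eq_inner[symmetric] power2_eq_square)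
    also have "\<dots> = H (s0 + e) e'" using gw[OF gT] by (simp add: Hq e'(2))
    also have "\<dots> \<le> K1 * norm e * norm e'" by (rule upper[OF er e'(1)])
    also have "\<dots> \<le> K1 * (C1 * norm (q - x)) * (C1 * norm g)"
      using K1 C1 e1 ne' by (intro mult_mono mult_left_mono) auto
    also have "\<dots> = (C * norm (q - x)) * norm g" by (simp add: C_def power2_eq_square)
    finally have gC: "norm g \<le> C * norm (q - x)"
      using C by (cases "g = 0") auto
    have "norm (\<psi> (\<phi> q) - \<psi> s0) \<le> C2 * norm (\<phi> q - s0)"
      using er r0 \<rho>2 by (intro lip\<psi>) (auto simp: e_def dist_norm norm_minus_commute)
    then have "norm (q - x) \<le> C2 * norm e" using \<psi>_\<phi>[OF qU] s0 by (simp add: e_def)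
    then have "(norm (q - x))\<^sup>2 \<le> (C2 * norm e)\<^sup>2" by (intro power_mono) auto
    then have "2 * c * (norm (q - x))\<^sup>2 \<le> 2 * c * (C2 * norm e)\<^sup>2"
      using c by (intro mult_left_mono) auto
    also have "\<dots> = \<delta>1 / 2 * (norm e)\<^sup>2" using C2 by (simp add: c_def power_mult_distrib)
    also have "\<dots> \<le> H (s0 + e) e" by (rule convex[OF eS er])
    also have "\<dots> = g \<bullet> \<psi>' (\<phi> q) e"
      using gw[of "\<psi>' (\<phi> q) e"] eS by (simp add: Hq tangent_space_eq[OF qM qU])
    finally have main: "2 * c * (norm (q - x))\<^sup>2 \<le> g \<bullet> \<psi>' (\<phi> q) e" .
    have "norm (x - q - \<psi>' (\<phi> q) (\<phi> x - \<phi> q)) \<le> c / C * norm (x - q)"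
      using q5 qM x \<rho>5(1) by (intro \<rho>5(2)) auto
    also have "\<phi> x - \<phi> q = - e" by (simp add: e_def s0_def)
    also have "x - q - \<psi>' (\<phi> q) (- e) = - ((q - x) - \<psi>' (\<phi> q) e)" by (simp add: blinfun.minus_right)
    finally have err: "norm ((q - x) - \<psi>' (\<phi> q) e) \<le> c / C * norm (q - x)"
      by (simp only: norm_minus_cancel norm_minus_commute[of x])
    have "\<bar>g \<bullet> ((q - x) - \<psi>' (\<phi> q) e)\<bar> \<le> norm g * norm ((q - x) - \<psi>' (\<phi> q) e)"
      by (rule Cauchy_Schwarz_ineq2)
    also have "\<dots> \<le> (C * norm (q - x)) * (c / C * norm (q - x))"
      using gC err C by (intro mult_mono) auto
    also have "\<dots> = c * (norm (q - x))\<^sup>2" using C by (simp add: power2_eq_square)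
    finally have "g \<bullet> (q - x) \<ge> g \<bullet> \<psi>' (\<phi> q) e - c * (norm (q - x))\<^sup>2"
      unfolding inner_diff_right by linarith
    with main have "g \<bullet> (q - x) \<ge> c * (norm (q - x))\<^sup>2" by linarith
    with gC qU qW show ?thesis by (simp add: g_def)
  qed
  with c C \<rho> show ?thesis by blast
qed

end

section \<open>Chart-free consequences and projection onto the manifold\<close>

lemma C2_onD:
  assumes "C2_on U (F :: 'a::euclidean_space \<Rightarrow> 'b::euclidean_space)"
  shows "open U"
    "\<exists>(F' :: 'a \<Rightarrow> 'a \<Rightarrow>\<^sub>L 'b) F''. (\<forall>x\<in>U. (F has_derivative blinfun_apply (F' x)) (at x)) \<and>
      (\<forall>x\<in>U. (F' has_derivative F'' x) (at x)) \<and> continuous_on U F'"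
proof -
  obtain F' :: "'a \<Rightarrow> 'a \<Rightarrow>\<^sub>L 'b" and F'' :: "'a \<Rightarrow> 'a \<Rightarrow>\<^sub>L 'a \<Rightarrow>\<^sub>L 'b" where
    F: "\<forall>x\<in>U. (F has_derivative blinfun_apply (F' x)) (at x)"
    "\<forall>x\<in>U. (F' has_derivative blinfun_apply (F'' x)) (at x)"
    using assms unfolding C2_on_def by blast
  have "continuous_on U F'"
    using F(2) by (intro continuous_at_imp_continuous_on ballI has_derivative_continuous) blast
  with F show "\<exists>(F' :: 'a \<Rightarrow> 'a \<Rightarrow>\<^sub>L 'b) F''. (\<forall>x\<in>U. (F has_derivative blinfun_apply (F' x)) (at x)) \<and>
      (\<forall>x\<in>U. (F' has_derivative F'' x) (at x)) \<and> continuous_on U F'"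
    by (intro exI[of _ F'] exI[of _ "\<lambda>x. blinfun_apply (F'' x)"]) simp
  show "open U" using assms unfolding C2_on_def by blast
qed

lemma C2_manifold_aroundE:
  assumes "C2_manifold_around M (x::'a::euclidean_space)"
  obtains U V S \<phi> \<psi> \<phi>' \<psi>' \<psi>2 where "flattening_chart M U V S \<phi> \<psi> \<phi>' \<psi>'" "x \<in> M" "x \<in> U"
    "(\<psi>' has_derivative \<psi>2) (at (\<phi> x))"
proof -
  obtain U V S \<phi> \<psi> where *: "x \<in> M" "x \<in> U" "C2_on U (\<phi> :: 'a \<Rightarrow> 'a)" "C2_on V (\<psi> :: 'a \<Rightarrow> 'a)"
    "homeomorphism U V \<phi> \<psi>" "subspace S" "\<phi> ` (M \<inter> U) = S \<inter> V"
    using assms unfolding C2_manifold_around_def by blast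
  obtain \<phi>' where \<phi>: "\<forall>x\<in>U. (\<phi> has_derivative blinfun_apply (\<phi>' x)) (at x)" "continuous_on U \<phi>'"
    using C2_onD(2)[OF *(3)] by blast
  obtain \<psi>' \<psi>2 where \<psi>: "\<forall>x\<in>V. (\<psi> has_derivative blinfun_apply (\<psi>' x)) (at x)"
    "\<forall>x\<in>V. (\<psi>' has_derivative \<psi>2 x) (at x)" "continuous_on V \<psi>'"
    using C2_onD(2)[OF *(4)] by blast
  have chart: "flattening_chart M U V S \<phi> \<psi> \<phi>' \<psi>'"
    by unfold_locales (use * \<phi> \<psi> C2_onD(1) in auto)
  have "\<phi> x \<in> V" using * by (auto simp: homeomorphism_def)
  with \<psi>(2) have \<psi>2: "(\<psi>' has_derivative \<psi>2 (\<phi> x)) (at (\<phi> x))" by (rule bspec)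
  note that1 = that[OF chart]
  note that2 = that1[OF *(1) *(2)]
  show thesis by (rule that2[OF \<psi>2])
qed

lemma manifold_growth_structure:
  fixes f :: "'a::euclidean_space \<Rightarrow> real"
  assumes M: "C2_manifold_around M x" and f: "L-lipschitz_on UNIV f"
    and reg: "\<forall>y\<in>M. subdifferentially_regular f y" and C2: "C2_on_manifold_around M f x"
    and growth: "\<delta> > 0" "\<forall>\<^sub>F y in nhds x. f y - f x \<ge> \<delta> / 2 * (norm (y - x))\<^sup>2"
  shows "\<exists>c>0. \<exists>C>0. (\<forall>\<eta>>0. \<exists>\<rho>>0. \<forall>p\<in>M \<inter> ball x \<rho>. \<forall>q\<in>M \<inter> ball x \<rho>.
        \<exists>w\<in>tangent_space M q. norm (p - q - w) \<le> \<eta> * norm (p - q)) \<and>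
    (\<exists>\<rho>>0. \<forall>q\<in>M \<inter> ball x \<rho>. norm (riemannian_gradient M f q) \<le> C * norm (q - x) \<and>
        c * (norm (q - x))\<^sup>2 \<le> riemannian_gradient M f q \<bullet> (q - x) \<and>
        (\<forall>u\<in>clarke_subdifferential f q. \<forall>w\<in>tangent_space M q. u \<bullet> w = riemannian_gradient M f q \<bullet> w))"
proof -
  obtain U V S \<phi> \<psi> \<phi>' \<psi>' \<psi>2 where chart: "flattening_chart M U V S \<phi> \<psi> \<phi>' \<psi>'" and x: "x \<in> M" "x \<in> U"
    and \<psi>2: "(\<psi>' has_derivative \<psi>2) (at (\<phi> x))"
    by (rule C2_manifold_aroundE[OF M])
  obtain W F where W: "x \<in> W" "C2_on W F" "\<forall>y\<in>M \<inter> W. F y = f y"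
    using C2 unfolding C2_on_manifold_around_def by blast
  obtain F' F'' where F: "\<forall>x\<in>W. (F has_derivative blinfun_apply (F' x)) (at x)"
    "\<forall>x\<in>W. (F' has_derivative F'' x) (at x)"
    using C2_onD(2)[OF W(2)] by blast
  interpret flattening_chart M U V S \<phi> \<psi> \<phi>' \<psi>' by (rule chart)
  interpret manifold_restriction M U V S \<phi> \<psi> \<phi>' \<psi>' f F F' W L
    by unfold_locales (use f F W reg C2_onD(1)[OF W(2)] in auto)
  from gradient_growth[OF x W(1) F(2)[rule_format, OF W(1)] \<psi>2 growth]
  obtain c C \<rho> where c: "c > 0" and C: "C > 0" and \<rho>: "\<rho> > 0" and
    G: "\<forall>q\<in>M \<inter> ball x \<rho>. q \<in> U \<and> q \<in> W \<and> norm (riemannian_gradient M f q) \<le> C * norm (q - x) \<and>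
      riemannian_gradient M f q \<bullet> (q - x) \<ge> c * (norm (q - x))\<^sup>2"
    by (elim exE conjE)
  have T: "\<exists>\<rho>>0. \<forall>p\<in>M \<inter> ball x \<rho>. \<forall>q\<in>M \<inter> ball x \<rho>.
      \<exists>w\<in>tangent_space M q. norm (p - q - w) \<le> \<eta> * norm (p - q)" if "\<eta> > 0" for \<eta>
  proof -
    from tangent_approximation[OF x that] obtain \<rho> where "\<rho> > 0" and
      t: "\<forall>p\<in>M \<inter> ball x \<rho>. \<forall>q\<in>M \<inter> ball x \<rho>. \<phi> p - \<phi> q \<in> S \<and>
        \<psi>' (\<phi> q) (\<phi> p - \<phi> q) \<in> tangent_space M q \<and>
        norm (p - q - \<psi>' (\<phi> q) (\<phi> p - \<phi> q)) \<le> \<eta> * norm (p - q)"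
      by (elim exE conjE)
    show ?thesis
    proof (intro exI[of _ \<rho>] conjI ballI)
      fix p q assume "p \<in> M \<inter> ball x \<rho>" "q \<in> M \<inter> ball x \<rho>"
      with t show "\<exists>w\<in>tangent_space M q. norm (p - q - w) \<le> \<eta> * norm (p - q)" by blast
    qed fact
  qed
  have K: "u \<bullet> w = riemannian_gradient M f q \<bullet> w"
    if "q \<in> M \<inter> ball x \<rho>" "u \<in> clarke_subdifferential f q" "w \<in> tangent_space M q" for q u w
    using that(1) G by (intro clarke_tangent that(2,3)) auto
  show ?thesis
    by (intro exI[of _ c] exI[of _ C] exI[of _ \<rho>] conjI c C \<rho> T allI impI ballI; (rule K)?)
      (use G in auto)
qed

text \<open>\<open>M\<close> may fail to be closed globally, but its part in a small closed ball is
  closed, being the preimage of \<open>S\<close> under the chart. With half the radius for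
  \<open>y\<close>, every point of \<open>M\<close> outside that ball is farther from
  \<open>y\<close> than \<open>x\<close> is, so the minimum over the closed part is the minimum over
  \<open>M\<close>.\<close>

lemma closest_point_near_manifold:
  fixes x :: "'a::euclidean_space"
  assumes "C2_manifold_around M x"
  shows "\<exists>\<rho>>0. \<forall>y\<in>ball x \<rho>. closest_point M y \<in> M \<and>
    norm (y - closest_point M y) = infdist y M \<and> infdist y M \<le> norm (y - x)"
proof -
  obtain U V S \<phi> \<psi> \<phi>' \<psi>' \<psi>2 where chart: "flattening_chart M U V S \<phi> \<psi> \<phi>' \<psi>'" and x: "x \<in> M" "x \<in> U"
    and "(\<psi>' has_derivative \<psi>2) (at (\<phi> x))"
    by (rule C2_manifold_aroundE[OF assms])
  interpret flattening_chart M U V S \<phi> \<psi> \<phi>' \<psi>' by (rule chart)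
  obtain r where r: "r > 0" "cball x r \<subseteq> U" using open_U x(2) open_contains_cball by blast
  have "M \<inter> cball x r = cball x r \<inter> \<phi> -` S"
    using r \<phi>_in_S \<psi>_in_M \<phi>_in \<psi>_\<phi> by (auto simp: subset_iff) (metis mem_cball)
  moreover have "continuous_on (cball x r) \<phi>"
    using homeo r by (auto simp: homeomorphism_def intro: continuous_on_subset)
  ultimately have cl: "closed (M \<inter> cball x r)"
    using continuous_on_closed_vimage[of "cball x r" \<phi>] closed_subspace[OF subspace_S]
    by (auto simp: Int_commute)
  have near: "\<forall>y\<in>ball x (r / 2). closest_point M y \<in> M \<and>
    norm (y - closest_point M y) = infdist y M \<and> infdist y M \<le> norm (y - x)"
  proof
    fix y assume y: "y \<in> ball x (r / 2)"
    have xN: "x \<in> M \<inter> cball x r" using x r by simp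
    then obtain p where p: "p \<in> M \<inter> cball x r" "\<And>z. z \<in> M \<inter> cball x r \<Longrightarrow> dist y p \<le> dist y z"
      using distance_attains_inf[OF cl] by blast
    have "dist y p \<le> dist y z" if "z \<in> M" for z
    proof (cases "z \<in> cball x r")
      case False
      then have "r < dist x z" by simp
      also have "dist x z \<le> dist x y + dist y z" by (rule dist_triangle)
      finally have "dist y x < dist y z" using y by (simp add: dist_commute)
      then show ?thesis using p(2)[OF xN] by simp
    qed (use p(2) that in auto)
    with p(1) have ex: "\<exists>p. p \<in> M \<and> (\<forall>z\<in>M. dist y p \<le> dist y z)" by blast
    have cp: "closest_point M y \<in> M" "\<And>z. z \<in> M \<Longrightarrow> dist y (closest_point M y) \<le> dist y z"
      using someI_ex[OF ex] unfolding closest_point_def by auto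
    have ne: "M \<noteq> {}" using x by blast
    have "infdist y M = dist y (closest_point M y)"
      using infdist_le[OF cp(1), of y] cINF_greatest[of M "dist y (closest_point M y)" "dist y"] cp(2) ne
      by (simp add: infdist_notempty)
    moreover have "infdist y M \<le> norm (y - x)"
      using infdist_le[OF x(1), of y] by (simp add: dist_norm)
    ultimately show "closest_point M y \<in> M \<and>
        norm (y - closest_point M y) = infdist y M \<and> infdist y M \<le> norm (y - x)"
      using cp(1) by (simp add: dist_norm)
  qed
  have "r / 2 > 0" using r(1) by simp
  with near show ?thesis by (intro exI[of _ "r / 2"], intro conjI)
qed

section \<open>Convergence rate\<close>

text \<open>In terms of \<open>l = 1 - ln (F/F 0)\<close> and \<open>m = - ln d\<close>, a step of the first kind increases \<open>l\<close> by a
  constant and one of the second kind increases \<open>m\<close>, where \<open>m\<close> lies between \<open>l / 2\<close> and \<open>l\<close> up to constants.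
  Hence \<open>A l\<^sup>2 + m - l / 2\<close> grows by a constant in every step if \<open>A\<close> is large.\<close>

lemma nearly_linear_rate:
  fixes F d :: "nat \<Rightarrow> real"
  assumes c: "c > 0" "L > 0" and q: "0 < q" "q < 1"
    and lower: "\<And>r. c * (d r)\<^sup>2 \<le> F r" and upper: "\<And>r. F r \<le> L * d r" and d0: "\<And>r. 0 \<le> d r"
    and dec: "\<And>r. F (Suc r) \<le> F r"
    and step: "\<And>r. F (Suc r) \<le> q * F r \<or> d (Suc r) \<le> q * d r"
  shows "\<exists>a>0. \<exists>b>0. \<forall>r. d r \<le> a * exp (- b * sqrt (real r))"
proof (cases "d 0 = 0")
  case True
  have F: "F r \<le> F 0" for r
    using dec by (induction r) (auto intro: order_trans)
  have "d r = 0" for r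
  proof -
    have "c * (d r)\<^sup>2 \<le> 0" using lower[of r] F[of r] upper[of 0] True by simp
    then show ?thesis using c by (simp add: mult_le_0_iff)
  qed
  then show ?thesis by (intro exI[of _ "1::real"] conjI) auto
next
  case False
  then have d00: "d 0 > 0" using d0[of 0] by simp
  have Fpos: "F r > 0" if "d r > 0" for r
  proof -
    have "c * (d r)\<^sup>2 > 0" using that c by simp
    then show ?thesis using lower[of r] by linarith
  qed
  \<comment> \<open>Once \<open>d\<close> vanishes the gap \<open>F\<close> is at most 0 from then
    on, which forces \<open>d\<close> to stay 0. So positivity passes to earlier indices and the
    logarithms below are meaningful.\<close>
  have pos_mono: "d i > 0" if "d r > 0" "i \<le> r" for i r
  proof (rule ccontr)
    assume "\<not> ?thesis"
    then have "d i = 0" using d0[of i] by simp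
    then have "F i \<le> 0" using upper[of i] by simp
    moreover have "F r \<le> F i" using \<open>i \<le> r\<close> dec by (rule lift_Suc_antimono_le[rotated])
    ultimately show False using Fpos[OF that(1)] by simp
  qed
  \<comment> \<open>The summand 1 ensures \<open>l r \<ge> 1\<close>, so that constants can be
    absorbed into multiples of \<open>l\<close>. \<open>K\<close> below collects the additive
    constants in the comparison of \<open>l\<close> and \<open>m\<close>.\<close>
  define l where "l r = 1 + ln (F 0) - ln (F r)" for r
  define m where "m r = - ln (d r)" for r
  define \<kappa> where "\<kappa> = - ln q"
  have \<kappa>: "\<kappa> > 0" using q by (simp add: \<kappa>_def)
  define K where "K = \<bar>1 + ln (F 0) - ln c\<bar> + \<bar>ln L - 1 - ln (F 0)\<bar>"
  have K0: "K \<ge> 0" by (simp add: K_def)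
  have l1: "l r \<ge> 1" if "d r > 0" for r
  proof -
    have "F r \<le> F 0" using dec by (induction r) (auto intro: order_trans)
    then show ?thesis using Fpos[OF that] Fpos[OF d00] by (simp add: l_def)
  qed
  have lm: "l r \<le> 2 * m r + K" if "d r > 0" for r
  proof -
    have "ln (c * (d r)\<^sup>2) \<le> ln (F r)"
      using lower[of r] c that Fpos[OF that] by (subst ln_le_cancel_iff) auto
    then have "ln c + 2 * ln (d r) \<le> ln (F r)"
      using c that by (simp add: ln_mult ln_realpow)
    then show ?thesis by (simp add: l_def m_def K_def)
  qed
  have ml: "m r \<le> l r + K" if "d r > 0" for r
  proof -
    have "ln (F r) \<le> ln (L * d r)"
      using upper[of r] c that Fpos[OF that] by (subst ln_le_cancel_iff) auto
    then have "ln (F r) \<le> ln L + ln (d r)"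
      using c that by (simp add: ln_mult)
    then show ?thesis by (simp add: l_def m_def K_def)
  qed
  \<comment> \<open>In a step of the first kind \<open>m - l / 2\<close> can drop by up to
    \<open>l / 2 + 3 / 2 * K\<close>; the second summand lets the growth of
    \<open>A * l\<^sup>2\<close> cover this and still leave \<open>\<kappa>\<close>. In a step of
    the second kind \<open>l\<close> may grow as well, and \<open>1 / 4\<close> suffices to offset
    the term \<open>- l / 2\<close>.\<close>
  define A where "A = 1 / 4 + (1 / 2 + 3 / 2 * K + \<kappa>) / (2 * \<kappa>)"
  have A4: "A \<ge> 1 / 4" using \<kappa> K0 by (simp add: A_def)
  have A\<kappa>: "2 * A * \<kappa> \<ge> 1 / 2 + 3 / 2 * K + \<kappa>" using \<kappa> by (simp add: A_def field_simps)
  define \<Psi> where "\<Psi> r = A * (l r)\<^sup>2 + m r - l r / 2" for r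
  have inc: "\<Psi> (Suc r) \<ge> \<Psi> r + \<kappa>" if pos: "d (Suc r) > 0" for r
  proof -
    have pos': "d r > 0" using pos_mono[OF pos, of r] by simp
    define \<Delta> where "\<Delta> = l (Suc r) - l r"
    have \<Delta>0: "\<Delta> \<ge> 0"
      using dec[of r] Fpos[OF pos] Fpos[OF pos'] by (simp add: \<Delta>_def l_def)
    have "(l (Suc r))\<^sup>2 - (l r)\<^sup>2 = 2 * l r * \<Delta> + \<Delta>\<^sup>2"
      by (simp add: \<Delta>_def power2_eq_square algebra_simps)
    then have "A * (l (Suc r))\<^sup>2 - A * (l r)\<^sup>2 = 2 * A * (l r * \<Delta>) + A * \<Delta>\<^sup>2"
      unfolding right_diff_distrib[symmetric] by (simp add: distrib_left)
    moreover have "A * \<Delta>\<^sup>2 \<ge> 0" using A4 by simp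
    ultimately have sq: "A * (l (Suc r))\<^sup>2 - A * (l r)\<^sup>2 \<ge> 2 * A * (l r * \<Delta>)" by linarith
    from step[of r] show ?thesis
    proof
      assume "F (Suc r) \<le> q * F r"
      then have "ln (F (Suc r)) \<le> ln (q * F r)"
        using Fpos[OF pos] Fpos[OF pos'] q by (subst ln_le_cancel_iff) auto
      then have "\<Delta> \<ge> \<kappa>"
        using Fpos[OF pos'] q by (simp add: \<Delta>_def l_def \<kappa>_def ln_mult)
      then have "l r * \<Delta> \<ge> l r * \<kappa>"
        using l1[OF pos'] by (intro mult_left_mono) auto
      then have "2 * A * (l r * \<Delta>) \<ge> 2 * A * (l r * \<kappa>)"
        by (rule mult_left_mono) (use A4 in auto)
      also have "2 * A * (l r * \<kappa>) = l r * (2 * A * \<kappa>)" by simp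
      also have "l r * (2 * A * \<kappa>) \<ge> l r * (1 / 2 + 3 / 2 * K + \<kappa>)"
        using A\<kappa> l1[OF pos'] by (intro mult_left_mono) auto
      finally have "2 * A * (l r * \<Delta>) \<ge> l r * (1 / 2) + l r * (3 / 2 * K + \<kappa>)"
        by (simp add: distrib_left)
      moreover have "l r * (3 / 2 * K + \<kappa>) \<ge> 1 * (3 / 2 * K + \<kappa>)"
        using l1[OF pos'] K0 \<kappa> by (intro mult_right_mono) auto
      ultimately show ?thesis
        using sq lm[OF pos] ml[OF pos'] by (simp add: \<Psi>_def)
    next
      assume "d (Suc r) \<le> q * d r"
      then have "ln (d (Suc r)) \<le> ln (q * d r)"
        using pos pos' q by (subst ln_le_cancel_iff) auto
      then have "m (Suc r) \<ge> m r + \<kappa>"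
        using pos' q by (simp add: m_def \<kappa>_def ln_mult)
      moreover have "l r * \<Delta> \<ge> 1 * \<Delta>" using l1[OF pos'] \<Delta>0 by (intro mult_right_mono) auto
      then have "2 * A * (l r * \<Delta>) \<ge> 2 * (1 / 4) * \<Delta>"
        using A4 \<Delta>0 by (intro mult_mono[of "2 * (1 / 4)" "2 * A" \<Delta> "l r * \<Delta>"]) auto
      ultimately show ?thesis using sq by (simp add: \<Psi>_def \<Delta>_def)
    qed
  qed
  have grow: "\<Psi> r \<ge> \<Psi> 0 + \<kappa> * real r" if "d r > 0" for r
    using that
  proof (induction r)
    case (Suc r)
    have "d r > 0" using pos_mono[OF Suc.prems, of r] by simp
    with Suc.IH inc[OF Suc.prems] show ?case by (simp add: algebra_simps)
  qed simp
  \<comment> \<open>Since \<open>l \<ge> 1\<close>, the lower-order terms of \<open>\<Psi>\<close>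
    are absorbed into a multiple of \<open>l\<^sup>2\<close>. Linear growth of \<open>\<Psi>\<close>
    thus makes \<open>l\<close> at least a multiple of \<open>sqrt r\<close>, and \<open>lm\<close>
    turns this into a bound on \<open>d\<close>.\<close>
  define B where "B = A + 1 / 2 + 3 / 2 * K"
  have B: "B > 0" using A4 K0 by (simp add: B_def)
  define \<beta> where "\<beta> = sqrt (\<kappa> / B)"
  have \<beta>: "\<beta> > 0" using \<kappa> B by (simp add: \<beta>_def)
  have "d r \<le> exp (K / 2) * exp (- (\<beta> / 2) * sqrt (real r))" for r
  proof (cases "d r > 0")
    case True
    have "\<Psi> 0 \<ge> - K / 2"
    proof -
      have "A * (l 0)\<^sup>2 \<ge> 0" using A4 by simp
      then show ?thesis using lm[OF d00] unfolding \<Psi>_def by linarith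
    qed
    then have "\<kappa> * real r \<le> \<Psi> r + K / 2" using grow[OF True] by linarith
    also have "\<dots> \<le> A * (l r)\<^sup>2 + l r / 2 + 3 / 2 * K"
      using ml[OF True] by (simp add: \<Psi>_def)
    also have "\<dots> \<le> A * (l r)\<^sup>2 + (l r)\<^sup>2 / 2 + 3 / 2 * K * (l r)\<^sup>2"
    proof -
      have "l r * l r \<ge> l r * 1" using l1[OF True] by (intro mult_left_mono) auto
      then have sq: "(l r)\<^sup>2 \<ge> l r" by (simp add: power2_eq_square)
      then have sq1: "(l r)\<^sup>2 \<ge> 1" using l1[OF True] by linarith
      have "3 / 2 * K * (l r)\<^sup>2 \<ge> 3 / 2 * K * 1" using sq1 K0 by (intro mult_left_mono) auto
      with sq show ?thesis by simp
    qed
    also have "\<dots> = B * (l r)\<^sup>2" by (simp add: B_def algebra_simps)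
    finally have "\<kappa> / B * real r \<le> (l r)\<^sup>2" using B by (simp add: field_simps)
    then have "sqrt (\<kappa> / B * real r) \<le> l r"
      using l1[OF True] by (intro real_le_lsqrt) auto
    then have "\<beta> * sqrt (real r) \<le> l r" by (simp only: \<beta>_def real_sqrt_mult)
    then have "ln (d r) \<le> K / 2 + - (\<beta> / 2) * sqrt (real r)"
      using lm[OF True] by (simp add: m_def)
    then have "exp (ln (d r)) \<le> exp (K / 2 + - (\<beta> / 2) * sqrt (real r))" by (simp only: exp_le_cancel_iff)
    then show ?thesis using True by (simp only: exp_ln exp_add)
  next
    case False
    then show ?thesis using d0[of r] by (smt (verit) exp_gt_zero mult_pos_pos)
  qed
  then show ?thesis using \<beta> by (intro exI[of _ "exp (K / 2)"] conjI exI[of _ "\<beta> / 2"]) auto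
qed

section \<open>Goldstein subgradients near the minimizer\<close>

text \<open>The local hypotheses with explicit constants on one common ball. Only
  \<open>tangent\<close> keeps a radius of its own, as it is used with several tolerances.\<close>

locale robust_growth =
  fixes f :: "'a::euclidean_space \<Rightarrow> real" and M :: "'a set" and xbar :: 'a
    and L K \<mu> c C \<delta> R :: real
  assumes lip: "L-lipschitz_on UNIV f"
    and pos: "L > 0" "K > 0" "\<mu> > 0" "c > 0" "C > 0" "\<delta> > 0" "R > 0"
    and growth: "\<And>x. x \<in> ball xbar R \<Longrightarrow> \<delta> / 2 * (norm (x - xbar))\<^sup>2 \<le> f x - f xbar"
    and zero: "0 \<in> clarke_subdifferential f xbar"
    and xbar_M: "xbar \<in> M"
    and proj: "\<And>x. x \<in> ball xbar R \<Longrightarrow> closest_point M x \<in> M \<and>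
      norm (x - closest_point M x) = infdist x M \<and> infdist x M \<le> norm (x - xbar)"
    and semi: "\<And>x y v. x \<in> M \<Longrightarrow> x \<in> ball xbar R \<Longrightarrow> y \<in> ball xbar R \<Longrightarrow> v \<in> clarke_subdifferential f y \<Longrightarrow>
      \<exists>u\<in>clarke_subdifferential f x. norm (v - u) \<le> K * norm (x - y)"
    and normal: "\<And>x v. x \<in> ball xbar R \<Longrightarrow> v \<in> clarke_subdifferential f x \<Longrightarrow>
      \<mu> * infdist x M \<le> v \<bullet> (x - closest_point M x)"
    and gradient_le: "\<And>q. q \<in> M \<Longrightarrow> q \<in> ball xbar R \<Longrightarrow>
      norm (riemannian_gradient M f q) \<le> C * norm (q - xbar)"
    and gradient_ge: "\<And>q. q \<in> M \<Longrightarrow> q \<in> ball xbar R \<Longrightarrow>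
      c * (norm (q - xbar))\<^sup>2 \<le> riemannian_gradient M f q \<bullet> (q - xbar)"
    and clarke_tangential: "\<And>q u w. q \<in> M \<Longrightarrow> q \<in> ball xbar R \<Longrightarrow> u \<in> clarke_subdifferential f q \<Longrightarrow>
      w \<in> tangent_space M q \<Longrightarrow> u \<bullet> w = riemannian_gradient M f q \<bullet> w"
    and tangent: "\<And>\<eta>. \<eta> > 0 \<Longrightarrow> \<exists>\<rho>>0. \<forall>p\<in>M \<inter> ball xbar \<rho>. \<forall>q\<in>M \<inter> ball xbar \<rho>.
      \<exists>w\<in>tangent_space M q. norm (p - q - w) \<le> \<eta> * norm (p - q)"
begin

lemma norm_clarke_le: "v \<in> clarke_subdifferential f x \<Longrightarrow> norm v \<le> L"
  using clarke_subset_cball[OF lip, of x] by auto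

text \<open>Away from \<open>M\<close>, all subgradients near \<open>x\<close> have a uniformly positive component in the
  direction \<open>x - P x\<close>, where \<open>P\<close> is the projection onto \<open>M\<close>.\<close>

lemma infdist_le_if_small_subgradient:
  "\<exists>\<rho>>0. \<exists>C1\<ge>1. \<forall>x\<in>ball xbar \<rho>. \<forall>\<epsilon>\<ge>0. \<epsilon> \<le> norm (x - xbar) \<longrightarrow>
    norm (goldstein_subgradient f \<epsilon> x) < \<mu> / 2 \<longrightarrow> infdist x M \<le> C1 * \<epsilon>"
proof -
  define \<eta> where "\<eta> = min 1 (\<mu> / (32 * L))"
  have \<eta>: "\<eta> > 0" "\<eta> \<le> 1" "L * \<eta> \<le> \<mu> / 32"
  proof -
    show "\<eta> > 0" "\<eta> \<le> 1" using pos by (auto simp: \<eta>_def)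
    have "L * \<eta> \<le> L * (\<mu> / (32 * L))" using pos by (intro mult_left_mono) (auto simp: \<eta>_def)
    then show "L * \<eta> \<le> \<mu> / 32" using pos by simp
  qed
  obtain \<rho>1 where \<rho>1: "\<rho>1 > 0" and tan: "\<forall>p\<in>M \<inter> ball xbar \<rho>1. \<forall>q\<in>M \<inter> ball xbar \<rho>1.
      \<exists>w\<in>tangent_space M q. norm (p - q - w) \<le> \<eta> * norm (p - q)"
    using tangent[OF \<eta>(1)] by blast
  \<comment> \<open>Error rates per unit of \<open>\<rho>\<close>: \<open>2 * K\<close> comes from
    replacing a subgradient at \<open>y\<close> by one at the projection \<open>q\<close>, at
    distance below \<open>2 * \<rho>\<close>; \<open>8 * C\<close> from the Riemannian gradient, of
    norm at most \<open>4 * C * \<rho>\<close>, paired with a tangent vector of length at most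
    \<open>2 * norm (p - q)\<close>.\<close>
  define a where "a = 2 * K + 8 * C"
  have a: "a > 0" using pos by (simp add: a_def)
  define \<rho> where "\<rho> = min (min (R / 4) (\<rho>1 / 4)) (\<mu> / (32 * a))"
  have \<rho>: "\<rho> > 0" "4 * \<rho> \<le> R" "4 * \<rho> \<le> \<rho>1" using pos \<rho>1 a by (auto simp: \<rho>_def)
  have "a * \<rho> \<le> a * (\<mu> / (32 * a))" using a by (intro mult_left_mono) (auto simp: \<rho>_def)
  then have a\<rho>: "a * \<rho> \<le> \<mu> / 32" using a by simp
  \<comment> \<open>If \<open>d\<close> exceeds \<open>C1 * \<epsilon>\<close>, the losses
    \<open>\<mu> * \<epsilon>\<close> and \<open>L * \<epsilon>\<close> from moving from
    \<open>x\<close> to \<open>y\<close> together stay below \<open>\<mu> * d / 4\<close>.\<close>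
  define C1 where "C1 = 4 * (\<mu> + L) / \<mu>"
  have C1: "C1 \<ge> 1" "\<mu> * C1 = 4 * (\<mu> + L)" using pos by (auto simp: C1_def field_simps)
  have "infdist x M \<le> C1 * \<epsilon>"
    if x: "x \<in> ball xbar \<rho>" and \<epsilon>: "0 \<le> \<epsilon>" "\<epsilon> \<le> norm (x - xbar)" and small: "norm (goldstein_subgradient f \<epsilon> x) < \<mu> / 2" for x \<epsilon>
  proof (rule ccontr)
    assume far: "\<not> infdist x M \<le> C1 * \<epsilon>"
    define d where "d = infdist x M"
    have d: "C1 * \<epsilon> < d" using far by (simp add: d_def)
    have "1 * \<epsilon> \<le> C1 * \<epsilon>" using C1 \<epsilon> by (intro mult_right_mono) auto
    with d have \<epsilon>d: "\<epsilon> < d" by simp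
    then have d0: "d > 0" using \<epsilon> by simp
    have xr: "norm (x - xbar) < \<rho>" using x by (simp add: dist_norm norm_minus_commute)
    have xR: "x \<in> ball xbar R" using x \<rho> by auto
    define p where "p = closest_point M x"
    have p: "p \<in> M" "norm (x - p) = d" "d \<le> norm (x - xbar)"
      using proj[OF xR] by (auto simp: p_def d_def)
    have pb: "norm (p - xbar) \<le> 2 * norm (x - xbar)"
      using norm_triangle_ineq4[of "x - xbar" "x - p"] p by simp
    \<comment> \<open>The normal growth condition at \<open>y\<close> concerns the direction
      \<open>y - q\<close> with \<open>y\<close>'s own projection \<open>q\<close>, whereas one
      fixed direction \<open>x - p\<close> is needed for the hull. The difference involves the chord
      \<open>p - q\<close>, which is nearly tangent at \<open>q\<close>, and the tangential part of
      subgradients is small near \<open>xbar\<close>. The total loss is half of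
      \<open>\<mu> * d\<close>.\<close>
    have main: "\<mu> / 2 * d \<le> v \<bullet> (x - p)" if y: "y \<in> cball x \<epsilon>" and v: "v \<in> clarke_subdifferential f y" for y v
    proof -
      have xy: "norm (x - y) \<le> \<epsilon>" using y by (simp add: dist_norm)
      have yb: "norm (y - xbar) \<le> 2 * norm (x - xbar)"
        using norm_triangle_ineq4[of "x - xbar" "x - y"] xy \<epsilon> by simp
      then have y\<rho>: "norm (y - xbar) < 2 * \<rho>" using xr by simp
      then have yR: "y \<in> ball xbar R" using \<rho> by (simp add: dist_norm norm_minus_commute)
      define q where "q = closest_point M y"
      define e where "e = infdist y M"
      have q: "q \<in> M" "norm (y - q) = e" "e \<le> norm (y - xbar)"
        using proj[OF yR] by (auto simp: q_def e_def)
      have e0: "e \<ge> 0" by (simp add: e_def infdist_nonneg)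
      have e1: "e \<le> d + \<epsilon>" "d \<le> e + \<epsilon>"
        using infdist_triangle[of y M x] infdist_triangle[of x M y] xy by (auto simp: d_def e_def dist_norm norm_minus_commute)
      have qb: "norm (q - xbar) \<le> 2 * norm (y - xbar)"
        using norm_triangle_ineq4[of "y - xbar" "y - q"] q by simp
      then have q\<rho>: "norm (q - xbar) < 4 * \<rho>" using y\<rho> by simp
      then have qR: "q \<in> ball xbar R" and q1: "q \<in> ball xbar \<rho>1" using \<rho> by (auto simp: dist_norm norm_minus_commute)
      have p1: "p \<in> ball xbar \<rho>1" using \<rho> pb xr by (simp add: dist_norm norm_minus_commute)
      obtain u where u: "u \<in> clarke_subdifferential f q" "norm (v - u) \<le> K * norm (q - y)"
        using semi[OF q(1) qR yR v] by blast
      have Kq: "K * norm (q - y) \<le> 2 * K * \<rho>"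
      proof -
        have "norm (q - y) \<le> 2 * \<rho>" using q y\<rho> by (simp add: norm_minus_commute)
        then have "K * norm (q - y) \<le> K * (2 * \<rho>)" using pos by (intro mult_left_mono) auto
        then show ?thesis by simp
      qed
      obtain w where w: "w \<in> tangent_space M q" "norm (p - q - w) \<le> \<eta> * norm (p - q)"
        using tan p(1) p1 q(1) q1 by blast
      have pq: "norm (p - q) \<le> 4 * d"
      proof -
        have "p - q = ((y - q) + (x - y)) - (x - p)" by simp
        then have "norm (p - q) \<le> norm ((y - q) + (x - y)) + norm (x - p)"
          by (simp only: norm_triangle_ineq4)
        moreover have "norm ((y - q) + (x - y)) \<le> norm (y - q) + norm (x - y)"
          by (rule norm_triangle_ineq)
        ultimately show ?thesis using q(2) xy p(2) e1 \<epsilon>d by linarith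
      qed
      have nw: "norm w \<le> 2 * norm (p - q)"
      proof -
        have "norm w \<le> norm (p - q) + norm (p - q - w)"
          using norm_triangle_ineq4[of "p - q" "p - q - w"] by simp
        also have "\<eta> * norm (p - q) \<le> 1 * norm (p - q)" using \<eta> by (intro mult_right_mono) auto
        then have "norm (p - q - w) \<le> norm (p - q)" using w(2) by simp
        finally show ?thesis by simp
      qed
      define G where "G = riemannian_gradient M f q"
      have "norm G \<le> C * norm (q - xbar)" unfolding G_def by (rule gradient_le[OF q(1) qR])
      also have "\<dots> \<le> C * (4 * \<rho>)" using q\<rho> pos by (intro mult_left_mono) auto
      finally have nG: "norm G \<le> 4 * C * \<rho>" by simp
      have "u \<bullet> w \<le> norm G * norm w"
        using clarke_tangential[OF q(1) qR u(1) w(1)] norm_cauchy_schwarz[of G w] by (simp add: G_def)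
      also have "\<dots> \<le> (4 * C * \<rho>) * (2 * norm (p - q))"
        using nG nw pos \<rho> by (intro mult_mono) auto
      finally have 1: "u \<bullet> w \<le> 8 * C * \<rho> * norm (p - q)" by simp
      have "u \<bullet> (p - q - w) \<le> norm u * norm (p - q - w)" by (rule norm_cauchy_schwarz)
      also have "\<dots> \<le> L * (\<eta> * norm (p - q))"
        using norm_clarke_le[OF u(1)] w(2) pos by (intro mult_mono) auto
      finally have 2: "u \<bullet> (p - q - w) \<le> L * \<eta> * norm (p - q)" by simp
      have "(v - u) \<bullet> (p - q) \<le> norm (v - u) * norm (p - q)" by (rule norm_cauchy_schwarz)
      also have "\<dots> \<le> 2 * K * \<rho> * norm (p - q)"
        using u(2) Kq by (intro mult_right_mono) auto
      finally have 3: "(v - u) \<bullet> (p - q) \<le> 2 * K * \<rho> * norm (p - q)" .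
      have "v \<bullet> (p - q) = u \<bullet> w + u \<bullet> (p - q - w) + (v - u) \<bullet> (p - q)"
        by (simp add: inner_diff_left inner_diff_right)
      also have "\<dots> \<le> 8 * C * \<rho> * norm (p - q) + L * \<eta> * norm (p - q) + 2 * K * \<rho> * norm (p - q)"
        using 1 2 3 by linarith
      also have "\<dots> = (a * \<rho> + L * \<eta>) * norm (p - q)" by (simp add: a_def algebra_simps)
      also have "\<dots> \<le> (\<mu> / 16) * norm (p - q)"
        using a\<rho> \<eta>(3) by (intro mult_right_mono) auto
      also have "\<dots> \<le> (\<mu> / 16) * (4 * d)" using pq pos by (intro mult_left_mono) auto
      finally have vpq: "v \<bullet> (p - q) \<le> \<mu> / 4 * d" by simp
      have "v \<bullet> (y - x) \<le> norm v * norm (y - x)" by (rule norm_cauchy_schwarz)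
      also have "\<dots> \<le> L * \<epsilon>"
        using norm_clarke_le[OF v] xy \<epsilon> pos by (intro mult_mono) (auto simp: norm_minus_commute)
      finally have vxy: "v \<bullet> (y - x) \<le> L * \<epsilon>" .
      have vyq: "\<mu> * e \<le> v \<bullet> (y - q)" using normal[OF yR v] by (simp add: e_def q_def)
      have "\<mu> * d \<le> \<mu> * (e + \<epsilon>)" using e1 pos by (intro mult_left_mono) auto
      then have \<mu>e: "\<mu> * d - \<mu> * \<epsilon> \<le> \<mu> * e" by (simp add: distrib_left)
      have "\<mu> * (C1 * \<epsilon>) \<le> \<mu> * d" using d pos by (intro mult_left_mono) auto
      then have "4 * (\<mu> + L) * \<epsilon> \<le> \<mu> * d" using C1(2) by (simp add: mult.assoc[symmetric])
      then have "\<mu> * \<epsilon> + L * \<epsilon> \<le> \<mu> * d / 4" by (simp add: algebra_simps)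
      moreover have "v \<bullet> (x - p) = v \<bullet> (y - q) - v \<bullet> (y - x) - v \<bullet> (p - q)"
        by (simp add: inner_diff_right)
      ultimately show ?thesis using vyq vxy vpq \<mu>e by simp
    qed
    have "\<mu> / 2 * d \<le> goldstein_subgradient f \<epsilon> x \<bullet> (x - p)"
      using main goldstein_subgradient_in[OF lip \<epsilon>(1)] by (rule goldstein_inner_ge)
    also have "\<dots> \<le> norm (goldstein_subgradient f \<epsilon> x) * d"
      using norm_cauchy_schwarz[of "goldstein_subgradient f \<epsilon> x" "x - p"] p(2) by simp
    also have "\<dots> < \<mu> / 2 * d" using small d0 by (intro mult_strict_right_mono)
    finally show False by simp
  qed
  then show ?thesis using \<rho>(1) C1(1) by blast
qed

text \<open>This stops the inner loop before its radius becomes too small. If the subgradient is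
  shorter than \<open>\<mu> / 2\<close>, then \<open>x\<close> is within
  \<open>C1 * \<epsilon>\<close> of \<open>M\<close>, so all subgradients in the ball are within
  \<open>K1 * \<epsilon>\<close> of subgradients at the projection \<open>p\<close>. Along an almost
  radial tangent vector these act like the Riemannian gradient, whose radial part is at least a
  multiple of the distance to \<open>xbar\<close>.\<close>

lemma goldstein_subgradient_large:
  "\<exists>\<rho>>0. \<exists>c0>0. \<forall>x\<in>ball xbar \<rho>. \<forall>\<epsilon>\<ge>0. \<epsilon> < c0 * norm (x - xbar) \<longrightarrow>
    \<epsilon> < norm (goldstein_subgradient f \<epsilon> x)"
proof -
  obtain \<rho>1 C1 where \<rho>1: "\<rho>1 > 0" and C1: "C1 \<ge> 1" and dist: "\<And>x \<epsilon>. x \<in> ball xbar \<rho>1 \<Longrightarrow> \<epsilon> \<ge> 0 \<Longrightarrow>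
      \<epsilon> \<le> norm (x - xbar) \<Longrightarrow> norm (goldstein_subgradient f \<epsilon> x) < \<mu> / 2 \<Longrightarrow> infdist x M \<le> C1 * \<epsilon>"
    using infdist_le_if_small_subgradient by metis
  define \<eta> where "\<eta> = min 1 (c / (2 * C))"
  have \<eta>: "\<eta> > 0" "\<eta> \<le> 1" "C * \<eta> \<le> c / 2"
  proof -
    show "\<eta> > 0" "\<eta> \<le> 1" using pos by (auto simp: \<eta>_def)
    have "C * \<eta> \<le> C * (c / (2 * C))" using pos by (intro mult_left_mono) (auto simp: \<eta>_def)
    then show "C * \<eta> \<le> c / 2" using pos by simp
  qed
  obtain \<rho>2 where \<rho>2: "\<rho>2 > 0" and tan: "\<forall>p\<in>M \<inter> ball xbar \<rho>2. \<forall>q\<in>M \<inter> ball xbar \<rho>2.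
      \<exists>w\<in>tangent_space M q. norm (p - q - w) \<le> \<eta> * norm (p - q)"
    using tangent[OF \<eta>(1)] by blast
  define K1 where "K1 = K * (1 + C1)"
  have K1: "K1 > 0" using pos C1 by (simp add: K1_def)
  define A where "A = 1 + K1"
  have A: "A > 0" using K1 by (simp add: A_def)
  \<comment> \<open>The first bound gives \<open>d \<le> r / 2\<close>, hence
    \<open>D \<ge> r / 2\<close>. The second makes \<open>A * \<epsilon>\<close> smaller than
    \<open>c / 4 * D\<close>, where \<open>A = 1 + K1\<close> accounts for the target
    \<open>\<epsilon>\<close> and the error \<open>K1 * \<epsilon>\<close>.\<close>
  define c0 where "c0 = min (1 / (2 * C1)) (c / (8 * A))"
  have c0: "c0 > 0" "C1 * c0 \<le> 1 / 2" "A * c0 \<le> c / 8" "c0 \<le> 1"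
  proof -
    show "c0 > 0" using C1 A pos by (simp add: c0_def)
    have "C1 * c0 \<le> C1 * (1 / (2 * C1))" using C1 by (intro mult_left_mono) (auto simp: c0_def)
    then show *: "C1 * c0 \<le> 1 / 2" using C1 by simp
    have "A * c0 \<le> A * (c / (8 * A))" using A by (intro mult_left_mono) (auto simp: c0_def)
    also have "\<dots> = c / 8" using A by simp
    finally show "A * c0 \<le> c / 8" .
    have "1 * c0 \<le> C1 * c0" using C1 \<open>c0 > 0\<close> by (intro mult_right_mono) auto
    with * show "c0 \<le> 1" by simp
  qed
  define \<rho> where "\<rho> = min (min \<rho>1 (\<rho>2 / 2)) (min (R / 2) (\<mu> / 2))"
  have \<rho>: "\<rho> > 0" "\<rho> \<le> \<rho>1" "2 * \<rho> \<le> \<rho>2" "2 * \<rho> \<le> R" "\<rho> \<le> \<mu> / 2" using pos \<rho>1 \<rho>2 by (auto simp: \<rho>_def)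
  have "\<epsilon> < norm (goldstein_subgradient f \<epsilon> x)"
    if x: "x \<in> ball xbar \<rho>" and \<epsilon>: "0 \<le> \<epsilon>" "\<epsilon> < c0 * norm (x - xbar)" for x \<epsilon>
  proof -
    define g where "g = goldstein_subgradient f \<epsilon> x"
    define r where "r = norm (x - xbar)"
    have r: "r \<ge> 0" "r < \<rho>" using x by (auto simp: r_def dist_norm norm_minus_commute)
    have "c0 * r \<le> 1 * r" using c0 r by (intro mult_right_mono) auto
    then have \<epsilon>r: "\<epsilon> < r" using \<epsilon> by (simp add: r_def)
    show ?thesis
    proof (cases "norm g < \<mu> / 2")
      case False
      then show ?thesis using \<epsilon>r r \<rho> by (simp add: g_def)
    next
      case True
      define d where "d = infdist x M"
      have d1: "d \<le> C1 * \<epsilon>"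
        unfolding d_def using True \<epsilon> \<epsilon>r x \<rho> by (intro dist) (auto simp: g_def r_def)
      also have "\<dots> \<le> C1 * (c0 * r)" using \<epsilon> C1 by (intro mult_left_mono) (auto simp: r_def)
      also have "\<dots> \<le> 1 / 2 * r" using c0(2) r unfolding mult.assoc[symmetric] by (intro mult_right_mono) auto
      finally have d2: "d \<le> r / 2" by simp
      have xR: "x \<in> ball xbar R" using x \<rho> by auto
      define p where "p = closest_point M x"
      have p: "p \<in> M" "norm (x - p) = d" using proj[OF xR] by (auto simp: p_def d_def)
      define D where "D = norm (p - xbar)"
      have D: "D \<ge> r / 2" "D \<le> 2 * r"
        using norm_triangle_ineq4[of "x - xbar" "x - p"] norm_triangle_ineq2[of "x - xbar" "x - p"] p d2
        by (auto simp: D_def r_def)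
      have D0: "D > 0" using D \<epsilon>r \<epsilon> by linarith
      have pR: "p \<in> ball xbar R" and p2: "p \<in> ball xbar \<rho>2"
        using D r \<rho> by (auto simp: D_def dist_norm norm_minus_commute)
      \<comment> \<open>Clarke subgradients are controlled on tangent vectors only, so the radial
        direction \<open>xbar - p\<close> is replaced by a nearby tangent vector.\<close>
      obtain w where w: "w \<in> tangent_space M p" "norm (xbar - p - w) \<le> \<eta> * norm (xbar - p)"
        using tan p(1) p2 xbar_M \<rho>2 by (meson IntI centre_in_ball)
      have w2: "norm (xbar - p - w) \<le> \<eta> * D" using w(2) by (simp add: D_def norm_minus_commute)
      have nw: "norm w \<le> 2 * D"
      proof -
        have "norm w \<le> norm (xbar - p) + norm (xbar - p - w)"
          using norm_triangle_ineq4[of "xbar - p" "xbar - p - w"] by simp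
        also have "\<eta> * D \<le> 1 * D" using \<eta> D0 by (intro mult_right_mono) auto
        then have "norm (xbar - p - w) \<le> D" using w2 by simp
        finally show ?thesis by (simp add: D_def norm_minus_commute)
      qed
      define G where "G = riemannian_gradient M f p"
      have G1: "norm G \<le> C * D" and G2: "c * D\<^sup>2 \<le> G \<bullet> (p - xbar)"
        using gradient_le[OF p(1) pR] gradient_ge[OF p(1) pR] by (auto simp: G_def D_def)
      have "- (G \<bullet> (xbar - p - w)) \<le> norm G * norm (xbar - p - w)"
        using norm_cauchy_schwarz[of "- G" "xbar - p - w"] by simp
      also have "\<dots> \<le> (C * D) * (\<eta> * D)" using G1 w2 pos D0 by (intro mult_mono) auto
      also have "\<dots> = (C * \<eta>) * D\<^sup>2" by (simp add: power2_eq_square)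
      also have "\<dots> \<le> c / 2 * D\<^sup>2" using \<eta>(3) by (intro mult_right_mono) auto
      finally have "- (G \<bullet> (xbar - p - w)) \<le> c / 2 * D\<^sup>2" .
      moreover have "G \<bullet> (- w) = G \<bullet> (p - xbar) + G \<bullet> (xbar - p - w)"
        by (simp add: inner_diff_right)
      ultimately have Gw: "c / 2 * D\<^sup>2 \<le> G \<bullet> (- w)" using G2 by simp
      have main: "c / 2 * D\<^sup>2 - 2 * K1 * \<epsilon> * D \<le> v \<bullet> (- w)"
        if y: "y \<in> cball x \<epsilon>" and v: "v \<in> clarke_subdifferential f y" for y v
      proof -
        have xy: "norm (x - y) \<le> \<epsilon>" using y by (simp add: dist_norm)
        have "norm (y - xbar) \<le> 2 * r"
          using norm_triangle_ineq4[of "x - xbar" "x - y"] xy \<epsilon>r by (simp add: r_def)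
        then have yR: "y \<in> ball xbar R" using \<rho> r by (simp add: dist_norm norm_minus_commute)
        obtain u where u: "u \<in> clarke_subdifferential f p" "norm (v - u) \<le> K * norm (p - y)"
          using semi[OF p(1) pR yR v] by blast
        have "norm (p - y) \<le> (1 + C1) * \<epsilon>"
          using norm_triangle_ineq4[of "x - y" "x - p"] xy p d1 by (simp add: algebra_simps)
        then have "K * norm (p - y) \<le> K * ((1 + C1) * \<epsilon>)" using pos by (intro mult_left_mono) auto
        with u(2) have vu: "norm (v - u) \<le> K1 * \<epsilon>" by (simp add: K1_def)
        have "(v - u) \<bullet> w \<le> norm (v - u) * norm w" by (rule norm_cauchy_schwarz)
        also have "\<dots> \<le> (K1 * \<epsilon>) * (2 * D)" using vu nw K1 \<epsilon> by (intro mult_mono) auto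
        finally have "(v - u) \<bullet> w \<le> 2 * K1 * \<epsilon> * D" by simp
        moreover have "u \<bullet> w = G \<bullet> w" unfolding G_def by (rule clarke_tangential[OF p(1) pR u(1) w(1)])
        ultimately show ?thesis using Gw by (simp add: inner_diff_left)
      qed
      have "c / 2 * D\<^sup>2 - 2 * K1 * \<epsilon> * D \<le> g \<bullet> (- w)"
        unfolding g_def using main goldstein_subgradient_in[OF lip \<epsilon>(1)] by (rule goldstein_inner_ge)
      also have "\<dots> \<le> norm g * norm (- w)" by (rule norm_cauchy_schwarz)
      also have "\<dots> \<le> norm g * (2 * D)" using nw by (intro mult_left_mono) auto
      finally have "(c / 4 * D - K1 * \<epsilon>) * (2 * D) \<le> norm g * (2 * D)"
        by (simp add: power2_eq_square algebra_simps)
      then have gD: "c / 4 * D - K1 * \<epsilon> \<le> norm g" using D0 by (subst (asm) mult_le_cancel_right) auto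
      have "A * \<epsilon> < A * (c0 * r)" using \<epsilon> A by (intro mult_strict_left_mono) (auto simp: r_def)
      also have "\<dots> \<le> c / 8 * r" using c0(3) r unfolding mult.assoc[symmetric] by (intro mult_right_mono) auto
      also have "\<dots> = c / 4 * (r / 2)" by simp
      also have "\<dots> \<le> c / 4 * D" using D pos by (intro mult_left_mono) auto
      finally have "\<epsilon> + K1 * \<epsilon> < c / 4 * D" by (simp add: A_def distrib_right)
      with gD show ?thesis by (simp add: g_def)
    qed
  qed
  then show ?thesis using \<rho>(1) c0(1) by blast
qed

end

section \<open>From the angle condition to the contraction of a step\<close>

lemma norm_normalized_diff_le:
  fixes u v :: "'a::euclidean_space"
  assumes "u \<noteq> 0" "v \<noteq> 0" "0 < \<eta>" "\<eta> \<le> 1" "vector_angle u v < arccos (1 - \<eta>\<^sup>2 / 2)"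
  shows "norm (u /\<^sub>R norm u - v /\<^sub>R norm v) \<le> \<eta>"
proof -
  define z where "z = (u \<bullet> v) / (norm u * norm v)"
  have "\<bar>u \<bullet> v\<bar> \<le> norm u * norm v" by (rule Cauchy_Schwarz_ineq2)
  then have z: "- 1 \<le> z" "z \<le> 1"
    using assms(1,2) by (auto simp: z_def abs_le_iff pos_divide_le_eq pos_le_divide_eq)
  have "\<eta>\<^sup>2 \<le> 1" using assms by (simp add: power_le_one)
  have "z \<ge> 1 - \<eta>\<^sup>2 / 2"
  proof (rule ccontr)
    assume "\<not> ?thesis"
    then have "arccos (1 - \<eta>\<^sup>2 / 2) \<le> arccos z"
      using z assms by (intro arccos_le_arccos) auto
    then show False using assms(5) by (simp add: vector_angle_def z_def)
  qed
  \<comment> \<open>The threshold \<open>1 - \<eta>\<^sup>2 / 2\<close> is the cosine at which this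
    squared distance equals \<open>\<eta>\<^sup>2\<close>.\<close>
  moreover have "(norm (u /\<^sub>R norm u - v /\<^sub>R norm v))\<^sup>2 = 2 - 2 * z"
  proof -
    have "(norm (a - b))\<^sup>2 = (norm a)\<^sup>2 + (norm b)\<^sup>2 - 2 * (a \<bullet> b)" for a b :: 'a
      by (simp add: power2_norm_eq_inner inner_diff_left inner_diff_right inner_commute[of b a])
    then show ?thesis
      using assms(1,2) by (simp add: z_def divide_inverse mult_ac)
  qed
  ultimately have "(norm (u /\<^sub>R norm u - v /\<^sub>R norm v))\<^sup>2 \<le> \<eta>\<^sup>2" by simp
  then show ?thesis using assms(3) by (rule power2_le_imp_le[OF _ less_imp_le])
qed

definition aligned :: "('a::euclidean_space \<Rightarrow> real) \<Rightarrow> 'a set \<Rightarrow> real \<Rightarrow> 'a \<Rightarrow> real \<Rightarrow> bool" where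
  "aligned f M \<theta> x \<epsilon> \<longleftrightarrow>
     goldstein_subgradient f \<epsilon> x \<noteq> 0 \<and> riemannian_gradient M f (closest_point M x) \<noteq> 0 \<and>
     vector_angle (goldstein_subgradient f \<epsilon> x) (riemannian_gradient M f (closest_point M x)) < \<theta>"

text \<open>The first two conjuncts serve to keep the iterates near \<open>xbar\<close>; the
  disjunction is the alternative that the rate estimate consumes.\<close>

definition contracts :: "('a::euclidean_space \<Rightarrow> real) \<Rightarrow> 'a \<Rightarrow> real \<Rightarrow> 'a \<Rightarrow> 'a \<Rightarrow> bool" where
  "contracts f xbar q x y \<longleftrightarrow> norm (y - xbar) \<le> 2 * norm (x - xbar) \<and> f y \<le> f x \<and>
     (f y - f xbar \<le> q * (f x - f xbar) \<or> norm (y - xbar) \<le> q * norm (x - xbar))"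

lemma funpow_half: "((\<lambda>\<epsilon>. \<epsilon> / 2) ^^ k) e = e / 2 ^ k" for e :: real
  by (induction k) auto

context robust_growth
begin

lemma goldstein_subgradient_zero:
  assumes "norm (x - xbar) \<le> \<epsilon>"
  shows "goldstein_subgradient f \<epsilon> x = 0"
proof -
  have "xbar \<in> cball x \<epsilon>" using assms by (simp add: dist_norm)
  then have "0 \<in> goldstein_subdifferential f \<epsilon> x"
    using clarke_subset_goldstein zero by blast
  from norm_goldstein_subgradient_le[OF lip this] show ?thesis by simp
qed

lemma lipschitz_min_step_xbar: "lipschitz_min_step f L \<beta> xbar = xbar"
proof -
  have "norm (goldstein_subgradient f (L / 2 / 2 ^ k) xbar) \<le> L / 2 / 2 ^ k" for k
    using goldstein_subgradient_zero[of xbar "L / 2 / 2 ^ k"] pos by simp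
  then have "while_option (\<lambda>\<epsilon>. norm (goldstein_subgradient f \<epsilon> xbar) \<le> \<epsilon>) (\<lambda>\<epsilon>. \<epsilon> / 2) (L / 2) = None"
    by (simp add: while_option_def funpow_half)
  then show ?thesis by (simp add: lipschitz_min_step_def)
qed

text \<open>The loop cannot stop while the ball still contains \<open>xbar\<close>, since then the
  subgradient is 0; this bounds the final radius from above. Radii below \<open>c0\<close> times the
  distance always stop it, so the last rejected radius is at least that large, and halving costs a
  factor 2.\<close>

lemma lipschitz_min_step_eq:
  "\<exists>\<rho>>0. \<exists>c1>0. \<forall>x\<in>ball xbar \<rho>. x \<noteq> xbar \<longrightarrow> (\<exists>\<epsilon>. c1 * norm (x - xbar) \<le> \<epsilon> \<and> \<epsilon> \<le> norm (x - xbar) \<and>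
    \<epsilon> < norm (goldstein_subgradient f \<epsilon> x) \<and>
    (\<forall>\<beta>. lipschitz_min_step f L \<beta> x =
      x - (\<beta> * \<epsilon> / norm (goldstein_subgradient f (\<beta> * \<epsilon>) x)) *\<^sub>R goldstein_subgradient f (\<beta> * \<epsilon>) x))"
proof -
  obtain \<rho>1 c0 where \<rho>1: "\<rho>1 > 0" and c0: "c0 > 0" and large: "\<And>x \<epsilon>. x \<in> ball xbar \<rho>1 \<Longrightarrow> \<epsilon> \<ge> 0 \<Longrightarrow>
      \<epsilon> < c0 * norm (x - xbar) \<Longrightarrow> \<epsilon> < norm (goldstein_subgradient f \<epsilon> x)"
    using goldstein_subgradient_large by metis
  \<comment> \<open>The bound \<open>L / c0\<close> serves the case in which the loop stops at once:
    it makes the initial radius \<open>L / 2\<close> at least \<open>c0 / 2\<close> times the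
    distance.\<close>
  define \<rho> where "\<rho> = min \<rho>1 (L / c0)"
  have \<rho>: "\<rho> > 0" using \<rho>1 c0 pos by (simp add: \<rho>_def)
  have "\<exists>\<epsilon>. c0 / 2 * norm (x - xbar) \<le> \<epsilon> \<and> \<epsilon> \<le> norm (x - xbar) \<and>
    \<epsilon> < norm (goldstein_subgradient f \<epsilon> x) \<and>
    (\<forall>\<beta>. lipschitz_min_step f L \<beta> x =
      x - (\<beta> * \<epsilon> / norm (goldstein_subgradient f (\<beta> * \<epsilon>) x)) *\<^sub>R goldstein_subgradient f (\<beta> * \<epsilon>) x)"
    if x: "x \<in> ball xbar \<rho>" "x \<noteq> xbar" for x
  proof -
    define r where "r = norm (x - xbar)"
    have r: "r > 0" using x by (simp add: r_def)
    have x1: "x \<in> ball xbar \<rho>1" using x by (simp add: \<rho>_def)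
    have "r < L / c0" using x by (simp add: r_def \<rho>_def dist_norm norm_minus_commute)
    then have rL: "c0 * r < L" using c0 by (simp add: pos_less_divide_eq mult.commute)
    define b where "b \<epsilon> \<longleftrightarrow> norm (goldstein_subgradient f \<epsilon> x) \<le> \<epsilon>" for \<epsilon>
    have nb: "\<not> b \<epsilon>" if "0 \<le> \<epsilon>" "\<epsilon> < c0 * r" for \<epsilon>
      using large[OF x1 that[unfolded r_def]] by (simp add: b_def)
    define e where "e k = L / 2 / 2 ^ k" for k :: nat
    have epos: "e k \<ge> 0" for k using pos by (simp add: e_def)
    have ex: "\<exists>k. \<not> b (e k)"
    proof -
      have "e \<longlonglongrightarrow> 0" unfolding e_def by real_asymp
      then have "\<forall>\<^sub>F k in sequentially. e k < c0 * r"
        using c0 r by (intro order_tendstoD) auto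
      then obtain k where "e k < c0 * r" by (auto simp: eventually_sequentially)
      then show ?thesis using nb epos by blast
    qed
    define k where "k = (LEAST k. \<not> b (e k))"
    have k: "\<not> b (e k)" unfolding k_def using ex by (rule LeastI_ex)
    have wo: "while_option (\<lambda>\<epsilon>. norm (goldstein_subgradient f \<epsilon> x) \<le> \<epsilon>) (\<lambda>\<epsilon>. \<epsilon> / 2) (L / 2) = Some (e k)"
      using ex by (simp add: while_option_def funpow_half b_def e_def k_def)
    have lower: "c0 / 2 * r \<le> e k"
    proof (cases k)
      case 0
      then show ?thesis using rL by (simp add: e_def)
    next
      case (Suc j)
      then have "b (e j)" using not_less_Least[of j "\<lambda>k. \<not> b (e k)"] by (simp add: k_def)
      then have "c0 * r \<le> e j" using nb epos by (meson not_le)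
      then show ?thesis by (simp add: Suc e_def)
    qed
    have upper: "e k \<le> r"
    proof (rule ccontr)
      assume "\<not> e k \<le> r"
      then have "goldstein_subgradient f (e k) x = 0"
        by (intro goldstein_subgradient_zero) (simp add: r_def)
      then have "b (e k)" using epos by (simp add: b_def)
      with k show False by simp
    qed
    have "\<forall>\<beta>. lipschitz_min_step f L \<beta> x =
      x - (\<beta> * e k / norm (goldstein_subgradient f (\<beta> * e k) x)) *\<^sub>R goldstein_subgradient f (\<beta> * e k) x"
      unfolding lipschitz_min_step_def wo by (simp add: Let_def)
    with lower upper k show ?thesis
      unfolding r_def b_def not_le by blast
  qed
  moreover have "c0 / 2 > 0" using c0 by simp
  ultimately show ?thesis using \<rho> by blast
qed

text \<open>If the Goldstein subgradient is bounded away from zero, the descent inequality contracts the function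
  values. Otherwise the step points, up to a small angle, along the negative Riemannian gradient of \<open>f\<close> on \<open>M\<close>,
  which makes an acute angle with \<open>xbar - x\<close>, so the distance to \<open>xbar\<close> contracts.\<close>

lemma step_contracts:
  "\<exists>\<theta>>0. \<exists>\<beta>1>0. \<forall>\<beta> \<sigma>. 0 < \<beta> \<longrightarrow> \<beta> < \<beta>1 \<longrightarrow> \<sigma> > 0 \<longrightarrow>
    (\<forall>x\<in>ball xbar \<sigma>. \<forall>\<epsilon>. x \<noteq> xbar \<longrightarrow> 0 \<le> \<epsilon> \<longrightarrow> \<epsilon> \<le> \<beta> * norm (x - xbar) \<longrightarrow>
      norm (goldstein_subgradient f \<epsilon> x) < \<sigma> \<longrightarrow> aligned f M \<theta> x \<epsilon>) \<longrightarrow>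
    (\<exists>\<rho>>0. \<exists>q. 0 < q \<and> q < 1 \<and> (\<forall>x\<in>ball xbar \<rho>. contracts f xbar q x (lipschitz_min_step f L \<beta> x)))"
proof -
  obtain \<rho>1 C1 where \<rho>1: "\<rho>1 > 0" and C1: "C1 \<ge> 1" and dist: "\<And>x \<epsilon>. x \<in> ball xbar \<rho>1 \<Longrightarrow> \<epsilon> \<ge> 0 \<Longrightarrow>
      \<epsilon> \<le> norm (x - xbar) \<Longrightarrow> norm (goldstein_subgradient f \<epsilon> x) < \<mu> / 2 \<Longrightarrow> infdist x M \<le> C1 * \<epsilon>"
    using infdist_le_if_small_subgradient by metis
  obtain \<rho>3 c1 where \<rho>3: "\<rho>3 > 0" and c1: "c1 > 0" and
    step: "\<forall>x\<in>ball xbar \<rho>3. x \<noteq> xbar \<longrightarrow> (\<exists>\<epsilon>. c1 * norm (x - xbar) \<le> \<epsilon> \<and> \<epsilon> \<le> norm (x - xbar) \<and>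
      \<epsilon> < norm (goldstein_subgradient f \<epsilon> x) \<and>
      (\<forall>\<beta>. lipschitz_min_step f L \<beta> x =
        x - (\<beta> * \<epsilon> / norm (goldstein_subgradient f (\<beta> * \<epsilon>) x)) *\<^sub>R goldstein_subgradient f (\<beta> * \<epsilon>) x))"
    using lipschitz_min_step_eq by blast
  \<comment> \<open>A lower bound for the cosine of the angle between the Riemannian gradient at
    \<open>p\<close> and \<open>p - xbar\<close>, from the two gradient estimates.\<close>
  define \<kappa> where "\<kappa> = c / C"
  have \<kappa>: "\<kappa> > 0" using pos by (simp add: \<kappa>_def)
  define \<eta> where "\<eta> = min 1 (\<kappa> / 4)"
  have \<eta>: "0 < \<eta>" "\<eta> \<le> 1" "\<eta> \<le> \<kappa> / 4" using \<kappa> by (auto simp: \<eta>_def)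
  define \<theta> where "\<theta> = arccos (1 - \<eta>\<^sup>2 / 2)"
  have \<theta>: "\<theta> > 0"
  proof -
    have "\<eta>\<^sup>2 \<le> 1" "\<eta>\<^sup>2 > 0" using \<eta> by (auto simp: power_le_one)
    then have "arccos 1 < arccos (1 - \<eta>\<^sup>2 / 2)" by (intro arccos_less_arccos) auto
    then show ?thesis by (simp add: \<theta>_def)
  qed
  \<comment> \<open>\<open>\<kappa> / 2\<close> keeps the quadratic term of the step below half of
    the linear gain, \<open>1 / (c1 * \<kappa>)\<close> keeps the root in \<open>q2\<close> real and
    positive, and the last bound makes \<open>x\<close> so close to \<open>M\<close> that
    \<open>(\<kappa> + 1) * d \<le> \<kappa> / 4 * r\<close>.\<close>
  define \<beta>1 where "\<beta>1 = min (min 1 (\<kappa> / 2)) (min (1 / (c1 * \<kappa>)) (\<kappa> / (4 * C1 * (\<kappa> + 1))))"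
  have \<beta>1: "\<beta>1 > 0" using \<kappa> c1 C1 by (simp add: \<beta>1_def)
  show ?thesis
  proof (rule exI[of _ \<theta>], rule conjI[OF \<theta>], rule exI[of _ \<beta>1], rule conjI[OF \<beta>1], intro allI impI)
    fix \<beta> \<sigma> :: real
    assume \<beta>: "0 < \<beta>" "\<beta> < \<beta>1" and \<sigma>: "\<sigma> > 0" and
      temp: "\<forall>x\<in>ball xbar \<sigma>. \<forall>\<epsilon>. x \<noteq> xbar \<longrightarrow> 0 \<le> \<epsilon> \<longrightarrow> \<epsilon> \<le> \<beta> * norm (x - xbar) \<longrightarrow>
        norm (goldstein_subgradient f \<epsilon> x) < \<sigma> \<longrightarrow> aligned f M \<theta> x \<epsilon>"
    have \<beta>': "\<beta> < 1" "\<beta> < \<kappa> / 2" "\<beta> * (c1 * \<kappa>) < 1" "C1 * \<beta> * (\<kappa> + 1) \<le> \<kappa> / 4"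
    proof -
      show "\<beta> < 1" "\<beta> < \<kappa> / 2" using \<beta> by (auto simp: \<beta>1_def)
      have "\<beta> < 1 / (c1 * \<kappa>)" using \<beta> by (auto simp: \<beta>1_def)
      then show "\<beta> * (c1 * \<kappa>) < 1" using c1 \<kappa> by (simp add: pos_less_divide_eq)
      have "\<beta> < \<kappa> / (4 * C1 * (\<kappa> + 1))" using \<beta> by (auto simp: \<beta>1_def)
      then have "\<beta> * (4 * C1 * (\<kappa> + 1)) < \<kappa>" using C1 \<kappa> by (subst (asm) pos_less_divide_eq) auto
      then show "C1 * \<beta> * (\<kappa> + 1) \<le> \<kappa> / 4" by (simp add: algebra_simps)
    qed
    define \<sigma>' where "\<sigma>' = min \<sigma> (\<mu> / 2)"
    have \<sigma>': "\<sigma>' > 0" using \<sigma> pos by (simp add: \<sigma>'_def)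
    \<comment> \<open>\<open>q1\<close> is the factor for function values: the decrease is at least
      \<open>\<beta> * c1 * \<sigma>' * r\<close> while the gap is at most \<open>L * r\<close>.
      Positivity of \<open>q\<close> rests on \<open>q2\<close>, the factor for distances.\<close>
    define q1 where "q1 = 1 - \<beta> * c1 * \<sigma>' / L"
    define q2 where "q2 = sqrt (1 - \<beta> * (c1 * \<kappa>) / 2)"
    define q where "q = max q1 q2"
    have q2: "0 < q2" "q2 < 1" using \<beta>'(3) \<beta> c1 \<kappa> by (auto simp: q2_def)
    have q: "0 < q" "q < 1" using q2 \<beta> c1 \<sigma>' pos by (auto simp: q_def q1_def)
    define \<rho> where "\<rho> = min (min \<rho>1 \<sigma>) (min \<rho>3 (R / 2))"
    have \<rho>: "\<rho> > 0" "\<rho> \<le> \<rho>1" "\<rho> \<le> \<sigma>" "\<rho> \<le> \<rho>3" "\<rho> \<le> R / 2" using \<rho>1 \<sigma> \<rho>3 pos by (auto simp: \<rho>_def)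
    have "contracts f xbar q x (lipschitz_min_step f L \<beta> x)" if x: "x \<in> ball xbar \<rho>" for x
    proof (cases "x = xbar")
      case True
      then show ?thesis by (simp add: contracts_def lipschitz_min_step_xbar)
    next
      case False
      define r where "r = norm (x - xbar)"
      have r: "r > 0" using False by (simp add: r_def)
      have xs: "x \<in> ball xbar \<rho>1" "x \<in> ball xbar \<sigma>" "x \<in> ball xbar \<rho>3" "x \<in> ball xbar R"
        using x \<rho> pos by auto
      from step xs(3) False obtain \<epsilon> where \<epsilon>: "c1 * r \<le> \<epsilon>" "\<epsilon> \<le> r" "\<epsilon> < norm (goldstein_subgradient f \<epsilon> x)"
        and eq: "\<And>\<beta>. lipschitz_min_step f L \<beta> x =
          x - (\<beta> * \<epsilon> / norm (goldstein_subgradient f (\<beta> * \<epsilon>) x)) *\<^sub>R goldstein_subgradient f (\<beta> * \<epsilon>) x"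
        unfolding r_def by blast
      have "c1 * r > 0" using c1 r by simp
      then have \<epsilon>0: "\<epsilon> > 0" using \<epsilon> by simp
      define s where "s = \<beta> * \<epsilon>"
      have s0: "s > 0" using \<beta> \<epsilon>0 by (simp add: s_def)
      have s\<epsilon>: "s \<le> \<epsilon>" using \<beta>'(1) \<epsilon>0 by (simp add: s_def)
      have s1: "s \<le> \<beta> * r" using \<epsilon> \<beta> by (simp add: s_def)
      have s2: "\<beta> * c1 * r \<le> s" using \<epsilon> \<beta> by (simp add: s_def)
      define g where "g = goldstein_subgradient f s x"
      define y where "y = lipschitz_min_step f L \<beta> x"
      have y: "y = x - (s / norm g) *\<^sub>R g" unfolding y_def eq g_def s_def ..
      have "norm (goldstein_subgradient f \<epsilon> x) \<le> norm g"
        unfolding g_def using s0 s\<epsilon> by (intro norm_goldstein_subgradient_antimono[OF lip]) auto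
      then have g: "norm g > 0" using \<epsilon> \<epsilon>0 by linarith
      have desc: "f y \<le> f x - s * norm g"
        unfolding y g_def using g s0 by (intro goldstein_descent[OF lip]) (auto simp: g_def)
      have "s * norm g > 0" using s0 g by simp
      with desc have dec: "f y \<le> f x" by simp
      have "norm (y - x) = s" using s0 g by (simp add: y)
      then have dist2: "norm (y - xbar) \<le> 2 * r"
        using norm_triangle_ineq[of "y - x" "x - xbar"] s\<epsilon> \<epsilon>(2) by (simp add: r_def)
      show ?thesis
      proof (cases "norm g < \<sigma>'")
        case False
        have "(\<beta> * c1 * r) * \<sigma>' \<le> s * norm g"
          using s2 False s0 \<sigma>' by (intro mult_mono) auto
        then have d: "f y - f xbar \<le> f x - f xbar - (\<beta> * c1 * \<sigma>') * r" using desc by (simp add: algebra_simps)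
        have "f x - f xbar \<le> L * r"
          using lipschitz_onD[OF lip, of x xbar] by (simp add: r_def dist_norm)
        then have "\<beta> * c1 * \<sigma>' / L * (f x - f xbar) \<le> \<beta> * c1 * \<sigma>' / L * (L * r)"
          using \<beta> c1 \<sigma>' pos by (intro mult_left_mono) auto
        also have "\<dots> = (\<beta> * c1 * \<sigma>') * r" using pos by simp
        finally have "f y - f xbar \<le> q1 * (f x - f xbar)" using d by (simp add: q1_def left_diff_distrib)
        also have "\<dots> \<le> q * (f x - f xbar)"
        proof -
          have "0 \<le> \<delta> / 2 * (norm (x - xbar))\<^sup>2" using pos by simp
          also have "\<dots> \<le> f x - f xbar" by (rule growth[OF xs(4)])
          finally show ?thesis by (intro mult_right_mono) (auto simp: q_def)
        qed
        finally show ?thesis using dist2 dec by (simp add: contracts_def y_def r_def)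
      next
        case True
        then have gs: "norm g < \<sigma>" "norm g < \<mu> / 2" by (auto simp: \<sigma>'_def)
        define p where "p = closest_point M x"
        define d where "d = infdist x M"
        have p: "p \<in> M" "norm (x - p) = d" "d \<le> r" using proj[OF xs(4)] by (auto simp: p_def d_def r_def)
        have "d \<le> C1 * s"
          unfolding d_def using gs s0 s\<epsilon> \<epsilon> xs by (intro dist) (auto simp: g_def r_def)
        also have "\<dots> \<le> C1 * (\<beta> * r)" using C1 s1 by (intro mult_left_mono) auto
        finally have d: "d \<le> C1 * \<beta> * r" by simp
        define G where "G = riemannian_gradient M f p"
        have ang: "g \<noteq> 0" "G \<noteq> 0" "vector_angle g G < \<theta>"
          using temp[rule_format, of x s] xs \<open>x \<noteq> xbar\<close> s0 s1 gs
          by (auto simp: aligned_def g_def G_def p_def r_def)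
        have hat: "norm (g /\<^sub>R norm g - G /\<^sub>R norm G) \<le> \<eta>"
          using ang \<eta> unfolding \<theta>_def by (intro norm_normalized_diff_le)
        have nG1: "norm (G /\<^sub>R norm G) = 1" using ang by simp
        define D where "D = norm (p - xbar)"
        have "D \<le> 2 * r" using norm_triangle_ineq4[of "x - xbar" "x - p"] p by (simp add: D_def r_def)
        moreover have "r < R / 2" using x \<rho> by (simp add: r_def dist_norm norm_minus_commute)
        ultimately have pR: "p \<in> ball xbar R" by (simp add: D_def dist_norm norm_minus_commute)
        have Dr: "r - d \<le> D" using norm_triangle_ineq2[of "x - xbar" "x - p"] p by (simp add: D_def r_def)
        have G1: "norm G \<le> C * D" and G2: "c * D\<^sup>2 \<le> G \<bullet> (p - xbar)"
          using gradient_le[OF p(1) pR] gradient_ge[OF p(1) pR] by (auto simp: G_def D_def)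
        have "(\<kappa> * D) * norm G \<le> (\<kappa> * D) * (C * D)"
          using G1 \<kappa> by (intro mult_left_mono) (auto simp: D_def)
        also have "\<dots> = c * D\<^sup>2" using pos by (simp add: \<kappa>_def power2_eq_square)
        finally have "\<kappa> * D \<le> (G \<bullet> (p - xbar)) / norm G"
          using G2 ang by (simp add: pos_le_divide_eq)
        also have "\<dots> = (G /\<^sub>R norm G) \<bullet> (p - xbar)" by (simp add: divide_inverse mult.commute)
        finally have 1: "\<kappa> * D \<le> (G /\<^sub>R norm G) \<bullet> (p - xbar)" .
        have 2: "- d \<le> (G /\<^sub>R norm G) \<bullet> (x - p)"
          using Cauchy_Schwarz_ineq2[of "G /\<^sub>R norm G" "x - p"] unfolding nG1 p(2) by linarith
        have "\<bar>(g /\<^sub>R norm g - G /\<^sub>R norm G) \<bullet> (x - xbar)\<bar> \<le> norm (g /\<^sub>R norm g - G /\<^sub>R norm G) * norm (x - xbar)"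
          by (rule Cauchy_Schwarz_ineq2)
        also have "\<dots> \<le> \<eta> * r" using hat by (auto simp: r_def intro!: mult_right_mono)
        finally have 3: "- (\<eta> * r) \<le> (g /\<^sub>R norm g - G /\<^sub>R norm G) \<bullet> (x - xbar)" by linarith
        \<comment> \<open>The first term is at least \<open>\<kappa> * (r - d)\<close>, the others
          lose at most \<open>d\<close> and \<open>\<eta> * r\<close>. By the choice of
          \<open>\<beta>1\<close> and \<open>\<eta>\<close>, half of \<open>\<kappa> * r\<close>
          remains.\<close>
        have split: "(g /\<^sub>R norm g) \<bullet> (x - xbar) = (G /\<^sub>R norm G) \<bullet> (p - xbar) + (G /\<^sub>R norm G) \<bullet> (x - p)
            + (g /\<^sub>R norm g - G /\<^sub>R norm G) \<bullet> (x - xbar)"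
          by (simp add: inner_diff_left inner_diff_right)
        have "\<kappa> * (r - d) \<le> \<kappa> * D" using Dr \<kappa> by (intro mult_left_mono) auto
        moreover have "\<kappa> * (r - d) - d - \<eta> * r \<ge> \<kappa> / 2 * r"
        proof -
          have "(\<kappa> + 1) * d \<le> (\<kappa> + 1) * (C1 * \<beta> * r)" using d \<kappa> by (intro mult_left_mono) auto
          also have "\<dots> = (C1 * \<beta> * (\<kappa> + 1)) * r" by simp
          also have "\<dots> \<le> \<kappa> / 4 * r" using \<beta>'(4) r by (intro mult_right_mono) auto
          finally have "(\<kappa> + 1) * d \<le> \<kappa> / 4 * r" .
          moreover have "\<eta> * r \<le> \<kappa> / 4 * r" using \<eta> r by (intro mult_right_mono) auto
          ultimately show ?thesis by (simp add: algebra_simps)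
        qed
        ultimately have acute: "\<kappa> / 2 * r \<le> (g /\<^sub>R norm g) \<bullet> (x - xbar)"
          using 1 2 3 split by linarith
        have e1: "y - xbar = (x - xbar) - s *\<^sub>R (g /\<^sub>R norm g)" by (simp add: y divide_inverse)
        have e2: "(norm (a - s *\<^sub>R b))\<^sup>2 = (norm a)\<^sup>2 - 2 * s * (b \<bullet> a) + s\<^sup>2 * (norm b)\<^sup>2" for a b :: 'a
          unfolding power2_norm_eq_inner
          by (simp add: inner_diff_left inner_diff_right inner_commute[of a b] power2_eq_square right_diff_distrib)
        have "norm (g /\<^sub>R norm g) = 1" using ang by simp
        then have "(norm (y - xbar))\<^sup>2 = r\<^sup>2 - 2 * s * ((g /\<^sub>R norm g) \<bullet> (x - xbar)) + s\<^sup>2"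
          unfolding e1 e2 r_def by (simp only: power_one mult_1_right)
        also have "\<dots> \<le> r\<^sup>2 - 2 * s * (\<kappa> / 2 * r) + s * (\<kappa> / 2 * r)"
        proof -
          have "2 * s * (\<kappa> / 2 * r) \<le> 2 * s * ((g /\<^sub>R norm g) \<bullet> (x - xbar))"
            using acute s0 by (intro mult_left_mono) auto
          moreover have "s * s \<le> s * (\<kappa> / 2 * r)"
          proof -
            have "\<beta> * r \<le> \<kappa> / 2 * r" using \<beta>'(2) r by (intro mult_right_mono) auto
            then show ?thesis using s0 s1 by (intro mult_left_mono) auto
          qed
          ultimately show ?thesis unfolding power2_eq_square[of s] by linarith
        qed
        also have "\<dots> = r\<^sup>2 - s * (\<kappa> / 2 * r)" by simp
        also have "\<dots> \<le> r\<^sup>2 - (\<beta> * c1 * r) * (\<kappa> / 2 * r)"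
        proof -
          have "(\<beta> * c1 * r) * (\<kappa> / 2 * r) \<le> s * (\<kappa> / 2 * r)"
            using s2 \<kappa> r by (intro mult_right_mono) auto
          then show ?thesis by linarith
        qed
        also have "\<dots> = (1 - \<beta> * (c1 * \<kappa>) / 2) * r\<^sup>2" by (simp add: power2_eq_square algebra_simps)
        also have "\<dots> = (q2 * r)\<^sup>2" using \<beta>'(3) by (simp add: q2_def power_mult_distrib)
        finally have "norm (y - xbar) \<le> q2 * r"
          by (rule power2_le_imp_le) (use q2 r in simp)
        also have "\<dots> \<le> q * r" using r by (intro mult_right_mono) (auto simp: q_def)
        finally show ?thesis using dist2 dec by (simp add: contracts_def y_def r_def)
      qed
    qed
    then show "\<exists>\<rho>>0. \<exists>q. 0 < q \<and> q < 1 \<and>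
        (\<forall>x\<in>ball xbar \<rho>. contracts f xbar q x (lipschitz_min_step f L \<beta> x))"
      using \<rho>(1) q by blast
  qed
qed

text \<open>A step may double the distance, so the contraction property alone does not confine the
  iterates. It does keep the next point within \<open>2 * \<rho>'\<close>, where quadratic growth is
  valid, and there the monotone decrease of \<open>f\<close> forces it back into the ball of radius
  \<open>\<rho>'\<close>.\<close>

lemma iterates_nearly_linear:
  assumes \<rho>: "\<rho> > 0" and q: "0 < q" "q < 1"
    and step: "\<forall>x\<in>ball xbar \<rho>. contracts f xbar q x (lipschitz_min_step f L \<beta> x)"
  shows "\<forall>\<^sub>F x0 in nhds xbar. \<exists>a>0. \<exists>b>0. \<forall>r.
    norm (lipschitz_min_iterates f L \<beta> x0 r - xbar) \<le> a * exp (- b * sqrt (real r))"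
proof -
  define \<rho>' where "\<rho>' = min \<rho> R / 2"
  have \<rho>': "\<rho>' > 0" "\<rho>' < \<rho>" "2 * \<rho>' \<le> R" using \<rho> pos by (auto simp: \<rho>'_def)
  \<comment> \<open>Makes the initial gap smaller than the quadratic growth bound at distance
    \<open>\<rho>'\<close>.\<close>
  define \<tau> where "\<tau> = min \<rho>' (\<delta> / 2 * \<rho>'\<^sup>2 / L)"
  have \<tau>: "\<tau> > 0" using \<rho>' pos by (simp add: \<tau>_def)
  have "\<exists>a>0. \<exists>b>0. \<forall>r. norm (lipschitz_min_iterates f L \<beta> x0 r - xbar) \<le> a * exp (- b * sqrt (real r))"
    if x0: "dist x0 xbar < \<tau>" for x0
  proof -
    define X where "X r = lipschitz_min_iterates f L \<beta> x0 r" for r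
    have X0: "X 0 = x0" and XS: "X (Suc r) = lipschitz_min_step f L \<beta> (X r)" for r
      by (auto simp: X_def lipschitz_min_iterates_def)
    have Lip: "f x - f xbar \<le> L * norm (x - xbar)" for x
      using lipschitz_onD[OF lip, of x xbar] by (simp add: dist_norm)
    have "f x0 - f xbar \<le> L * norm (x0 - xbar)" by (rule Lip)
    also have "\<dots> < L * (\<delta> / 2 * \<rho>'\<^sup>2 / L)"
      using x0 pos by (intro mult_strict_left_mono) (auto simp: \<tau>_def dist_norm)
    finally have F0: "f x0 - f xbar < \<delta> / 2 * \<rho>'\<^sup>2" using pos by simp
    have inv: "norm (X r - xbar) < \<rho>' \<and> f (X r) \<le> f x0" for r
    proof (induction r)
      case 0
      then show ?case using x0 by (simp add: X0 \<tau>_def dist_norm)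
    next
      case (Suc r)
      then have "X r \<in> ball xbar \<rho>" using \<rho>' by (simp add: dist_norm norm_minus_commute)
      note st = bspec[OF step this, unfolded contracts_def, folded XS]
      have "norm (X (Suc r) - xbar) < 2 * \<rho>'" using st Suc by linarith
      then have inR: "X (Suc r) \<in> ball xbar R" using \<rho>' by (simp add: dist_norm norm_minus_commute)
      have le: "f (X (Suc r)) \<le> f x0" using st Suc by linarith
      have "\<delta> / 2 * (norm (X (Suc r) - xbar))\<^sup>2 < \<delta> / 2 * \<rho>'\<^sup>2"
        using growth[OF inR] le F0 by linarith
      then have "(norm (X (Suc r) - xbar))\<^sup>2 < \<rho>'\<^sup>2" using pos by simp
      then have "norm (X (Suc r) - xbar) < \<rho>'" by (rule power2_less_imp_less) (use \<rho>' in simp)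
      with le show ?case by simp
    qed
    have inb: "X r \<in> ball xbar \<rho>" "X r \<in> ball xbar R" for r
      using inv[of r] \<rho>' by (auto simp: dist_norm norm_minus_commute)
    have "\<exists>a>0. \<exists>b>0. \<forall>r. norm (X r - xbar) \<le> a * exp (- b * sqrt (real r))"
    proof (rule nearly_linear_rate[where F="\<lambda>r. f (X r) - f xbar" and c="\<delta> / 2" and L=L and q=q])
      show "\<delta> / 2 * (norm (X r - xbar))\<^sup>2 \<le> f (X r) - f xbar" for r by (rule growth[OF inb(2)])
      show "f (X r) - f xbar \<le> L * norm (X r - xbar)" for r by (rule Lip)
      show "f (X (Suc r)) - f xbar \<le> f (X r) - f xbar" for r
        using bspec[OF step inb(1), of r] by (simp add: XS contracts_def)
      show "f (X (Suc r)) - f xbar \<le> q * (f (X r) - f xbar) \<or> norm (X (Suc r) - xbar) \<le> q * norm (X r - xbar)" for r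
        using bspec[OF step inb(1), of r] by (simp add: XS contracts_def)
    qed (use pos q in auto)
    then show ?thesis by (simp add: X_def)
  qed
  then show ?thesis using \<tau> by (auto simp: eventually_nhds_metric)
qed

end

text \<open>Violating pairs for all \<open>\<sigma> = 1 / (n + 1)\<close> would form sequences
  contradicting the hypothesis. The property \<open>P\<close> will be
  \<open>aligned f M \<theta>\<close>.\<close>

lemma tempered_uniform:
  fixes f :: "'a::euclidean_space \<Rightarrow> real"
  assumes temp: "\<forall>(x :: nat \<Rightarrow> 'a) \<epsilon>.
        (\<forall>r. x r \<noteq> xbar) \<and> x \<longlonglongrightarrow> xbar \<and>
        (\<forall>r. 0 \<le> \<epsilon> r \<and> \<epsilon> r \<le> \<beta> * norm (x r - xbar)) \<and>
        (\<lambda>r. goldstein_subgradient f (\<epsilon> r) (x r)) \<longlonglongrightarrow> 0 \<longrightarrow>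
        (\<forall>\<^sub>F r in sequentially. P (x r) (\<epsilon> r))"
  shows "\<exists>\<sigma>>0. \<forall>x\<in>ball xbar \<sigma>. \<forall>\<epsilon>. x \<noteq> xbar \<longrightarrow> 0 \<le> \<epsilon> \<longrightarrow> \<epsilon> \<le> \<beta> * norm (x - xbar) \<longrightarrow>
    norm (goldstein_subgradient f \<epsilon> x) < \<sigma> \<longrightarrow> P x \<epsilon>"
proof (rule ccontr)
  assume contra: "\<not> ?thesis"
  have "\<exists>x \<epsilon>. dist x xbar < 1 / Suc n \<and> x \<noteq> xbar \<and> 0 \<le> \<epsilon> \<and> \<epsilon> \<le> \<beta> * norm (x - xbar) \<and>
    norm (goldstein_subgradient f \<epsilon> x) < 1 / Suc n \<and> \<not> P x \<epsilon>" for n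
  proof -
    have "1 / real (Suc n) > 0" by simp
    with contra have "\<not> (\<forall>x\<in>ball xbar (1 / Suc n). \<forall>\<epsilon>. x \<noteq> xbar \<longrightarrow> 0 \<le> \<epsilon> \<longrightarrow> \<epsilon> \<le> \<beta> * norm (x - xbar) \<longrightarrow>
      norm (goldstein_subgradient f \<epsilon> x) < 1 / Suc n \<longrightarrow> P x \<epsilon>)"
      by blast
    then obtain x \<epsilon> where "x \<in> ball xbar (1 / Suc n)" "x \<noteq> xbar" "0 \<le> \<epsilon>" "\<epsilon> \<le> \<beta> * norm (x - xbar)"
      "norm (goldstein_subgradient f \<epsilon> x) < 1 / Suc n" "\<not> P x \<epsilon>"
      by blast
    then show ?thesis by (intro exI[of _ x] exI[of _ \<epsilon>]) (simp add: dist_commute)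
  qed
  then obtain x \<epsilon> where x: "\<And>n. dist (x n) xbar < 1 / Suc n" "\<And>n. x n \<noteq> xbar"
    "\<And>n. 0 \<le> \<epsilon> n" "\<And>n. \<epsilon> n \<le> \<beta> * norm (x n - xbar)"
    "\<And>n. norm (goldstein_subgradient f (\<epsilon> n) (x n)) < 1 / Suc n" "\<And>n. \<not> P (x n) (\<epsilon> n)"
    by metis
  have "x \<longlonglongrightarrow> xbar" using x(1) by (rule LIMSEQ_if_dist_less)
  moreover have "(\<lambda>n. goldstein_subgradient f (\<epsilon> n) (x n)) \<longlonglongrightarrow> 0"
    by (rule LIMSEQ_if_dist_less) (use x(5) in simp)
  ultimately have "\<forall>\<^sub>F n in sequentially. P (x n) (\<epsilon> n)"
    using temp x(2-4) by blast
  then show False using x(6) by (auto simp: eventually_sequentially)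
qed

lemma robust_growth_if_grows_robustly:
  fixes f :: "'a::euclidean_space \<Rightarrow> real"
  assumes M: "C2_manifold_around M xbar" and "L > 0" and f: "L-lipschitz_on UNIV f"
    and grow: "grows_robustly f M xbar"
  shows "\<exists>K \<mu> c C \<delta> R. robust_growth f M xbar L K \<mu> c C \<delta> R"
proof -
  obtain \<delta> K \<mu> where \<delta>: "\<delta> > 0" "\<forall>\<^sub>F x in nhds xbar. f x - f xbar \<ge> \<delta> / 2 * (norm (x - xbar))\<^sup>2"
    and reg: "\<forall>x\<in>M. subdifferentially_regular f x" and C2: "C2_on_manifold_around M f xbar"
    and K: "K > 0" "\<forall>\<^sub>F (x, y) in nhds xbar \<times>\<^sub>F nhds xbar. x \<in> M \<longrightarrow>
        clarke_subdifferential f y \<subseteq>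
          {u + w |u w. u \<in> clarke_subdifferential f x \<and> w \<in> cball 0 (K * norm (x - y))}"
    and \<mu>: "\<mu> > 0" "\<forall>\<^sub>F x in nhds xbar. \<forall>v\<in>clarke_subdifferential f x.
        v \<bullet> (x - closest_point M x) \<ge> \<mu> * infdist x M"
    using grow unfolding grows_robustly_def by blast
  have xM: "xbar \<in> M" using M by (simp add: C2_manifold_around_def)
  from manifold_growth_structure[OF M f reg C2 \<delta>] obtain c C \<rho>1 where c: "c > 0" and C: "C > 0"
    and T: "\<forall>\<eta>>0. \<exists>\<rho>>0. \<forall>p\<in>M \<inter> ball xbar \<rho>. \<forall>q\<in>M \<inter> ball xbar \<rho>.
        \<exists>w\<in>tangent_space M q. norm (p - q - w) \<le> \<eta> * norm (p - q)"
    and \<rho>1: "\<rho>1 > 0" and G: "\<forall>q\<in>M \<inter> ball xbar \<rho>1. norm (riemannian_gradient M f q) \<le> C * norm (q - xbar) \<and>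
        c * (norm (q - xbar))\<^sup>2 \<le> riemannian_gradient M f q \<bullet> (q - xbar) \<and>
        (\<forall>u\<in>clarke_subdifferential f q. \<forall>w\<in>tangent_space M q. u \<bullet> w = riemannian_gradient M f q \<bullet> w)"
    by (elim exE conjE)
  obtain \<rho>2 where \<rho>2: "\<rho>2 > 0" and P: "\<forall>y\<in>ball xbar \<rho>2. closest_point M y \<in> M \<and>
    norm (y - closest_point M y) = infdist y M \<and> infdist y M \<le> norm (y - xbar)"
    using closest_point_near_manifold[OF M] by (elim exE conjE)
  obtain \<rho>3 where \<rho>3: "\<rho>3 > 0" "\<And>x. dist x xbar < \<rho>3 \<Longrightarrow> f x - f xbar \<ge> \<delta> / 2 * (norm (x - xbar))\<^sup>2"
    using \<delta>(2) unfolding eventually_nhds_metric by blast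
  obtain \<rho>4 where \<rho>4: "\<rho>4 > 0" "\<And>x v. dist x xbar < \<rho>4 \<Longrightarrow> v \<in> clarke_subdifferential f x \<Longrightarrow>
      v \<bullet> (x - closest_point M x) \<ge> \<mu> * infdist x M"
    using \<mu>(2) unfolding eventually_nhds_metric by blast
  obtain P1 P2 where P12: "eventually P1 (nhds xbar)" "eventually P2 (nhds xbar)"
    "\<And>x y. P1 x \<Longrightarrow> P2 y \<Longrightarrow> x \<in> M \<Longrightarrow> clarke_subdifferential f y \<subseteq>
          {u + w |u w. u \<in> clarke_subdifferential f x \<and> w \<in> cball 0 (K * norm (x - y))}"
    using K(2) unfolding eventually_prod_filter by (auto simp only: prod.case)
  have "\<forall>\<^sub>F x in nhds xbar. P1 x \<and> P2 x" using P12(1,2) by (rule eventually_conj)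
  then obtain \<rho>5 where \<rho>5: "\<rho>5 > 0" "\<And>x. dist x xbar < \<rho>5 \<Longrightarrow> P1 x \<and> P2 x"
    unfolding eventually_nhds_metric by blast
  define R where "R = min (min \<rho>1 \<rho>2) (min \<rho>3 (min \<rho>4 \<rho>5))"
  have R: "R > 0" using \<rho>1 \<rho>2 \<rho>3 \<rho>4 \<rho>5 by (simp add: R_def)
  have R1: "x \<in> ball xbar \<rho>1" "x \<in> ball xbar \<rho>2" "dist x xbar < \<rho>3" "dist x xbar < \<rho>4" "dist x xbar < \<rho>5"
    if "x \<in> ball xbar R" for x
    using that by (auto simp: R_def dist_commute)
  have min: "\<forall>\<^sub>F y in nhds xbar. f xbar \<le> f y"
    using \<delta>(2)
  proof eventually_elim
    case (elim y)
    have "0 \<le> \<delta> / 2 * (norm (y - xbar))\<^sup>2" using \<delta>(1) by simp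
    with elim show ?case by linarith
  qed
  have "robust_growth f M xbar L K \<mu> c C \<delta> R"
  proof
    show "0 \<in> clarke_subdifferential f xbar"
      by (rule zero_in_clarke_local_min[OF bspec[OF reg xM] min])
    show "\<exists>u\<in>clarke_subdifferential f x. norm (v - u) \<le> K * norm (x - y)"
      if xy: "x \<in> M" "x \<in> ball xbar R" "y \<in> ball xbar R" "v \<in> clarke_subdifferential f y" for x y v
    proof -
      have "v \<in> {u + w |u w. u \<in> clarke_subdifferential f x \<and> w \<in> cball 0 (K * norm (x - y))}"
        using P12(3)[of x y] \<rho>5(2)[OF R1(5)[OF xy(2)]] \<rho>5(2)[OF R1(5)[OF xy(3)]] xy(1,4) by blast
      then obtain u w where "v = u + w" "u \<in> clarke_subdifferential f x" "norm w \<le> K * norm (x - y)"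
        by auto
      then show ?thesis by (intro bexI[of _ u]) auto
    qed
    show "\<exists>\<rho>>0. \<forall>p\<in>M \<inter> ball xbar \<rho>. \<forall>q\<in>M \<inter> ball xbar \<rho>.
      \<exists>w\<in>tangent_space M q. norm (p - q - w) \<le> \<eta> * norm (p - q)" if "\<eta> > 0" for \<eta>
      using T that by blast
  qed (use f \<open>L > 0\<close> \<delta> K(1) \<mu>(1) c C R xM P G \<rho>3(2) \<rho>4(2) R1 in simp_all)
  then show ?thesis by blast
qed

theorem theorem7p6:
  fixes f :: "'a::euclidean_space \<Rightarrow> real" and M :: "'a set" and xbar :: 'a and L :: real
  assumes "C2_manifold_around M xbar"
    and "L > 0"
    and "L-lipschitz_on UNIV f"
    and "grows_robustly f M xbar"
    and "tempered_growth f M xbar"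
  shows "\<forall>\<^sub>F \<beta> in at_right 0. \<forall>\<^sub>F x0 in nhds xbar.
           \<exists>a>0. \<exists>b>0. \<forall>r. norm (lipschitz_min_iterates f L \<beta> x0 r - xbar) \<le> a * exp (- b * sqrt (real r))"
proof -
  obtain K \<mu> c C \<delta> R where "robust_growth f M xbar L K \<mu> c C \<delta> R"
    using robust_growth_if_grows_robustly[OF assms(1-4)] by (elim exE)
  then interpret robust_growth f M xbar L K \<mu> c C \<delta> R .
  from step_contracts obtain \<theta> \<beta>1 where \<theta>: "\<theta> > 0" and \<beta>1: "\<beta>1 > 0" and
    step: "\<forall>\<beta> \<sigma>. 0 < \<beta> \<longrightarrow> \<beta> < \<beta>1 \<longrightarrow> \<sigma> > 0 \<longrightarrow>
      (\<forall>x\<in>ball xbar \<sigma>. \<forall>\<epsilon>. x \<noteq> xbar \<longrightarrow> 0 \<le> \<epsilon> \<longrightarrow> \<epsilon> \<le> \<beta> * norm (x - xbar) \<longrightarrow>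
        norm (goldstein_subgradient f \<epsilon> x) < \<sigma> \<longrightarrow> aligned f M \<theta> x \<epsilon>) \<longrightarrow>
      (\<exists>\<rho>>0. \<exists>q. 0 < q \<and> q < 1 \<and> (\<forall>x\<in>ball xbar \<rho>. contracts f xbar q x (lipschitz_min_step f L \<beta> x)))"
    by (elim exE conjE)
  have "\<forall>\<^sub>F \<beta> in at_right 0. \<beta> \<in> {0<..<\<beta>1}"
    using \<beta>1 by (rule eventually_at_right_real)
  \<comment> \<open>Tempered growth is used at the single angle \<open>\<theta>\<close> fixed above;
    for each small \<open>\<beta>\<close> it then supplies the threshold
    \<open>\<sigma>\<close>.\<close>
  moreover note assms(5)[unfolded tempered_growth_def, rule_format, OF \<theta>, folded aligned_def]
  ultimately show ?thesis
  proof eventually_elim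
    case (elim \<beta>)
    have \<beta>: "0 < \<beta>" "\<beta> < \<beta>1" using elim(1) by auto
    obtain \<sigma> where \<sigma>: "\<sigma> > 0" and
      "\<forall>x\<in>ball xbar \<sigma>. \<forall>\<epsilon>. x \<noteq> xbar \<longrightarrow> 0 \<le> \<epsilon> \<longrightarrow> \<epsilon> \<le> \<beta> * norm (x - xbar) \<longrightarrow>
        norm (goldstein_subgradient f \<epsilon> x) < \<sigma> \<longrightarrow> aligned f M \<theta> x \<epsilon>"
      using tempered_uniform[OF elim(2)] by (elim exE conjE)
    with step \<beta> have "\<exists>\<rho>>0. \<exists>q. 0 < q \<and> q < 1 \<and>
        (\<forall>x\<in>ball xbar \<rho>. contracts f xbar q x (lipschitz_min_step f L \<beta> x))"
      by blast
    then obtain \<rho> q where "\<rho> > 0" "0 < q" "q < 1"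
      "\<forall>x\<in>ball xbar \<rho>. contracts f xbar q x (lipschitz_min_step f L \<beta> x)"
      by (elim exE conjE)
    then show ?case by (rule iterates_nearly_linear)
  qed
qed

end
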